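(* Let $u, v \in H^2(\mathbb{T})$ be an admissible Toeplitz pair with $v$ outer. The following are equivalent. (a) $T_uT_{\overline{v}}: H^2(\mathbb{T})\to H^2(\mathbb{T})$ is bounded. (b) $P_R: L^2\left(\mathbb{T},\frac{1}{|v|^2}\right)\to L^2\left(\mathbb{T},|u|^2\right)$ is bounded. (c) $uv\in L^\infty(\mathbb{T})$. (d) $\sup_{|w|<1}P_w\left(|u|^2\right)P_w\left(|v|^2\right)<\infty$. (e) $|u|^2\,dm$ is a Carleson measure for the space $\operatorname{ran}\tilde{T}_{\overline{v}}$.
   Context: $\mathbb{D}$ is the open unit disc, $\mathbb{T}$ the unit circle, $m$ normalised Lebesgue measure on $\mathbb{T}$, $L^p(\mathbb{T}) = L^p(\mathbb{T}, m)$. $B_\epsilon(\zeta)$ is the open ball of radius $\epsilon$ centred at $\zeta$ in $\mathbb{C}$. For $0<p<\infty$, $H^p(\mathbb{T})$ is the Hardy space of analytic functions on $\mathbb{D}$, identified with their radial boundary values on $\mathbb{T}$ and hence viewed inside $L^p(\mathbb{T})$. For a set $X$ of analytic functions, $\overline{X}$ is the set of their complex conjugates; $zH^2(\mathbb{T})=\{z h(z): h\in H^2(\mathbb{T})\}$. $P_w(\rho)=\int_{\mathbb{T}}\frac{1-|w|^2}{|\zeta-w|^2}\rho(\zeta)\,dm(\zeta)$ is the Poisson extension of $\rho\in L^1(\mathbb{T})$ at $w\in\mathbb{D}$. $H(\mathbb{T})$ is the space of holomorphic functions on $\mathbb{D}$ that have a.e. defined radial boundary values on $\mathbb{T}$.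 Elements of $H(\mathbb{T})$ are also regarded as functions on $\mathbb{T}$ through these boundary values. Riesz projection: for $f \in L^1(\mathbb{T})$, $(Pf)(z)=\int_{\mathbb{T}} \frac{f(\zeta)}{1-\overline{\zeta}z}\,dm(\zeta)$, $z\in\mathbb{D}$; $P$ maps $L^1(\mathbb{T})$ into $H^s(\mathbb{T})$ for every $0<s<1$, so $Pf$ has a.e. radial boundary values. For a weight $\rho$, $L^2(\mathbb{T},\rho)$ is the space of measurable $g$ with $\int_{\mathbb{T}}|g|^2\rho\,dm<\infty$; since $g \in L^2(\mathbb{T},1/|v|^2)$ means $g=vf$ with $f\in L^2(\mathbb{T})$, such $g$ lie in $L^1(\mathbb{T})$. $P_R$ is the two-weighted Riesz projection $g\mapsto Pg$; it is bounded if there is $C>0$ with $\int_{\mathbb{T}}|Pg|^2|u|^2\,dm\le C\int_{\mathbb{T}}|g|^2\frac{1}{|v|^2}\,dm$ for all $g\in L^2(\mathbb{T},1/|v|^2)$. Toeplitz product: for $f\in H^2(\mathbb{T})$, $T_uT_{\overline v} f := u\,P(\overline{v}f)$, an element of $H(\mathbb{T})$. Range space: for $v\in H^2(\mathbb{T})$ outer and $0<s<1$, $\tilde{T}_{\overline{v}}: H^2(\mathbb{T})\to H^s(\mathbb{T})$ is $\tilde{T}_{\overline{v}}f=P(\overline{v}f)$, which is injective. $\operatorname{ran}\tilde{T}_{\overline{v}}$ is equipped with the inner product $\langle \tilde{T}_{\overline{v}}f,\tilde{T}_{\overline{v}}g\rangle_{\operatorname{ran}}:=\langle f,g\rangle_{H^2}$,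 making it a Hilbert space of analytic functions on $\mathbb{D}$. Carleson measure: a positive finite Borel measure $\mu$ on the closed unit disc is a Carleson measure for a Hilbert space $\mathcal{H}$ of analytic functions on $\mathbb{D}$ if there is $C>0$ with $\|f\|_{\mu}\le C\|f\|_{\mathcal{H}}$ for all $f\in\mathcal{H}$, where $\|f\|_\mu$ is the $L^2(\mu)$ norm. Here $|u|^2\,dm$ is carried by $\mathbb{T}$ and functions in $\operatorname{ran}\tilde{T}_{\overline{v}}$ are evaluated on $\mathbb{T}$ through radial boundary values. Poles: $\zeta \in \mathbb{T}$ is a pole of $f \in H(\mathbb{T})$ if for all $\epsilon>0$, $f \notin L^\infty(B_\epsilon(\zeta)\cap\mathbb{T})$. Write $v \in L^2(\mathbb{T})$ as $v=\overline{v_-}+v_+$ with $v_+ \in H^2(\mathbb{T})$ and $\overline{v_-}\in\overline{zH^2(\mathbb{T})}$; the poles of $v$ are the union of the poles of $v_-$ and of $v_+$. A pole $\zeta$ of $f$ is simple if there is $n \in \mathbb{N}$ such that $(z-\zeta)^n f(z) \in L^\infty(\mathbb{T}\cap B_\epsilon(\zeta))$ for some $\epsilon>0$; the smallest such $n$ is the order of the pole. The same terminology is used for $f=v\in L^2(\mathbb{T})$. Admissible Toeplitz pair: $u \in H(\mathbb{T})$, $v \in L^2(\mathbb{T})$ are an admissible Toeplitz pair if (i) both $u$ and $v$ have finitely many poles, each pole being simple; (ii) $u$ is analytic at the poles of $v$; (iii) writing $v=\overline{v_-}+v_+$ with $v_+ \in H^2(\mathbb{T})$ and $\overline{v_-}\in\overline{zH^2(\mathbb{T})}$,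 both $v_-$ and $v_+$ are analytic at the poles of $u$; (iv) one of the following holds: (1) $v \in \overline{H^2(\mathbb{T})}$; or (2) for every $t \in \mathbb{T}$ which is a pole of $u$ of order $j$ and for all $0\le i<j$, whenever the function $\frac{v(z)}{(z-t)^i}$ has value $0$ at $t$, the functions $\frac{v_+(z)}{(z-t)^i}$ and $\frac{\overline{v_-(z)}}{(z-t)^i}$ also have value $0$ at $t$ (values at $t$ being understood as limits as $z\to t$ along $\mathbb{T}$). *)

theory Defs
  imports "HOL-Analysis.Analysis"
begin

text \<open>
  Functions on the open unit disc and functions on the unit circle both have type
  \<open>complex \<Rightarrow> complex\<close>. For the former only the values on \<open>ball 0 1\<close> matter, for the latter only
  the values on \<open>sphere 0 1\<close>; \<open>bv\<close> passes from the disc to the circle.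
\<close>

abbreviation unit_disc :: "complex set" where "unit_disc \<equiv> ball 0 1"
abbreviation unit_circle :: "complex set" where "unit_circle \<equiv> sphere 0 1"

text \<open>Normalised Lebesgue measure, on the Borel subsets of the circle.\<close>

definition circle_measure :: "complex measure" where
  "circle_measure =
     distr (uniform_measure lborel {0..<2 * pi}) (restrict_space borel unit_circle) cis"

definition weighted_L2 :: "(complex \<Rightarrow> real) \<Rightarrow> (complex \<Rightarrow> complex) set" where
  "weighted_L2 \<rho> = {g \<in> borel_measurable circle_measure.
     (\<integral>\<^sup>+\<zeta>. ennreal ((cmod (g \<zeta>))\<^sup>2 * \<rho> \<zeta>) \<partial>circle_measure) < \<infinity>}"

abbreviation circle_L2 :: "(complex \<Rightarrow> complex) set" where
  "circle_L2 \<equiv> weighted_L2 (\<lambda>_. 1)"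

definition Linfty_on :: "complex set \<Rightarrow> (complex \<Rightarrow> complex) set" where
  "Linfty_on E = {f. set_borel_measurable circle_measure E f \<and>
     (\<exists>M. AE \<zeta> in circle_measure. \<zeta> \<in> E \<longrightarrow> cmod (f \<zeta>) \<le> M)}"

text \<open>
  Radial boundary values. Where the radial limit does not exist, \<open>Lim\<close> returns a fixed
  unspecified number.
\<close>

definition bv :: "(complex \<Rightarrow> complex) \<Rightarrow> complex \<Rightarrow> complex" where
  "bv f \<zeta> = Lim (at_left (1::real)) (\<lambda>r. f (of_real r * \<zeta>))"

definition radial_bv_space :: "(complex \<Rightarrow> complex) set" where
  "radial_bv_space = {f. f holomorphic_on unit_disc \<and>
     (AE \<zeta> in circle_measure. \<exists>l. ((\<lambda>r. f (of_real r * \<zeta>)) \<longlongrightarrow> l) (at_left (1::real)))}"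

definition hardy :: "real \<Rightarrow> (complex \<Rightarrow> complex) set" where
  "hardy p = {f. f holomorphic_on unit_disc \<and>
     bdd_above ((\<lambda>r. LINT \<zeta>|circle_measure. cmod (f (of_real r * \<zeta>)) powr p) ` {0..<1})}"

text \<open>The inner product and norm that \<open>hardy 2\<close> carries as a subspace of \<open>L\<^sup>2\<close> of the circle.\<close>

definition hardy2_inner :: "(complex \<Rightarrow> complex) \<Rightarrow> (complex \<Rightarrow> complex) \<Rightarrow> complex" where
  "hardy2_inner f g = (LINT \<zeta>|circle_measure. bv f \<zeta> * cnj (bv g \<zeta>))"

definition hardy2_norm :: "(complex \<Rightarrow> complex) \<Rightarrow> real" where
  "hardy2_norm f = sqrt (LINT \<zeta>|circle_measure. (cmod (bv f \<zeta>))\<^sup>2)"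

definition outer :: "(complex \<Rightarrow> complex) \<Rightarrow> bool" where
  "outer f \<longleftrightarrow> (\<exists>c \<phi>. cmod c = 1 \<and> \<phi> \<in> borel_measurable circle_measure \<and>
     (\<forall>\<zeta>\<in>unit_circle. 0 < \<phi> \<zeta>) \<and> integrable circle_measure (\<lambda>\<zeta>. ln (\<phi> \<zeta>)) \<and>
     (\<forall>z\<in>unit_disc.
        f z = c * exp (LINT \<zeta>|circle_measure. (\<zeta> + z) / (\<zeta> - z) * of_real (ln (\<phi> \<zeta>)))))"

definition poisson :: "(complex \<Rightarrow> real) \<Rightarrow> complex \<Rightarrow> real" where
  "poisson \<rho> w = (LINT \<zeta>|circle_measure. (1 - (cmod w)\<^sup>2) / (cmod (\<zeta> - w))\<^sup>2 * \<rho> \<zeta>)"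

definition riesz_proj :: "(complex \<Rightarrow> complex) \<Rightarrow> complex \<Rightarrow> complex" where
  "riesz_proj f z = (LINT \<zeta>|circle_measure. f \<zeta> / (1 - cnj \<zeta> * z))"

text \<open>
  In the following operators the symbol \<open>v\<close> is a function on the circle, while \<open>u\<close>, the argument
  \<open>f\<close> and the result are functions on the disc.
\<close>

definition conj_toeplitz :: "(complex \<Rightarrow> complex) \<Rightarrow> (complex \<Rightarrow> complex) \<Rightarrow> complex \<Rightarrow> complex" where
  "conj_toeplitz v f = riesz_proj (\<lambda>\<zeta>. cnj (v \<zeta>) * bv f \<zeta>)"

definition toeplitz_product ::
  "(complex \<Rightarrow> complex) \<Rightarrow> (complex \<Rightarrow> complex) \<Rightarrow> (complex \<Rightarrow> complex) \<Rightarrow> complex \<Rightarrow> complex" where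
  "toeplitz_product u v f = (\<lambda>z. u z * conj_toeplitz v f z)"

definition hardy2_bounded :: "((complex \<Rightarrow> complex) \<Rightarrow> (complex \<Rightarrow> complex)) \<Rightarrow> bool" where
  "hardy2_bounded A \<longleftrightarrow> (\<forall>f\<in>hardy 2. A f \<in> hardy 2) \<and>
     (\<exists>C>0. \<forall>f\<in>hardy 2. hardy2_norm (A f) \<le> C * hardy2_norm f)"

definition riesz_proj_bounded :: "(complex \<Rightarrow> real) \<Rightarrow> (complex \<Rightarrow> real) \<Rightarrow> bool" where
  "riesz_proj_bounded \<rho> \<sigma> \<longleftrightarrow> (\<exists>C>0. \<forall>g\<in>weighted_L2 \<rho>.
     (\<integral>\<^sup>+\<zeta>. ennreal ((cmod (bv (riesz_proj g) \<zeta>))\<^sup>2 * \<sigma> \<zeta>) \<partial>circle_measure)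
       \<le> ennreal C * (\<integral>\<^sup>+\<zeta>. ennreal ((cmod (g \<zeta>))\<^sup>2 * \<rho> \<zeta>) \<partial>circle_measure))"

text \<open>
  For \<open>v\<close> the boundary function of an outer function, \<open>conj_toeplitz v\<close> is injective on \<open>hardy 2\<close>
  up to the irrelevant values off the disc, so the choice made by \<open>inv_into\<close> does not affect
  \<open>ran_inner\<close>.
\<close>

definition ran_space :: "(complex \<Rightarrow> complex) \<Rightarrow> (complex \<Rightarrow> complex) set" where
  "ran_space v = conj_toeplitz v ` hardy 2"

definition ran_inner ::
  "(complex \<Rightarrow> complex) \<Rightarrow> (complex \<Rightarrow> complex) \<Rightarrow> (complex \<Rightarrow> complex) \<Rightarrow> complex" where
  "ran_inner v F G = hardy2_inner (inv_into (hardy 2) (conj_toeplitz v) F)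
                                  (inv_into (hardy 2) (conj_toeplitz v) G)"

definition closed_disc_ext :: "(complex \<Rightarrow> complex) \<Rightarrow> complex \<Rightarrow> complex" where
  "closed_disc_ext f z = (if cmod z < 1 then f z else bv f z)"

text \<open>
  A space of analytic functions is given by its carrier \<open>H\<close> and its inner product \<open>ip\<close>. The norm
  inequality is squared, since its left-hand side may be infinite.
\<close>

definition carleson_measure ::
  "complex measure \<Rightarrow> (complex \<Rightarrow> complex) set \<Rightarrow>
   ((complex \<Rightarrow> complex) \<Rightarrow> (complex \<Rightarrow> complex) \<Rightarrow> complex) \<Rightarrow> bool" where
  "carleson_measure \<mu> H ip \<longleftrightarrow>
     sets \<mu> = sets (restrict_space borel (cball 0 1)) \<and> finite_measure \<mu> \<and>
     (\<exists>C>0. \<forall>f\<in>H. (\<integral>\<^sup>+z. ennreal ((cmod (closed_disc_ext f z))\<^sup>2) \<partial>\<mu>)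
        \<le> ennreal (C\<^sup>2 * Re (ip f f)))"

text \<open>The measure \<open>\<rho> dm\<close> on the circle, as a measure on the closed disc.\<close>

definition boundary_measure :: "(complex \<Rightarrow> real) \<Rightarrow> complex measure" where
  "boundary_measure \<rho> = distr (density circle_measure (\<lambda>\<zeta>. ennreal (\<rho> \<zeta>)))
     (restrict_space borel (cball 0 1)) (\<lambda>\<zeta>. \<zeta>)"

text \<open>Poles and their orders, for a function on the circle.\<close>

definition poles :: "(complex \<Rightarrow> complex) \<Rightarrow> complex set" where
  "poles f = {\<zeta> \<in> unit_circle. \<forall>\<epsilon>>0. f \<notin> Linfty_on (ball \<zeta> \<epsilon> \<inter> unit_circle)}"

definition pole_cancelled_by :: "(complex \<Rightarrow> complex) \<Rightarrow> complex \<Rightarrow> nat \<Rightarrow> bool" where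
  "pole_cancelled_by f \<zeta> n \<longleftrightarrow>
     (\<exists>\<epsilon>>0. (\<lambda>z. (z - \<zeta>) ^ n * f z) \<in> Linfty_on (unit_circle \<inter> ball \<zeta> \<epsilon>))"

definition simple_at :: "(complex \<Rightarrow> complex) \<Rightarrow> complex \<Rightarrow> bool" where
  "simple_at f \<zeta> \<longleftrightarrow> (\<exists>n. pole_cancelled_by f \<zeta> n)"

definition pole_order :: "(complex \<Rightarrow> complex) \<Rightarrow> complex \<Rightarrow> nat" where
  "pole_order f \<zeta> = (LEAST n. pole_cancelled_by f \<zeta> n)"

text \<open>Analyticity at a boundary point of a function on the disc: analytic continuation across it.\<close>

definition analytic_at_bdry :: "(complex \<Rightarrow> complex) \<Rightarrow> complex \<Rightarrow> bool" where
  "analytic_at_bdry f \<zeta> \<longleftrightarrow> (\<exists>\<epsilon>>0. \<exists>g. g holomorphic_on ball \<zeta> \<epsilon> \<and>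
     (\<forall>z \<in> ball \<zeta> \<epsilon> \<inter> unit_disc. g z = f z))"

text \<open>
  Vanishing of the limit along the circle. Intersecting with \<open>ae_filter\<close> makes this independent of
  the representative of a function that is only given almost everywhere.
\<close>

definition value_zero_at :: "(complex \<Rightarrow> complex) \<Rightarrow> complex \<Rightarrow> bool" where
  "value_zero_at f t \<longleftrightarrow> (f \<longlongrightarrow> 0) (inf (at t within unit_circle) (ae_filter circle_measure))"

text \<open>\<open>v = cnj v\<^sub>- + v\<^sub>+\<close> almost everywhere, with \<open>v\<^sub>-\<close> in \<open>z H\<^sup>2\<close> and \<open>v\<^sub>+\<close> in \<open>H\<^sup>2\<close>.\<close>

definition riesz_decomp ::
  "(complex \<Rightarrow> complex) \<Rightarrow> (complex \<Rightarrow> complex) \<Rightarrow> (complex \<Rightarrow> complex) \<Rightarrow> bool" where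
  "riesz_decomp v vm vp \<longleftrightarrow>
     vm \<in> (\<lambda>h z. z * h z) ` hardy 2 \<and> vp \<in> hardy 2 \<and>
     (AE \<zeta> in circle_measure. v \<zeta> = cnj (bv vm \<zeta>) + bv vp \<zeta>)"

text \<open>
  Every square-integrable \<open>v\<close> has a Riesz decomposition, and its two parts are unique on the disc.
  The poles of \<open>v\<close> are those of the two parts, but their simplicity refers to \<open>v\<close> itself.
\<close>

definition admissible_toeplitz_pair :: "(complex \<Rightarrow> complex) \<Rightarrow> (complex \<Rightarrow> complex) \<Rightarrow> bool" where
  "admissible_toeplitz_pair u v \<longleftrightarrow>
     u \<in> radial_bv_space \<and> v \<in> circle_L2 \<and>
     (\<exists>vm vp. riesz_decomp v vm vp \<and>
       (let U = poles (bv u); V = poles (bv vm) \<union> poles (bv vp) in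
         finite U \<and> finite V \<and> (\<forall>\<zeta>\<in>U. simple_at (bv u) \<zeta>) \<and> (\<forall>\<zeta>\<in>V. simple_at v \<zeta>) \<and>
         (\<forall>\<zeta>\<in>V. analytic_at_bdry u \<zeta>) \<and>
         (\<forall>\<zeta>\<in>U. analytic_at_bdry vm \<zeta> \<and> analytic_at_bdry vp \<zeta>) \<and>
         ((\<exists>h\<in>hardy 2. AE \<zeta> in circle_measure. v \<zeta> = cnj (bv h \<zeta>)) \<or>
          (\<forall>t\<in>U. \<forall>i < pole_order (bv u) t.
             value_zero_at (\<lambda>z. v z / (z - t) ^ i) t \<longrightarrow>
             value_zero_at (\<lambda>z. bv vp z / (z - t) ^ i) t \<and>
             value_zero_at (\<lambda>z. cnj (bv vm z) / (z - t) ^ i) t))))"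

end

theory Submission
  imports Defs "HOL-Probability.Probability_Measure" "HOL-Complex_Analysis.Complex_Analysis"
begin

text \<open>
  The conditions (a), (b) and (e) each give a bound for \<open>P (cnj v F)\<close> in \<open>L\<^sup>2\<close> with weight \<open>\<bar>u\<bar>\<^sup>2\<close>, for bounded
  \<open>F\<close>; in (e) this uses that \<open>P (cnj v f)\<close> determines \<open>f\<close> when \<open>v\<close> is outer. Subtracting from the
  operator its conjugate by a disc automorphism leaves an operator of rank one, whose norm is the square
  root of the product of Poisson integrals in (d). As \<open>\<bar>u w\<bar>\<^sup>2\<close> is at most the Poisson integral of
  \<open>\<bar>u\<bar>\<^sup>2\<close> at \<open>w\<close>, (d) bounds \<open>u v\<close> in the disc, which is (c). Conversely, if \<open>u v\<close> is bounded, then each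
  pole of \<open>u\<close> is absorbed by a zero of \<open>v\<close> and each pole of \<open>v\<close> by a zero of \<open>u\<close>. Moving the
  polynomials with these zeros through the Riesz projection turns \<open>u P (cnj v F)\<close> into a bounded
  function times the projection of a bounded multiple of \<open>F\<close>, up to an error controlled by the
  \<open>L\<^sup>1\<close> norms of \<open>cnj v F\<close> and of that multiple.

  Radial limits of \<open>H\<^sup>2\<close> functions exist almost everywhere because a primitive of the function is
  continuous up to the circle and, by Lebesgue's differentiation theorem, differentiable almost
  everywhere along it.
\<close>

section \<open>Normalised Lebesgue measure on the circle\<close>

text \<open>Two classes of \<open>F\<close> are kept apart. For bounded \<open>F\<close> the product
  \<open>cnj v F\<close> is in L2, so its projection is in H2, where radial limits are at hand;
  necessity is tested on these only. For general \<open>F\<close> in L2 the product is merely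
  integrable and its projection need not be in H2. Sufficiency therefore bounds the means of
  \<open>u P (cnj v F)\<close> on interior circles, uniformly in the radius; this puts the product
  in H2, gives the limits of the projection where \<open>bv u\<close> is nonzero, and yields (a),
  (b) and (e) together. From (c), condition (d) is reached through any of them.

  Polynomials can be moved through the projection because a Lipschitz difference cancels the
  singularity of the Cauchy kernel. The error is a constant times an L1 norm; it is multiplied by
  \<open>u / R\<close>, which is still in H2 because \<open>u\<close> vanishes at the zeros of
  \<open>R\<close>, so its circular means stay bounded. The conjugate polynomial is extended into
  the disc as \<open>cnj (Q (1 / cnj z))\<close>. As the zeros of \<open>Q\<close> lie on the
  circle, this has modulus at most a constant times that of \<open>Q\<close> once
  \<open>cmod z >= 1/2\<close>, which is why the bound is stated for such radii.\<close>

abbreviation mT :: "complex measure" where "mT \<equiv> circle_measure"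

lemma emeasure_circle_arc: "emeasure lborel {0..<2 * pi} = ennreal (2 * pi)"
  by (simp add: emeasure_lborel_Ico)

lemma cis_measurable [measurable]:
  "cis \<in> measurable (uniform_measure lborel {0..<2 * pi}) (restrict_space borel unit_circle)"
proof -
  have "cis \<in> borel_measurable borel"
    by (intro borel_measurable_continuous_onI continuous_intros)
  then show ?thesis
    by (intro measurable_restrict_space2) (auto simp: measurable_def uniform_measure_def)
qed

lemma space_circle [simp]: "space mT = unit_circle"
  by (simp add: circle_measure_def space_restrict_space)

lemma sets_circle [measurable_cong]: "sets mT = sets (restrict_space borel unit_circle)"
  by (simp add: circle_measure_def)

lemma prob_space_circle: "prob_space mT"
  unfolding circle_measure_def
  by (intro prob_space.prob_space_distr prob_space_uniform_measure)
     (auto simp: emeasure_circle_arc)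

interpretation mT: prob_space mT by (rule prob_space_circle)

lemma continuous_imp_measurable_circle [intro]:
  fixes f :: "complex \<Rightarrow> 'a::topological_space"
  assumes "continuous_on unit_circle f"
  shows "f \<in> borel_measurable mT"
  using borel_measurable_continuous_on_restrict[OF assms]
  by (simp add: measurable_cong_sets[OF sets_circle refl])

lemma id_measurable_circle [measurable]: "(\<lambda>\<zeta>. \<zeta>) \<in> borel_measurable mT"
  by (intro continuous_imp_measurable_circle continuous_intros)

lemma integrable_circle_bounded:
  fixes f :: "complex \<Rightarrow> 'a::{banach,second_countable_topology}"
  assumes "f \<in> borel_measurable mT" and "AE \<zeta> in mT. norm (f \<zeta>) \<le> B"
  shows "integrable mT f"
  using assms by (intro mT.integrable_const_bound)

lemma integrable_circle_continuous:
  fixes f :: "complex \<Rightarrow> 'a::{banach,second_countable_topology}"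
  assumes "continuous_on unit_circle f"
  shows "integrable mT f"
proof -
  have "bounded (f ` unit_circle)"
    using assms by (intro compact_imp_bounded compact_continuous_image) auto
  then obtain B where "\<And>\<zeta>. \<zeta> \<in> unit_circle \<Longrightarrow> norm (f \<zeta>) \<le> B"
    unfolding bounded_iff by blast
  then show ?thesis
    using assms by (intro integrable_circle_bounded[where B=B] continuous_imp_measurable_circle AE_I2) auto
qed

text \<open>The half-open parameter interval is traded for the closed one, which differs by a null
  point, so that the fundamental theorem of calculus on \<open>{0..2*pi}\<close> applies.\<close>

lemma integral_circle:
  fixes f :: "complex \<Rightarrow> 'a::{banach,second_countable_topology}"
  assumes "f \<in> borel_measurable mT"
  shows "(LINT \<zeta>|mT. f \<zeta>) = (LINT t|lborel. indicator {0..2 * pi} t *\<^sub>R f (cis t)) /\<^sub>R (2 * pi)"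
proof -
  have [measurable]: "f \<in> borel_measurable (restrict_space borel unit_circle)"
    using assms by (simp add: measurable_cong_sets[OF sets_circle refl])
  have m2 [measurable]: "(\<lambda>t. f (cis t)) \<in> borel_measurable borel"
  proof -
    have "cis \<in> measurable borel (restrict_space borel unit_circle)"
      using cis_measurable by (simp add: measurable_def uniform_measure_def)
    then show ?thesis by (rule measurable_compose) measurable
  qed
  have u: "uniform_measure lborel {0..<2 * pi} = density lborel (\<lambda>t. ennreal (indicator {0..<2*pi} t / (2*pi)))"
    unfolding uniform_measure_def
    by (intro density_cong AE_I2) (auto simp: emeasure_circle_arc divide_ennreal[symmetric] ennreal_indicator)
  have "(LINT \<zeta>|mT. f \<zeta>) = (LINT t|uniform_measure lborel {0..<2*pi}. f (cis t))"
    unfolding circle_measure_def by (intro integral_distr) auto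
  also have "\<dots> = (LINT t|lborel. (indicator {0..<2*pi} t / (2*pi)) *\<^sub>R f (cis t))"
    unfolding u by (intro integral_density) auto
  also have "\<dots> = (LINT t|lborel. (indicator {0..2*pi} t *\<^sub>R f (cis t)) /\<^sub>R (2*pi))"
  proof (intro integral_cong_AE)
    have "AE t in lborel. t \<noteq> 2 * pi" by (rule AE_lborel_singleton)
    then show "AE t in lborel. (indicator {0..<2*pi} t / (2*pi)) *\<^sub>R f (cis t) = (indicator {0..2*pi} t *\<^sub>R f (cis t)) /\<^sub>R (2*pi)"
      by eventually_elim (auto simp: indicator_def field_simps)
  qed auto
  also have "\<dots> = (LINT t|lborel. indicator {0..2*pi} t *\<^sub>R f (cis t)) /\<^sub>R (2*pi)"
    by (rule integral_scaleR_right)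
  finally show ?thesis .
qed

text \<open>The parameter 0 is dropped as a null point: later pointwise arguments need an angle away
  from the jump of \<open>Arg2pi\<close>.\<close>

lemma AE_circle_cis:
  assumes "{\<zeta> \<in> unit_circle. P \<zeta>} \<in> sets mT"
    and "AE t in lborel. t \<in> {0<..<2 * pi} \<longrightarrow> P (cis t)"
  shows "AE \<zeta> in mT. P \<zeta>"
proof -
  have "AE t in lborel. t \<in> {0..<2 * pi} \<longrightarrow> P (cis t)"
    using assms(2) AE_lborel_singleton[of "0::real"] by eventually_elim auto
  then have "AE t in uniform_measure lborel {0..<2*pi}. P (cis t)"
    by (intro AE_uniform_measureI) auto
  then show ?thesis
    unfolding circle_measure_def using assms(1)
    by (subst AE_distr_iff) (auto simp: sets_circle space_restrict_space)
qed

text \<open>There are no atoms because \<open>cis\<close> is injective on the open interval. This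
  allows finitely many zeros or poles to be ignored.\<close>

lemma AE_circle_neq: "AE \<zeta> in mT. \<zeta> \<noteq> a"
proof (rule AE_circle_cis)
  show "{\<zeta> \<in> unit_circle. \<zeta> \<noteq> a} \<in> sets mT"
  proof -
    have "{\<zeta> \<in> space mT. \<zeta> \<noteq> a} \<in> sets mT" by measurable
    then show ?thesis by simp
  qed
  have "finite {t \<in> {0<..<2*pi}. cis t = a}"
  proof (cases "\<exists>t0 \<in> {0<..<2*pi}. cis t0 = a")
    case True
    then obtain t0 where t0: "t0 \<in> {0<..<2*pi}" "cis t0 = a" by blast
    have "{t \<in> {0<..<2*pi}. cis t = a} \<subseteq> {t0}"
    proof (clarify)
      fix t assume t: "t \<in> {0<..<2*pi}" "a = cis t"
      then have "cis t0 = cis t" using t0 by simp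
      then show "t = t0"
        using t t0 Arg2pi_unique[of 1 t "cis t"] Arg2pi_unique[of 1 t0 "cis t0"] by (auto simp: cis_conv_exp)
    qed
    then show ?thesis by (rule finite_subset) auto
  next
    case False
    then have "{t \<in> {0<..<2*pi}. cis t = a} = {}" by blast
    then show ?thesis by (metis finite.emptyI)
  qed
  then have "AE t in lborel. t \<notin> {t \<in> {0<..<2*pi}. cis t = a}"
    by (intro AE_not_in) (auto simp: null_sets_def emeasure_lborel_countable countable_finite intro!: sets.countable)
  then show "AE t in lborel. t \<in> {0<..<2 * pi} \<longrightarrow> cis t \<noteq> a"
    by eventually_elim auto
qed

lemma integral_circle_power:
  "(LINT \<zeta>|mT. \<zeta> ^ n) = (if n = 0 then 1 else 0)"
proof (cases "n = 0")
  case True then show ?thesis using mT.prob_space by simp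
next
  case False
  \<comment> \<open>The antiderivative is \<open>2*pi\<close>-periodic, so the two end values
    cancel.\<close>
  have "(LINT t|lborel. indicator {0..2*pi} t *\<^sub>R cis t ^ n) =
        cis (2*pi) ^ n / (\<i> * of_nat n) - cis 0 ^ n / (\<i> * of_nat n)"
  proof (rule integral_FTC_Icc)
    fix x :: real
    have "((\<lambda>t. exp (\<i> * of_nat n * t) / (\<i> * of_nat n)) has_field_derivative exp (\<i> * of_nat n * x)) (at (of_real x))"
      using False by (auto intro!: derivative_eq_intros)
    then have "((\<lambda>t. exp (\<i> * of_nat n * of_real t) / (\<i> * of_nat n)) has_vector_derivative exp (\<i> * of_nat n * x)) (at x within {0..2*pi})"
      using has_vector_derivative_real_field has_vector_derivative_at_within by blast
    moreover have "exp (\<i> * of_nat n * of_real t) = cis t ^ n" for t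
      by (simp add: cis_conv_exp exp_of_nat_mult[symmetric] mult_ac)
    ultimately show "((\<lambda>t. cis t ^ n / (\<i> * of_nat n)) has_vector_derivative cis x ^ n) (at x within {0..2*pi})"
      by simp
  qed (auto intro!: continuous_intros)
  then show ?thesis using False
    by (subst integral_circle) (auto intro!: continuous_imp_measurable_circle continuous_intros)
qed

lemma circle_cnj_mult: "\<zeta> \<in> unit_circle \<Longrightarrow> \<zeta> * cnj \<zeta> = 1"
  by (simp add: complex_norm_square[symmetric])

lemma integral_circle_orth:
  "(LINT \<zeta>|mT. \<zeta> ^ n * cnj \<zeta> ^ k) = (if n = k then 1 else 0)"
proof -
  have *: "(LINT \<zeta>|mT. \<zeta> ^ n * cnj \<zeta> ^ k) = (if n = k then 1 else 0)" if "k \<le> n" for n k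
  proof -
    have "\<zeta> ^ n * cnj \<zeta> ^ k = \<zeta> ^ (n - k)" if "\<zeta> \<in> unit_circle" for \<zeta>
    proof -
      have "\<zeta> ^ n * cnj \<zeta> ^ k = \<zeta> ^ (n - k) * (\<zeta> * cnj \<zeta>) ^ k"
        using \<open>k \<le> n\<close> by (simp add: power_mult_distrib power_add[symmetric] mult.assoc[symmetric])
      then show ?thesis using that by (simp add: circle_cnj_mult)
    qed
    then have "(LINT \<zeta>|mT. \<zeta> ^ n * cnj \<zeta> ^ k) = (LINT \<zeta>|mT. \<zeta> ^ (n - k))"
      by (intro Bochner_Integration.integral_cong) auto
    then show ?thesis using that by (auto simp: integral_circle_power)
  qed
  show ?thesis
  proof (cases "k \<le> n")
    case True then show ?thesis by (rule *)
  next
    case False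
    have "cnj (LINT \<zeta>|mT. \<zeta> ^ k * cnj \<zeta> ^ n) = (LINT \<zeta>|mT. cnj (\<zeta> ^ k * cnj \<zeta> ^ n))"
      by (rule Bochner_Integration.integral_cnj[symmetric])
    also have "\<dots> = (LINT \<zeta>|mT. \<zeta> ^ n * cnj \<zeta> ^ k)"
      by (intro Bochner_Integration.integral_cong) (auto simp: mult.commute)
    finally have "(LINT \<zeta>|mT. \<zeta> ^ n * cnj \<zeta> ^ k) = cnj (LINT \<zeta>|mT. \<zeta> ^ k * cnj \<zeta> ^ n)" by simp
    then show ?thesis using False *[of n k] by auto
  qed
qed

section \<open>Square-integrable functions\<close>

definition sq_integrable :: "(complex \<Rightarrow> complex) \<Rightarrow> bool" where
  "sq_integrable f \<longleftrightarrow> f \<in> borel_measurable mT \<and> integrable mT (\<lambda>\<zeta>. (cmod (f \<zeta>))\<^sup>2)"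

definition sqn :: "(complex \<Rightarrow> complex) \<Rightarrow> real" where
  "sqn f = (LINT \<zeta>|mT. (cmod (f \<zeta>))\<^sup>2)"

lemma sq_integrableD:
  assumes "sq_integrable f"
  shows "f \<in> borel_measurable mT" "integrable mT (\<lambda>\<zeta>. (cmod (f \<zeta>))\<^sup>2)"
  using assms by (auto simp: sq_integrable_def)

lemma sqn_nonneg [simp]: "0 \<le> sqn f"
  by (simp add: sqn_def)

lemma sq_integrable_bound:
  assumes "sq_integrable g" "f \<in> borel_measurable mT" "AE \<zeta> in mT. cmod (f \<zeta>) \<le> K * cmod (g \<zeta>)"
  shows "sq_integrable f" "sqn f \<le> K\<^sup>2 * sqn g"
proof -
  have g: "integrable mT (\<lambda>\<zeta>. K\<^sup>2 * (cmod (g \<zeta>))\<^sup>2)"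
    using assms(1) by (auto simp: sq_integrable_def)
  have le: "AE \<zeta> in mT. (cmod (f \<zeta>))\<^sup>2 \<le> K\<^sup>2 * (cmod (g \<zeta>))\<^sup>2"
    using assms(3)
  proof eventually_elim
    case (elim \<zeta>)
    then have "(cmod (f \<zeta>))\<^sup>2 \<le> (K * cmod (g \<zeta>))\<^sup>2"
      by (intro power_mono) auto
    then show ?case by (simp add: power_mult_distrib)
  qed
  have f: "integrable mT (\<lambda>\<zeta>. (cmod (f \<zeta>))\<^sup>2)"
  proof (rule Bochner_Integration.integrable_bound[OF g])
    show "AE \<zeta> in mT. norm ((cmod (f \<zeta>))\<^sup>2) \<le> norm (K\<^sup>2 * (cmod (g \<zeta>))\<^sup>2)"
      using le by eventually_elim auto
  qed (use assms(2) in measurable)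
  show "sq_integrable f" using f assms(2) by (simp add: sq_integrable_def)
  have "sqn f \<le> (LINT \<zeta>|mT. K\<^sup>2 * (cmod (g \<zeta>))\<^sup>2)"
    unfolding sqn_def by (rule integral_mono_AE[OF f g le])
  then show "sqn f \<le> K\<^sup>2 * sqn g" by (simp add: sqn_def)
qed

lemma sq_integrable_bounded:
  assumes "f \<in> borel_measurable mT" "AE \<zeta> in mT. cmod (f \<zeta>) \<le> K"
  shows "sq_integrable f"
proof -
  have "sq_integrable (\<lambda>_. 1)" by (simp add: sq_integrable_def)
  then show ?thesis
    using assms by (rule_tac sq_integrable_bound[where K=K]) auto
qed

lemma sq_integrable_continuous:
  assumes "continuous_on unit_circle f"
  shows "sq_integrable f"
  using assms unfolding sq_integrable_def
  by (auto intro!: integrable_circle_continuous continuous_intros)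

lemma sq_integrable_cmult:
  assumes "sq_integrable f" "g \<in> borel_measurable mT" "AE \<zeta> in mT. cmod (g \<zeta>) \<le> K"
  shows "sq_integrable (\<lambda>\<zeta>. g \<zeta> * f \<zeta>)" "sqn (\<lambda>\<zeta>. g \<zeta> * f \<zeta>) \<le> K\<^sup>2 * sqn f"
proof -
  have [measurable]: "f \<in> borel_measurable mT" "g \<in> borel_measurable mT"
    using assms by (auto simp: sq_integrable_def)
  have m: "(\<lambda>\<zeta>. g \<zeta> * f \<zeta>) \<in> borel_measurable mT" by measurable
  have "AE \<zeta> in mT. cmod (g \<zeta> * f \<zeta>) \<le> K * cmod (f \<zeta>)"
    using assms(3) by eventually_elim (auto simp: norm_mult intro!: mult_right_mono)
  from sq_integrable_bound[OF assms(1) m this]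
  show "sq_integrable (\<lambda>\<zeta>. g \<zeta> * f \<zeta>)" "sqn (\<lambda>\<zeta>. g \<zeta> * f \<zeta>) \<le> K\<^sup>2 * sqn f"
    by auto
qed

lemma cnj_borel_measurable [measurable]: "cnj \<in> borel_measurable borel"
  by (intro borel_measurable_continuous_onI continuous_intros)

lemma sq_integrable_cnj [simp]: "sq_integrable f \<Longrightarrow> sq_integrable (\<lambda>\<zeta>. cnj (f \<zeta>))"
  unfolding sq_integrable_def by (auto intro: measurable_compose[OF _ cnj_borel_measurable])

lemma sqn_cnj [simp]: "sqn (\<lambda>\<zeta>. cnj (f \<zeta>)) = sqn f"
  by (simp add: sqn_def)

text \<open>Replaces Minkowski's inequality when norms are kept squared. Its factor 2 reappears in
  later constants, such as the 4 of \<open>two_weight_imp_poisson\<close>.\<close>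

lemma cmod_add_squared: "(cmod (a + b))\<^sup>2 \<le> 2 * (cmod a)\<^sup>2 + 2 * (cmod b)\<^sup>2"
proof -
  have "(cmod (a + b))\<^sup>2 \<le> (cmod a + cmod b)\<^sup>2"
    by (intro power_mono norm_triangle_ineq) auto
  also have "\<dots> \<le> 2 * (cmod a)\<^sup>2 + 2 * (cmod b)\<^sup>2"
    using sum_squares_bound[of "cmod a" "cmod b"] by (simp add: power2_sum)
  finally show ?thesis .
qed

lemma sq_integrable_add:
  assumes "sq_integrable f" "sq_integrable g"
  shows "sq_integrable (\<lambda>\<zeta>. f \<zeta> + g \<zeta>)" "sqn (\<lambda>\<zeta>. f \<zeta> + g \<zeta>) \<le> 2 * sqn f + 2 * sqn g"
proof -
  have [measurable]: "f \<in> borel_measurable mT" "g \<in> borel_measurable mT"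
    using assms by (auto simp: sq_integrable_def)
  have i: "integrable mT (\<lambda>\<zeta>. 2 * (cmod (f \<zeta>))\<^sup>2 + 2 * (cmod (g \<zeta>))\<^sup>2)"
    using assms by (auto simp: sq_integrable_def)
  have j: "integrable mT (\<lambda>\<zeta>. (cmod (f \<zeta> + g \<zeta>))\<^sup>2)"
    by (rule Bochner_Integration.integrable_bound[OF i]) (auto simp: cmod_add_squared)
  show "sq_integrable (\<lambda>\<zeta>. f \<zeta> + g \<zeta>)" using j by (simp add: sq_integrable_def)
  have "sqn (\<lambda>\<zeta>. f \<zeta> + g \<zeta>) \<le> (LINT \<zeta>|mT. 2 * (cmod (f \<zeta>))\<^sup>2 + 2 * (cmod (g \<zeta>))\<^sup>2)"
    unfolding sqn_def by (rule integral_mono[OF j i]) (rule cmod_add_squared)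
  also have "\<dots> = 2 * sqn f + 2 * sqn g"
    using assms by (simp add: sqn_def sq_integrable_def)
  finally show "sqn (\<lambda>\<zeta>. f \<zeta> + g \<zeta>) \<le> 2 * sqn f + 2 * sqn g" .
qed

lemma sq_integrable_minus: "sq_integrable f \<Longrightarrow> sq_integrable (\<lambda>\<zeta>. - f \<zeta>)"
  by (simp add: sq_integrable_def)

lemma sq_integrable_diff:
  assumes "sq_integrable f" "sq_integrable g"
  shows "sq_integrable (\<lambda>\<zeta>. f \<zeta> - g \<zeta>)" "sqn (\<lambda>\<zeta>. f \<zeta> - g \<zeta>) \<le> 2 * sqn f + 2 * sqn g"
  using sq_integrable_add[OF assms(1) sq_integrable_minus[OF assms(2)]] by (simp_all add: sqn_def)

lemma integrable_mult_sq:
  assumes "sq_integrable f" "sq_integrable g"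
  shows "integrable mT (\<lambda>\<zeta>. f \<zeta> * g \<zeta>)"
proof -
  have [measurable]: "f \<in> borel_measurable mT" "g \<in> borel_measurable mT"
    using assms by (auto simp: sq_integrable_def)
  have i: "integrable mT (\<lambda>\<zeta>. (cmod (f \<zeta>))\<^sup>2 + (cmod (g \<zeta>))\<^sup>2)"
    using assms by (auto simp: sq_integrable_def)
  show ?thesis
  proof (rule Bochner_Integration.integrable_bound[OF i])
    have "cmod a * cmod b \<le> (cmod a)\<^sup>2 + (cmod b)\<^sup>2" for a b
      using sum_squares_bound[of "cmod a" "cmod b"] mult_nonneg_nonneg[of "cmod a" "cmod b"] 
      by (simp del: mult_nonneg_nonneg)
    then show "AE \<zeta> in mT. norm (f \<zeta> * g \<zeta>) \<le> norm ((cmod (f \<zeta>))\<^sup>2 + (cmod (g \<zeta>))\<^sup>2)"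
      by (auto simp: norm_mult)
  qed measurable
qed

lemma sq_integrable_imp_integrable: "sq_integrable f \<Longrightarrow> integrable mT f"
  using integrable_mult_sq[of f "\<lambda>_. 1"] sq_integrable_continuous[of "\<lambda>_. 1"] by simp

lemma sq_integrable_nn:
  assumes "f \<in> borel_measurable mT"
  shows "sq_integrable f \<longleftrightarrow> (\<integral>\<^sup>+\<zeta>. ennreal ((cmod (f \<zeta>))\<^sup>2) \<partial>mT) < \<infinity>"
  using assms unfolding sq_integrable_def
  by (auto simp: integrable_iff_bounded)

lemma sqn_nn:
  assumes "sq_integrable f"
  shows "(\<integral>\<^sup>+\<zeta>. ennreal ((cmod (f \<zeta>))\<^sup>2) \<partial>mT) = ennreal (sqn f)"
  using assms unfolding sq_integrable_def sqn_def
  by (intro nn_integral_eq_integral) auto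

lemma Cauchy_Schwarz_norm:
  assumes "sq_integrable f" "sq_integrable g"
  shows "(LINT \<zeta>|mT. cmod (f \<zeta> * g \<zeta>))\<^sup>2 \<le> sqn f * sqn g"
proof -
  have [measurable]: "f \<in> borel_measurable mT" "g \<in> borel_measurable mT"
    using assms by (auto simp: sq_integrable_def)
  have "(\<integral>\<^sup>+\<zeta>. ennreal (cmod (f \<zeta>)) * ennreal (cmod (g \<zeta>)) \<partial>mT)\<^sup>2 \<le>
     (\<integral>\<^sup>+\<zeta>. (ennreal (cmod (f \<zeta>)))\<^sup>2 \<partial>mT) * (\<integral>\<^sup>+\<zeta>. (ennreal (cmod (g \<zeta>)))\<^sup>2 \<partial>mT)"
    by (rule Cauchy_Schwarz_nn_integral) auto
  moreover have "(\<integral>\<^sup>+\<zeta>. ennreal (cmod (f \<zeta>)) * ennreal (cmod (g \<zeta>)) \<partial>mT) = ennreal (LINT \<zeta>|mT. cmod (f \<zeta> * g \<zeta>))"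
    using integrable_norm[OF integrable_mult_sq[OF assms]]
    by (subst nn_integral_eq_integral[symmetric]) (auto simp: norm_mult ennreal_mult)
  ultimately have "ennreal ((LINT \<zeta>|mT. cmod (f \<zeta> * g \<zeta>))\<^sup>2) \<le> ennreal (sqn f * sqn g)"
    using sqn_nn[OF assms(1)] sqn_nn[OF assms(2)]
    by (simp add: ennreal_power ennreal_mult)
  then show ?thesis by (simp add: ennreal_le_iff)
qed

lemma Cauchy_Schwarz_circle:
  assumes "sq_integrable f" "sq_integrable g"
  shows "(cmod (LINT \<zeta>|mT. f \<zeta> * g \<zeta>))\<^sup>2 \<le> sqn f * sqn g"
proof -
  have "(cmod (LINT \<zeta>|mT. f \<zeta> * g \<zeta>))\<^sup>2 \<le> (LINT \<zeta>|mT. cmod (f \<zeta> * g \<zeta>))\<^sup>2"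
    by (intro power_mono) auto
  then show ?thesis using Cauchy_Schwarz_norm[OF assms] by linarith
qed

lemma integral_norm_le_sqn:
  assumes "sq_integrable f"
  shows "(LINT \<zeta>|mT. cmod (f \<zeta>))\<^sup>2 \<le> sqn f"
proof -
  have "sqn (\<lambda>_. 1) = 1" using mT.prob_space by (simp add: sqn_def)
  then show ?thesis
    using Cauchy_Schwarz_norm[OF assms, of "\<lambda>_. 1"] sq_integrable_continuous[of "\<lambda>_. 1"] by simp
qed

lemma sqn_AE_cong:
  assumes "AE \<zeta> in mT. f \<zeta> = g \<zeta>" "f \<in> borel_measurable mT" "g \<in> borel_measurable mT"
  shows "sqn f = sqn g"
  unfolding sqn_def using assms by (intro integral_cong_AE) auto

section \<open>Fourier coefficients of nonnegative index and Bessel's inequality\<close>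

definition fcoeff :: "(complex \<Rightarrow> complex) \<Rightarrow> nat \<Rightarrow> complex" where
  "fcoeff F n = (LINT \<zeta>|mT. F \<zeta> * cnj \<zeta> ^ n)"

lemma integrable_times_bounded:
  fixes F g :: "complex \<Rightarrow> complex"
  assumes "integrable mT F" "g \<in> borel_measurable mT" "AE \<zeta> in mT. cmod (g \<zeta>) \<le> K"
  shows "integrable mT (\<lambda>\<zeta>. F \<zeta> * g \<zeta>)"
proof (rule Bochner_Integration.integrable_bound)
  show "integrable mT (\<lambda>\<zeta>. K * cmod (F \<zeta>))" using assms(1) by auto
  show "AE \<zeta> in mT. norm (F \<zeta> * g \<zeta>) \<le> norm (K * cmod (F \<zeta>))"
    using assms(3)
  proof eventually_elim
    case (elim \<zeta>)
    then have "cmod (g \<zeta>) \<le> \<bar>K\<bar>" by linarith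
    then have "cmod (F \<zeta>) * cmod (g \<zeta>) \<le> cmod (F \<zeta>) * \<bar>K\<bar>" by (intro mult_left_mono) auto
    then show ?case by (simp add: norm_mult abs_mult mult.commute)
  qed
qed (use assms in auto)

lemma integrable_times_continuous:
  fixes F g :: "complex \<Rightarrow> complex"
  assumes "integrable mT F" "continuous_on unit_circle g"
  shows "integrable mT (\<lambda>\<zeta>. F \<zeta> * g \<zeta>)"
proof -
  have "bounded (g ` unit_circle)"
    using assms by (intro compact_imp_bounded compact_continuous_image) auto
  then obtain B where "\<forall>\<zeta>\<in>unit_circle. norm (g \<zeta>) \<le> B"
    unfolding bounded_iff by blast
  then show ?thesis
    using assms by (intro integrable_times_bounded[where K=B] continuous_imp_measurable_circle AE_I2) auto
qed

text \<open>Domination by \<open>cmod (c n) * cmod (F \<zeta>)\<close> justifies the interchange for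
  a merely integrable \<open>F\<close>. Expanding geometric, Koebe and Taylor series with it reduces
  kernel integrals to Fourier coefficients.\<close>

lemma integral_times_series:
  fixes F :: "complex \<Rightarrow> complex" and e :: "nat \<Rightarrow> complex \<Rightarrow> complex"
  assumes "integrable mT F" "summable (\<lambda>n. cmod (c n))"
    and "\<And>n. continuous_on unit_circle (e n)" "\<And>n \<zeta>. \<zeta> \<in> unit_circle \<Longrightarrow> cmod (e n \<zeta>) \<le> 1"
  shows "(\<lambda>n. c n * (LINT \<zeta>|mT. F \<zeta> * e n \<zeta>)) sums (LINT \<zeta>|mT. F \<zeta> * (\<Sum>n. c n * e n \<zeta>))"
proof -
  have i: "integrable mT (\<lambda>\<zeta>. F \<zeta> * (c n * e n \<zeta>))" for n
    using assms by (intro integrable_times_continuous continuous_intros)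
  have le: "cmod (F \<zeta> * (c n * e n \<zeta>)) \<le> cmod (c n) * cmod (F \<zeta>)" if "\<zeta> \<in> unit_circle" for n \<zeta>
    using mult_left_mono[OF assms(4)[OF that], of "cmod (c n) * cmod (F \<zeta>)" n] by (simp add: norm_mult mult_ac)
  have "(\<lambda>n. LINT \<zeta>|mT. F \<zeta> * (c n * e n \<zeta>)) sums (LINT \<zeta>|mT. (\<Sum>n. F \<zeta> * (c n * e n \<zeta>)))"
  proof (rule sums_integral)
    show "AE \<zeta> in mT. summable (\<lambda>n. norm (F \<zeta> * (c n * e n \<zeta>)))"
    proof (rule AE_I2)
      fix \<zeta> assume "\<zeta> \<in> space mT"
      then show "summable (\<lambda>n. norm (F \<zeta> * (c n * e n \<zeta>)))"
        using le by (intro summable_comparison_test'[OF summable_mult2[OF assms(2)]]) auto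
    qed
    show "summable (\<lambda>n. LINT \<zeta>|mT. norm (F \<zeta> * (c n * e n \<zeta>)))"
    proof (rule summable_comparison_test'[OF summable_mult2[OF assms(2)]])
      fix n
      have "(LINT \<zeta>|mT. norm (F \<zeta> * (c n * e n \<zeta>))) \<le> (LINT \<zeta>|mT. cmod (c n) * cmod (F \<zeta>))"
        using i[of n] assms(1) le by (intro integral_mono) auto
      then show "norm (LINT \<zeta>|mT. norm (F \<zeta> * (c n * e n \<zeta>))) \<le> cmod (c n) * (LINT \<zeta>|mT. cmod (F \<zeta>))"
        by simp
    qed
  qed (rule i)
  moreover have "(LINT \<zeta>|mT. F \<zeta> * (c n * e n \<zeta>)) = c n * (LINT \<zeta>|mT. F \<zeta> * e n \<zeta>)" for n
    by (subst integral_mult_right_zero[symmetric]) (simp add: mult_ac)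
  moreover have "(LINT \<zeta>|mT. (\<Sum>n. F \<zeta> * (c n * e n \<zeta>))) = (LINT \<zeta>|mT. F \<zeta> * (\<Sum>n. c n * e n \<zeta>))"
  proof (intro Bochner_Integration.integral_cong refl)
    fix \<zeta> assume "\<zeta> \<in> space mT"
    then have "cmod (c n * e n \<zeta>) \<le> cmod (c n)" for n
      using mult_left_mono[OF assms(4), of \<zeta> "cmod (c n)" n] by (simp add: norm_mult)
    then have "summable (\<lambda>n. c n * e n \<zeta>)"
      by (intro summable_comparison_test'[OF assms(2)])
    then show "(\<Sum>n. F \<zeta> * (c n * e n \<zeta>)) = F \<zeta> * (\<Sum>n. c n * e n \<zeta>)"
      by (rule suminf_mult)
  qed
  ultimately show ?thesis by simp
qed

lemma fcoeff_sum:
  "fcoeff (\<lambda>\<zeta>. \<Sum>n<N. a n * \<zeta> ^ n) k = (if k < N then a k else 0)"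
proof -
  have "fcoeff (\<lambda>\<zeta>. \<Sum>n<N. a n * \<zeta> ^ n) k = (LINT \<zeta>|mT. (\<Sum>n<N. a n * (\<zeta> ^ n * cnj \<zeta> ^ k)))"
    unfolding fcoeff_def by (simp add: sum_distrib_right mult.assoc)
  also have "\<dots> = (\<Sum>n<N. a n * (LINT \<zeta>|mT. \<zeta> ^ n * cnj \<zeta> ^ k))"
    by (subst Bochner_Integration.integral_sum) (auto intro!: integrable_circle_continuous continuous_intros)
  also have "\<dots> = (\<Sum>n<N. if n = k then a n else 0)"
    by (intro sum.cong) (auto simp: integral_circle_orth)
  finally show ?thesis by simp
qed

lemma integral_times_cnj_sum:
  assumes "integrable mT F"
  shows "(LINT \<zeta>|mT. F \<zeta> * cnj (\<Sum>n<N. a n * \<zeta> ^ n)) = (\<Sum>n<N. cnj (a n) * fcoeff F n)"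
proof -
  have "(LINT \<zeta>|mT. F \<zeta> * cnj (\<Sum>n<N. a n * \<zeta> ^ n)) = (LINT \<zeta>|mT. (\<Sum>n<N. cnj (a n) * (F \<zeta> * cnj \<zeta> ^ n)))"
    by (simp add: sum_distrib_left mult_ac)
  also have "\<dots> = (\<Sum>n<N. cnj (a n) * fcoeff F n)"
    unfolding fcoeff_def
    by (subst Bochner_Integration.integral_sum)
       (auto intro!: integrable_mult_right integrable_times_continuous assms continuous_intros)
  finally show ?thesis .
qed

lemma cmod_diff_squared:
  "(cmod (a - b))\<^sup>2 = (cmod a)\<^sup>2 + (cmod b)\<^sup>2 - 2 * Re (a * cnj b)"
proof -
  have "(Re a - Re b)\<^sup>2 + (Im a - Im b)\<^sup>2 = ((Re a)\<^sup>2 + (Im a)\<^sup>2) + ((Re b)\<^sup>2 + (Im b)\<^sup>2) - 2 * (Re a * Re b + Im a * Im b)"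
    by (simp add: power2_eq_square algebra_simps)
  then show ?thesis by (simp add: cmod_power2)
qed

lemma sqn_diff:
  assumes "sq_integrable f" "sq_integrable g"
  shows "sqn (\<lambda>\<zeta>. f \<zeta> - g \<zeta>) = sqn f + sqn g - 2 * Re (LINT \<zeta>|mT. f \<zeta> * cnj (g \<zeta>))"
proof -
  have "integrable mT (\<lambda>\<zeta>. f \<zeta> * cnj (g \<zeta>))" using assms by (intro integrable_mult_sq) auto
  moreover from this have "integrable mT (\<lambda>\<zeta>. Re (f \<zeta> * cnj (g \<zeta>)))" by (rule integrable_Re)
  moreover have "(LINT \<zeta>|mT. Re (f \<zeta> * cnj (g \<zeta>))) = Re (LINT \<zeta>|mT. f \<zeta> * cnj (g \<zeta>))"
    using calculation(1) by (rule integral_Re)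
  ultimately show ?thesis using assms unfolding sqn_def cmod_diff_squared
    by (auto simp: sq_integrable_def simp del: times_complex.simps)
qed

lemma sqn_sum: "sqn (\<lambda>\<zeta>. \<Sum>n<N. a n * \<zeta> ^ n) = (\<Sum>n<N. (cmod (a n))\<^sup>2)"
proof -
  let ?s = "\<lambda>\<zeta>. \<Sum>n<N. a n * \<zeta> ^ n"
  have i: "integrable mT ?s" by (intro integrable_circle_continuous continuous_intros)
  have "complex_of_real (sqn ?s) = (LINT \<zeta>|mT. ?s \<zeta> * cnj (?s \<zeta>))"
    unfolding sqn_def by (subst integral_complex_of_real[symmetric]) (simp only: complex_norm_square)
  also have "\<dots> = (\<Sum>n<N. cnj (a n) * fcoeff ?s n)"
    by (rule integral_times_cnj_sum[OF i])
  also have "\<dots> = (\<Sum>n<N. complex_of_real ((cmod (a n))\<^sup>2))"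
    by (intro sum.cong) (auto simp: fcoeff_sum complex_norm_square mult.commute simp del: of_real_power)
  finally show ?thesis by (metis of_real_eq_iff of_real_sum)
qed

text \<open>The partial Fourier sum is an orthogonal projection, so Pythagoras applies: the mixed
  term equals the squared norm of the sum.\<close>

lemma sqn_diff_sum:
  assumes "sq_integrable F"
  shows "sqn (\<lambda>\<zeta>. F \<zeta> - (\<Sum>n<N. fcoeff F n * \<zeta> ^ n)) = sqn F - (\<Sum>n<N. (cmod (fcoeff F n))\<^sup>2)"
proof -
  have "(LINT \<zeta>|mT. F \<zeta> * cnj (\<Sum>n<N. fcoeff F n * \<zeta> ^ n)) = of_real (\<Sum>n<N. (cmod (fcoeff F n))\<^sup>2)"
    by (subst integral_times_cnj_sum)
       (auto simp: sq_integrable_imp_integrable assms complex_norm_square mult.commute simp del: of_real_power)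
  then show ?thesis
    by (subst sqn_diff) (auto simp: assms sqn_sum intro!: sq_integrable_continuous continuous_intros)
qed

lemma Bessel:
  assumes "sq_integrable F"
  shows "summable (\<lambda>n. (cmod (fcoeff F n))\<^sup>2)" "(\<Sum>n. (cmod (fcoeff F n))\<^sup>2) \<le> sqn F"
proof -
  have le: "(\<Sum>n<N. (cmod (fcoeff F n))\<^sup>2) \<le> sqn F" for N
    using sqn_diff_sum[OF assms, of N] sqn_nonneg[of "\<lambda>\<zeta>. F \<zeta> - (\<Sum>n<N. fcoeff F n * \<zeta> ^ n)"] by linarith
  show "summable (\<lambda>n. (cmod (fcoeff F n))\<^sup>2)"
    by (rule summableI_nonneg_bounded[OF _ le]) auto
  then show "(\<Sum>n. (cmod (fcoeff F n))\<^sup>2) \<le> sqn F"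
    by (rule suminf_le_const[OF _ le])
qed

section \<open>Power series and \<open>H\<^sup>2\<close>\<close>

definition tcoeff :: "(complex \<Rightarrow> complex) \<Rightarrow> nat \<Rightarrow> complex" where
  "tcoeff f n = (deriv ^^ n) f 0 / fact n"

lemma tcoeff_sums:
  assumes "f holomorphic_on unit_disc" "cmod z < 1"
  shows "(\<lambda>n. tcoeff f n * z ^ n) sums f z"
  using holomorphic_power_series[of f 0 1 z] assms by (simp add: tcoeff_def)

lemma powser_summable_norm:
  fixes a :: "nat \<Rightarrow> complex"
  assumes "\<And>z. cmod z < 1 \<Longrightarrow> summable (\<lambda>n. a n * z ^ n)" "cmod z < 1"
  shows "summable (\<lambda>n. cmod (a n * z ^ n))"
proof -
  obtain s where s: "cmod z < s" "s < 1" using dense[OF assms(2)] by blast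
  then have "0 < s" using norm_ge_zero[of z] by linarith
  then have "summable (\<lambda>n. a n * complex_of_real s ^ n)"
    using s by (intro assms(1)) simp
  then show ?thesis
    by (rule powser_insidea) (use s \<open>0 < s\<close> in simp)
qed

lemma cmod_dilate: "\<zeta> \<in> unit_circle \<Longrightarrow> 0 \<le> r \<Longrightarrow> cmod (of_real r * \<zeta>) = r"
  by (simp add: norm_mult)

lemma continuous_on_dilate:
  assumes "f holomorphic_on unit_disc" "0 \<le> r" "r < 1"
  shows "continuous_on unit_circle (\<lambda>\<zeta>. f (of_real r * \<zeta>))"
proof (rule continuous_on_compose2[of unit_disc f])
  show "continuous_on unit_disc f" using assms(1) by (rule holomorphic_on_imp_continuous_on)
qed (use assms in \<open>auto intro!: continuous_intros simp: norm_mult\<close>)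

lemma circle_series_measurable:
  "(\<lambda>\<zeta>. \<Sum>n. c n * \<zeta> ^ n) \<in> borel_measurable mT"
  by measurable

lemma circle_series_bound:
  assumes "summable (\<lambda>n. cmod (c n))" "cmod \<zeta> = 1"
  shows "summable (\<lambda>n. c n * \<zeta> ^ n)" "cmod (\<Sum>n. c n * \<zeta> ^ n) \<le> (\<Sum>n. cmod (c n))"
proof -
  have eq: "cmod (c n * \<zeta> ^ n) = cmod (c n)" for n
    using assms(2) by (simp add: norm_mult norm_power)
  have s: "summable (\<lambda>n. cmod (c n * \<zeta> ^ n))" using assms(1) by (simp add: eq)
  show "summable (\<lambda>n. c n * \<zeta> ^ n)" by (rule summable_norm_cancel[OF s])
  show "cmod (\<Sum>n. c n * \<zeta> ^ n) \<le> (\<Sum>n. cmod (c n))"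
    using summable_norm[OF s] by (simp add: eq)
qed

lemma circle_series_integrable:
  assumes "summable (\<lambda>n. cmod (c n))"
  shows "integrable mT (\<lambda>\<zeta>. \<Sum>n. c n * \<zeta> ^ n)"
  using circle_series_bound[OF assms]
  by (intro integrable_circle_bounded[where B="\<Sum>n. cmod (c n)"] circle_series_measurable AE_I2) auto

lemma circle_series_fcoeff:
  assumes "summable (\<lambda>n. cmod (c n))"
  shows "fcoeff (\<lambda>\<zeta>. \<Sum>n. c n * \<zeta> ^ n) k = c k"
proof -
  have "(\<lambda>n. c n * (LINT \<zeta>|mT. cnj \<zeta> ^ k * \<zeta> ^ n)) sums (LINT \<zeta>|mT. cnj \<zeta> ^ k * (\<Sum>n. c n * \<zeta> ^ n))"
    by (rule integral_times_series)
       (auto intro!: assms integrable_circle_continuous continuous_intros simp: norm_power)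
  moreover have "(\<lambda>n. c n * (LINT \<zeta>|mT. cnj \<zeta> ^ k * \<zeta> ^ n)) = (\<lambda>n. if n = k then c n else 0)"
    by (auto simp: mult.commute[of "cnj _ ^ k"] integral_circle_orth)
  ultimately have "(\<lambda>n. if n = k then c n else 0) sums fcoeff (\<lambda>\<zeta>. \<Sum>n. c n * \<zeta> ^ n) k"
    by (simp add: fcoeff_def mult.commute)
  then show ?thesis using sums_single[of k c] sums_unique2 by blast
qed

text \<open>Parseval for absolutely convergent series: the function is paired term by term with its
  conjugate series, the coefficients being known from \<open>circle_series_fcoeff\<close>.\<close>

lemma circle_series_sqn:
  assumes "summable (\<lambda>n. cmod (c n))"
  shows "(\<lambda>n. (cmod (c n))\<^sup>2) sums sqn (\<lambda>\<zeta>. \<Sum>n. c n * \<zeta> ^ n)"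
proof -
  let ?g = "\<lambda>\<zeta>. \<Sum>n. c n * \<zeta> ^ n"
  have "(\<lambda>n. cnj (c n) * (LINT \<zeta>|mT. ?g \<zeta> * cnj \<zeta> ^ n)) sums (LINT \<zeta>|mT. ?g \<zeta> * (\<Sum>n. cnj (c n) * cnj \<zeta> ^ n))"
    using assms
    by (intro integral_times_series circle_series_integrable)
       (auto intro!: continuous_intros simp: norm_power)
  moreover have "(LINT \<zeta>|mT. ?g \<zeta> * (\<Sum>n. cnj (c n) * cnj \<zeta> ^ n)) = of_real (sqn ?g)"
    unfolding sqn_def
  proof (subst integral_complex_of_real[symmetric], intro Bochner_Integration.integral_cong refl)
    fix \<zeta> assume "\<zeta> \<in> space mT"
    then have "(\<lambda>n. c n * \<zeta> ^ n) sums ?g \<zeta>"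
      using circle_series_bound(1)[OF assms] by (intro summable_sums) auto
    then have "(\<lambda>n. cnj (c n) * cnj \<zeta> ^ n) sums cnj (?g \<zeta>)"
      by (subst sums_cnj[symmetric]) simp
    then show "?g \<zeta> * (\<Sum>n. cnj (c n) * cnj \<zeta> ^ n) = of_real ((cmod (?g \<zeta>))\<^sup>2)"
      by (simp add: sums_unique[symmetric] complex_norm_square del: of_real_power)
  qed
  moreover have "cnj (c n) * (LINT \<zeta>|mT. ?g \<zeta> * cnj \<zeta> ^ n) = of_real ((cmod (c n))\<^sup>2)" for n
    using circle_series_fcoeff[OF assms, of n] unfolding fcoeff_def
    by (simp add: complex_norm_square mult.commute del: of_real_power)
  ultimately have "(\<lambda>n. complex_of_real ((cmod (c n))\<^sup>2)) sums of_real (sqn ?g)" by simp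
  then show ?thesis by (simp only: sums_of_real_iff)
qed

lemma dilate_series:
  assumes "f holomorphic_on unit_disc" "0 \<le> r" "r < 1"
  shows "summable (\<lambda>n. cmod (tcoeff f n * of_real r ^ n))"
    and "\<zeta> \<in> unit_circle \<Longrightarrow> f (of_real r * \<zeta>) = (\<Sum>n. (tcoeff f n * of_real r ^ n) * \<zeta> ^ n)"
proof -
  show "summable (\<lambda>n. cmod (tcoeff f n * of_real r ^ n))"
    using tcoeff_sums[OF assms(1)] assms(2,3)
    by (intro powser_summable_norm) (auto simp: sums_iff)
  show "f (of_real r * \<zeta>) = (\<Sum>n. (tcoeff f n * of_real r ^ n) * \<zeta> ^ n)" if "\<zeta> \<in> unit_circle"
    using tcoeff_sums[OF assms(1), of "of_real r * \<zeta>"] that assms(2,3)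
    by (simp add: sums_iff norm_mult power_mult_distrib mult.assoc)
qed

lemma fcoeff_cong: "(\<And>\<zeta>. \<zeta> \<in> unit_circle \<Longrightarrow> f \<zeta> = g \<zeta>) \<Longrightarrow> fcoeff f n = fcoeff g n"
  unfolding fcoeff_def by (intro Bochner_Integration.integral_cong) auto

lemma sqn_cong: "(\<And>\<zeta>. \<zeta> \<in> unit_circle \<Longrightarrow> cmod (f \<zeta>) = cmod (g \<zeta>)) \<Longrightarrow> sqn f = sqn g"
  unfolding sqn_def by (intro Bochner_Integration.integral_cong) auto

lemma dilate_fcoeff:
  assumes "f holomorphic_on unit_disc" "0 \<le> r" "r < 1"
  shows "fcoeff (\<lambda>\<zeta>. f (of_real r * \<zeta>)) n = tcoeff f n * of_real r ^ n"
proof -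
  have "fcoeff (\<lambda>\<zeta>. f (of_real r * \<zeta>)) n = fcoeff (\<lambda>\<zeta>. \<Sum>k. (tcoeff f k * of_real r ^ k) * \<zeta> ^ k) n"
    by (intro fcoeff_cong dilate_series(2)[OF assms])
  then show ?thesis using circle_series_fcoeff[OF dilate_series(1)[OF assms], of n] by simp
qed

lemma dilate_sqn:
  assumes "f holomorphic_on unit_disc" "0 \<le> r" "r < 1"
  shows "(\<lambda>n. (cmod (tcoeff f n))\<^sup>2 * r ^ (2 * n)) sums sqn (\<lambda>\<zeta>. f (of_real r * \<zeta>))"
proof -
  have "sqn (\<lambda>\<zeta>. f (of_real r * \<zeta>)) = sqn (\<lambda>\<zeta>. \<Sum>n. (tcoeff f n * of_real r ^ n) * \<zeta> ^ n)"
    by (intro sqn_cong) (simp add: dilate_series(2)[OF assms])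
  moreover have "(cmod (tcoeff f n * of_real r ^ n))\<^sup>2 = (cmod (tcoeff f n))\<^sup>2 * r ^ (2 * n)" for n
    using assms(2) by (simp add: norm_mult norm_power power_mult_distrib power_mult[symmetric] mult.commute)
  ultimately show ?thesis
    using circle_series_sqn[OF dilate_series(1)[OF assms]] by simp
qed

text \<open>On the circle of radius 1/2 both expansions converge absolutely, and their coefficients
  are Fourier coefficients of one and the same function.\<close>

lemma tcoeff_unique:
  assumes "f holomorphic_on unit_disc" "\<And>z. cmod z < 1 \<Longrightarrow> (\<lambda>n. a n * z ^ n) sums f z"
  shows "tcoeff f n = a n"
proof -
  have s: "summable (\<lambda>n. cmod (a n * (1/2) ^ n))"
    using assms(2) by (intro powser_summable_norm) (auto simp: sums_iff)
  have "tcoeff f n * (1/2) ^ n = fcoeff (\<lambda>\<zeta>. f (of_real (1/2) * \<zeta>)) n"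
    using dilate_fcoeff[OF assms(1), of "1/2" n] by simp
  also have "\<dots> = fcoeff (\<lambda>\<zeta>. \<Sum>n. (a n * (1/2) ^ n) * \<zeta> ^ n) n"
  proof (rule fcoeff_cong)
    fix \<zeta> :: complex assume "\<zeta> \<in> unit_circle"
    then have "(\<lambda>n. a n * (of_real (1/2) * \<zeta>) ^ n) sums f (of_real (1/2) * \<zeta>)"
      by (intro assms(2)) (auto simp: norm_mult)
    then show "f (of_real (1/2) * \<zeta>) = (\<Sum>n. (a n * (1/2) ^ n) * \<zeta> ^ n)"
      by (simp add: sums_iff power_divide)
  qed
  also have "\<dots> = a n * (1/2) ^ n"
    using circle_series_fcoeff[OF s] by simp
  finally show ?thesis by simp
qed

lemma hardy2_integral:
  "(LINT \<zeta>|mT. cmod (f (of_real r * \<zeta>)) powr 2) = sqn (\<lambda>\<zeta>. f (of_real r * \<zeta>))"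
  unfolding sqn_def by simp

text \<open>The squared H2 norm, available before boundary values are known to exist;
  \<open>hardy2_hsum\<close> later identifies it with the boundary norm.\<close>

definition hsum :: "(complex \<Rightarrow> complex) \<Rightarrow> real" where
  "hsum f = (\<Sum>n. (cmod (tcoeff f n))\<^sup>2)"

lemma hardy2_hol: "f \<in> hardy 2 \<Longrightarrow> f holomorphic_on unit_disc"
  by (simp add: hardy_def)

lemma sum_le_sums:
  fixes f :: "nat \<Rightarrow> real"
  assumes "f sums s" "\<And>n. 0 \<le> f n"
  shows "(\<Sum>n<N. f n) \<le> s"
  using sum_le_suminf[OF sums_summable[OF assms(1)], of "{..<N}"] assms by (simp add: sums_iff)

lemma dilate_sqn_le:
  assumes "f holomorphic_on unit_disc" "summable (\<lambda>n. (cmod (tcoeff f n))\<^sup>2)" "0 \<le> r" "r < 1"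
  shows "sqn (\<lambda>\<zeta>. f (of_real r * \<zeta>)) \<le> hsum f"
proof -
  note s = dilate_sqn[OF assms(1,3,4)]
  have "(\<Sum>n. (cmod (tcoeff f n))\<^sup>2 * r ^ (2 * n)) \<le> hsum f"
    unfolding hsum_def using assms
    by (intro suminf_le assms sums_summable[OF s]) (auto intro!: mult_left_le power_le_one)
  then show ?thesis using sums_unique[OF s] by simp
qed

text \<open>The circular means increase with the radius, so only the radii near 1 matter.\<close>

lemma hardy2I:
  assumes hol: "f holomorphic_on unit_disc" and s: "s < 1"
    and B: "\<And>r. s \<le> r \<Longrightarrow> 0 \<le> r \<Longrightarrow> r < 1 \<Longrightarrow> sqn (\<lambda>\<zeta>. f (of_real r * \<zeta>)) \<le> B"
  shows "f \<in> hardy 2" "summable (\<lambda>n. (cmod (tcoeff f n))\<^sup>2)" "hsum f \<le> B"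
proof -
  have le: "(\<Sum>n<N. (cmod (tcoeff f n))\<^sup>2) \<le> B" for N
  \<comment> \<open>For fixed \<open>N\<close> the sum is a polynomial in \<open>r\<close>, so
    letting \<open>r\<close> tend to 1 keeps the bound.\<close>
  proof (rule tendsto_upperbound)
    show "((\<lambda>r. \<Sum>n<N. (cmod (tcoeff f n))\<^sup>2 * r ^ (2 * n)) \<longlongrightarrow> (\<Sum>n<N. (cmod (tcoeff f n))\<^sup>2)) (at_left (1::real))"
      by (rule tendsto_eq_intros refl | simp)+
    have "eventually (\<lambda>r::real. r \<in> {max 0 s<..<1}) (at_left 1)"
      using s by (intro eventually_at_left_real) auto
    then show "\<forall>\<^sub>F r in at_left 1. (\<Sum>n<N. (cmod (tcoeff f n))\<^sup>2 * r ^ (2 * n)) \<le> B"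
    proof eventually_elim
      case (elim r)
      then have "(\<Sum>n<N. (cmod (tcoeff f n))\<^sup>2 * r ^ (2 * n)) \<le> sqn (\<lambda>\<zeta>. f (of_real r * \<zeta>))"
        using dilate_sqn[OF hol, of r] by (intro sum_le_sums) auto
      then show ?case using B[of r] elim by auto
    qed
  qed auto
  show s: "summable (\<lambda>n. (cmod (tcoeff f n))\<^sup>2)"
    by (rule summableI_nonneg_bounded[OF _ le]) auto
  show "hsum f \<le> B" unfolding hsum_def by (rule suminf_le_const[OF s le])
  have "sqn (\<lambda>\<zeta>. f (of_real r * \<zeta>)) \<le> hsum f" if "0 \<le> r" "r < 1" for r
    by (rule dilate_sqn_le[OF hol s that])
  then show "f \<in> hardy 2" using hol
    unfolding hardy_def hardy2_integral by (auto intro!: bdd_aboveI2[where M="hsum f"])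
qed

lemma hardy2D:
  assumes "f \<in> hardy 2"
  shows "summable (\<lambda>n. (cmod (tcoeff f n))\<^sup>2)"
    and "\<And>r. 0 \<le> r \<Longrightarrow> r < 1 \<Longrightarrow> sqn (\<lambda>\<zeta>. f (of_real r * \<zeta>)) \<le> hsum f"
proof -
  have hol: "f holomorphic_on unit_disc" using assms by (rule hardy2_hol)
  obtain B where B: "\<And>r. 0 \<le> r \<Longrightarrow> r < 1 \<Longrightarrow> sqn (\<lambda>\<zeta>. f (of_real r * \<zeta>)) \<le> B"
    using assms unfolding hardy_def hardy2_integral bdd_above_def by force
  show s: "summable (\<lambda>n. (cmod (tcoeff f n))\<^sup>2)"
    by (rule hardy2I(2)[OF hol _ B, of 0]) auto
  show "sqn (\<lambda>\<zeta>. f (of_real r * \<zeta>)) \<le> hsum f" if "0 \<le> r" "r < 1" for r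
    by (rule dilate_sqn_le[OF hol s that])
qed

lemma hardy2_summableI:
  assumes "f holomorphic_on unit_disc" "summable (\<lambda>n. (cmod (tcoeff f n))\<^sup>2)"
  shows "f \<in> hardy 2"
proof (rule hardy2I(1)[where B="hsum f"])
  fix r :: real assume r: "0 \<le> r" "r < 1"
  show "sqn (\<lambda>\<zeta>. f (of_real r * \<zeta>)) \<le> hsum f"
    by (rule dilate_sqn_le[OF assms r])
qed (use assms in \<open>auto intro: zero_less_one\<close>)

lemma sq_integrable_dilate:
  assumes "f holomorphic_on unit_disc" "0 \<le> r" "r < 1"
  shows "sq_integrable (\<lambda>\<zeta>. f (of_real r * \<zeta>))"
  using continuous_on_dilate[OF assms] by (rule sq_integrable_continuous)

lemma dilate_measurable:
  assumes "f holomorphic_on unit_disc" "0 \<le> r" "r < 1"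
  shows "(\<lambda>\<zeta>. f (of_real r * \<zeta>)) \<in> borel_measurable mT"
  using continuous_on_dilate[OF assms] by (rule continuous_imp_measurable_circle)

lemma hardy2_dominated:
  assumes "f \<in> hardy 2" "g holomorphic_on unit_disc" "\<And>z. cmod z < 1 \<Longrightarrow> cmod (g z) \<le> K * cmod (f z)"
  shows "g \<in> hardy 2"
proof (rule hardy2I(1)[where s=0 and B="K\<^sup>2 * hsum f"])
  fix r :: real assume r: "0 \<le> r" "r < 1"
  have "sqn (\<lambda>\<zeta>. g (of_real r * \<zeta>)) \<le> K\<^sup>2 * sqn (\<lambda>\<zeta>. f (of_real r * \<zeta>))"
  proof (rule sq_integrable_bound(2))
    show "sq_integrable (\<lambda>\<zeta>. f (of_real r * \<zeta>))"
      by (rule sq_integrable_dilate[OF hardy2_hol[OF assms(1)] r])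
    show "(\<lambda>\<zeta>. g (of_real r * \<zeta>)) \<in> borel_measurable mT"
      by (rule dilate_measurable[OF assms(2) r])
    show "AE \<zeta> in mT. cmod (g (of_real r * \<zeta>)) \<le> K * cmod (f (of_real r * \<zeta>))"
      using r by (intro AE_I2 assms(3)) (simp add: norm_mult)
  qed
  also have "\<dots> \<le> K\<^sup>2 * hsum f"
    using hardy2D(2)[OF assms(1) r] by (intro mult_left_mono) auto
  finally show "sqn (\<lambda>\<zeta>. g (of_real r * \<zeta>)) \<le> K\<^sup>2 * hsum f" .
qed (use assms in auto)

lemma hardy2_mult_bounded:
  assumes "f \<in> hardy 2" "g holomorphic_on unit_disc" "\<And>z. cmod z < 1 \<Longrightarrow> cmod (g z) \<le> K"
  shows "(\<lambda>z. g z * f z) \<in> hardy 2"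
proof (rule hardy2_dominated[OF assms(1), where K=K])
  show "(\<lambda>z. g z * f z) holomorphic_on unit_disc"
    by (intro holomorphic_intros assms(2) hardy2_hol[OF assms(1)])
  show "cmod (g z * f z) \<le> K * cmod (f z)" if "cmod z < 1" for z
    unfolding norm_mult by (intro mult_right_mono assms(3) that) auto
qed

lemma hardy2_add:
  assumes "f \<in> hardy 2" "g \<in> hardy 2"
  shows "(\<lambda>z. f z + g z) \<in> hardy 2"
proof (rule hardy2I(1)[where s=0 and B="2 * hsum f + 2 * hsum g"])
  fix r :: real assume r: "0 \<le> r" "r < 1"
  have "sqn (\<lambda>\<zeta>. f (of_real r * \<zeta>) + g (of_real r * \<zeta>)) \<le> 2 * sqn (\<lambda>\<zeta>. f (of_real r * \<zeta>)) + 2 * sqn (\<lambda>\<zeta>. g (of_real r * \<zeta>))"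
    using r assms by (intro sq_integrable_add sq_integrable_dilate hardy2_hol)
  then show "sqn (\<lambda>\<zeta>. f (of_real r * \<zeta>) + g (of_real r * \<zeta>)) \<le> 2 * hsum f + 2 * hsum g"
    using hardy2D(2)[OF assms(1) r] hardy2D(2)[OF assms(2) r] by linarith
qed (use assms in \<open>auto intro!: holomorphic_intros dest: hardy2_hol\<close>)

lemma hardy2_bounded_hol:
  assumes "g holomorphic_on unit_disc" "\<And>z. cmod z < 1 \<Longrightarrow> cmod (g z) \<le> K"
  shows "g \<in> hardy 2"
proof -
  have "(\<lambda>_. 1) \<in> hardy 2"
    using mT.prob_space by (intro hardy2I(1)[where s=0 and B=1]) (auto simp: sqn_def)
  then show ?thesis using assms hardy2_dominated[of "\<lambda>_. 1" g K] by simp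
qed

lemma hardy2_diff:
  assumes "f \<in> hardy 2" "g \<in> hardy 2"
  shows "(\<lambda>z. f z - g z) \<in> hardy 2"
proof -
  have "(\<lambda>z. (-1) * g z) \<in> hardy 2"
    by (rule hardy2_mult_bounded[OF assms(2), where K=1]) auto
  from hardy2_add[OF assms(1) this] show ?thesis by simp
qed

section \<open>The Riesz projection on L1 and L2\<close>

lemma riesz_proj_sums:
  assumes "integrable mT F" "cmod z < 1"
  shows "(\<lambda>n. fcoeff F n * z ^ n) sums riesz_proj F z"
proof -
  have "(\<lambda>n. z ^ n * (LINT \<zeta>|mT. F \<zeta> * cnj \<zeta> ^ n)) sums (LINT \<zeta>|mT. F \<zeta> * (\<Sum>n. z ^ n * cnj \<zeta> ^ n))"
    using assms
    by (intro integral_times_series) (auto intro!: continuous_intros simp: norm_power)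
  moreover have "(LINT \<zeta>|mT. F \<zeta> * (\<Sum>n. z ^ n * cnj \<zeta> ^ n)) = riesz_proj F z"
    unfolding riesz_proj_def
  \<comment> \<open>The inner series is the geometric expansion of the Cauchy kernel; so the
    projection keeps exactly the coefficients of nonnegative index.\<close>
  proof (intro Bochner_Integration.integral_cong refl)
    fix \<zeta> assume "\<zeta> \<in> space mT"
    then have "(\<lambda>n. (cnj \<zeta> * z) ^ n) sums (1 / (1 - cnj \<zeta> * z))"
      using assms by (intro geometric_sums) (auto simp: norm_mult)
    then show "F \<zeta> * (\<Sum>n. z ^ n * cnj \<zeta> ^ n) = F \<zeta> / (1 - cnj \<zeta> * z)"
      by (simp add: sums_iff power_mult_distrib mult.commute)
  qed
  ultimately show ?thesis by (simp add: fcoeff_def mult.commute)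
qed

lemma riesz_proj_hol:
  assumes "integrable mT F"
  shows "riesz_proj F holomorphic_on unit_disc"
  using riesz_proj_sums[OF assms] by (intro power_series_holomorphic[where a="fcoeff F"]) auto

lemma tcoeff_riesz_proj:
  assumes "integrable mT F"
  shows "tcoeff (riesz_proj F) n = fcoeff F n"
  using riesz_proj_sums[OF assms] riesz_proj_hol[OF assms] by (intro tcoeff_unique)

text \<open>Bessel's inequality, as the Taylor coefficients of the projection are the Fourier
  coefficients of \<open>F\<close>.\<close>

lemma riesz_proj_hardy2:
  assumes "sq_integrable F"
  shows "riesz_proj F \<in> hardy 2" "hsum (riesz_proj F) \<le> sqn F"
proof -
  note i = sq_integrable_imp_integrable[OF assms]
  show "riesz_proj F \<in> hardy 2"
    using Bessel(1)[OF assms] by (intro hardy2_summableI riesz_proj_hol i) (simp add: tcoeff_riesz_proj i)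
  show "hsum (riesz_proj F) \<le> sqn F"
    using Bessel(2)[OF assms] by (simp add: hsum_def tcoeff_riesz_proj i)
qed

section \<open>Radial limits and the Poisson kernel\<close>

definition has_radial_limit :: "(complex \<Rightarrow> complex) \<Rightarrow> complex \<Rightarrow> complex \<Rightarrow> bool" where
  "has_radial_limit f \<zeta> l \<longleftrightarrow> ((\<lambda>r. f (of_real r * \<zeta>)) \<longlongrightarrow> l) (at_left (1::real))"

lemma bv_eqI: "has_radial_limit f \<zeta> l \<Longrightarrow> bv f \<zeta> = l"
  unfolding has_radial_limit_def bv_def by (rule tendsto_Lim) auto

lemma radial_eventually: "eventually (\<lambda>r::real. 0 < r \<and> s < r \<and> r < 1) (at_left 1)" if "s < 1"
proof -
  have "eventually (\<lambda>r::real. r \<in> {max 0 s<..<1}) (at_left 1)"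
    using that by (intro eventually_at_left_real) auto
  then show ?thesis by eventually_elim auto
qed

text \<open>A Cauchy condition with discrete parameters, which makes the existence of a radial limit
  a countable combination of closed sets. The offset 2 keeps all radii positive.\<close>

definition radial_osc :: "(complex \<Rightarrow> complex) \<Rightarrow> nat \<Rightarrow> nat \<Rightarrow> complex set" where
  "radial_osc f n k = {\<zeta> \<in> unit_circle. \<forall>p\<in>{1 - 1 / (real k + 2)<..<1}. \<forall>q\<in>{1 - 1 / (real k + 2)<..<1}.
      cmod (f (of_real p * \<zeta>) - f (of_real q * \<zeta>)) \<le> 1 / (real n + 1)}"

text \<open>Uncountably many pairs of radii do no harm: each pair gives a closed condition, and any
  intersection of closed sets is closed.\<close>

lemma radial_osc_sets:
  assumes "f holomorphic_on unit_disc"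
  shows "radial_osc f n k \<in> sets mT"
proof -
  let ?I = "{1 - 1 / (real k + 2)<..<1}"
  have pos: "0 < p" if "p \<in> ?I" for p
  proof -
    have "1 / (real k + 2) \<le> 1" by (simp add: field_simps)
    moreover have "1 - 1 / (real k + 2) < p" using that by simp
    ultimately show ?thesis by linarith
  qed
  have "closed {\<zeta> \<in> unit_circle. cmod (f (of_real p * \<zeta>) - f (of_real q * \<zeta>)) \<le> 1 / (real n + 1)}"
    if "p \<in> ?I" "q \<in> ?I" for p q
  proof -
    have "closed (unit_circle \<inter> (\<lambda>\<zeta>. cmod (f (of_real p * \<zeta>) - f (of_real q * \<zeta>))) -` {..1 / (real n + 1)})"
      using pos[OF that(1)] pos[OF that(2)] that
      by (intro continuous_closed_preimage continuous_intros continuous_on_dilate assms) auto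
    then show ?thesis by (simp add: vimage_def Int_def)
  qed
  then have "closed (\<Inter>p\<in>?I. \<Inter>q\<in>?I. {\<zeta> \<in> unit_circle. cmod (f (of_real p * \<zeta>) - f (of_real q * \<zeta>)) \<le> 1 / (real n + 1)})"
    by (intro closed_INT) auto
  moreover have "radial_osc f n k = (\<Inter>p\<in>?I. \<Inter>q\<in>?I. {\<zeta> \<in> unit_circle. cmod (f (of_real p * \<zeta>) - f (of_real q * \<zeta>)) \<le> 1 / (real n + 1)})"
  proof -
    obtain x where "x \<in> ?I" using dense[of "1 - 1 / (real k + 2)" 1] by auto
    then show ?thesis unfolding radial_osc_def by blast
  qed
  ultimately have "closed (radial_osc f n k)" by simp
  then show ?thesis
    unfolding sets_circle by (auto simp: sets_restrict_space_iff radial_osc_def)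
qed

text \<open>One fixed sequence of radii in \<open>{0..<1}\<close> turns radial limits into
  sequential ones, as needed for measurability, Fatou's lemma and dominated convergence.\<close>

lemma radial_seq: "filterlim (\<lambda>j. 1 - 1 / (real j + 3)) (at_left 1) sequentially"
proof -
  have "(\<lambda>j. 1 / real (j + 3)) \<longlonglongrightarrow> 0"
    by (rule LIMSEQ_ignore_initial_segment[OF lim_1_over_n])
  then have "(\<lambda>j. 1 - 1 / real (j + 3)) \<longlonglongrightarrow> 1 - 0"
    by (intro tendsto_diff tendsto_const)
  then have "(\<lambda>j. 1 - 1 / (real j + 3)) \<longlonglongrightarrow> 1" by simp
  then show ?thesis by (simp add: filterlim_at)
qed

text \<open>Cauchy's criterion for the filter of radii tending to 1; completeness of the complex
  plane supplies the limit.\<close>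

lemma radial_limit_iff_osc:
  assumes "\<zeta> \<in> unit_circle"
  shows "(\<exists>l. has_radial_limit f \<zeta> l) \<longleftrightarrow> \<zeta> \<in> (\<Inter>n. \<Union>k. radial_osc f n k)"
proof
  assume "\<exists>l. has_radial_limit f \<zeta> l"
  then obtain l where l: "((\<lambda>r. f (of_real r * \<zeta>)) \<longlongrightarrow> l) (at_left (1::real))"
    by (auto simp: has_radial_limit_def)
  show "\<zeta> \<in> (\<Inter>n. \<Union>k. radial_osc f n k)"
  proof (intro INT_I)
    fix n
    have "eventually (\<lambda>r::real. dist (f (of_real r * \<zeta>)) l < 1 / (2 * (real n + 1))) (at_left 1)"
      using l by (rule tendstoD) auto
    then obtain b where b: "b < 1" "\<And>r. b < r \<Longrightarrow> r < 1 \<Longrightarrow> dist (f (of_real r * \<zeta>)) l < 1 / (2 * (real n + 1))"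
      unfolding eventually_at_left_field by blast
    obtain k where "1 / (1 - b) < real k" using reals_Archimedean2 by blast
    then have "1 < (1 - b) * (real k + 2)" using b(1) by (simp add: field_simps)
    then have k: "b < 1 - 1 / (real k + 2)" by (simp add: field_simps)
    have "\<zeta> \<in> radial_osc f n k"
      unfolding radial_osc_def
    proof (intro CollectI conjI assms ballI)
      fix p q assume pq: "p \<in> {1 - 1 / (real k + 2)<..<1}" "q \<in> {1 - 1 / (real k + 2)<..<1}"
      have "dist (f (of_real p * \<zeta>)) l < 1 / (2 * (real n + 1))" "dist (f (of_real q * \<zeta>)) l < 1 / (2 * (real n + 1))"
        using pq k by (intro b(2); auto)+
      then have "dist (f (of_real p * \<zeta>)) (f (of_real q * \<zeta>)) < 1 / (2 * (real n + 1)) + 1 / (2 * (real n + 1))"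
        using dist_triangle2[of "f (of_real p * \<zeta>)" "f (of_real q * \<zeta>)" l] by linarith
      then show "cmod (f (of_real p * \<zeta>) - f (of_real q * \<zeta>)) \<le> 1 / (real n + 1)"
        by (simp add: dist_norm field_simps)
    qed
    then show "\<zeta> \<in> (\<Union>k. radial_osc f n k)" by blast
  qed
next
  assume osc: "\<zeta> \<in> (\<Inter>n. \<Union>k. radial_osc f n k)"
  let ?F = "filtermap (\<lambda>r. f (of_real r * \<zeta>)) (at_left (1::real))"
  have "cauchy_filter ?F"
    unfolding cauchy_filter_metric_filtermap
  proof (intro allI impI)
    fix e :: real assume "e > 0"
    then obtain n where n: "1 / (real n + 1) < e"
      using reals_Archimedean[of e] by (auto simp: inverse_eq_divide add.commute)
    obtain k where k: "\<zeta> \<in> radial_osc f n k" using osc by blast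
    let ?I = "{1 - 1 / (real k + 2)<..<1}"
    have "eventually (\<lambda>r. r \<in> ?I) (at_left 1)" by (intro eventually_at_left_real) auto
    moreover have "dist (f (of_real x * \<zeta>)) (f (of_real y * \<zeta>)) < e" if "x \<in> ?I" "y \<in> ?I" for x y
    proof -
      have "cmod (f (of_real x * \<zeta>) - f (of_real y * \<zeta>)) \<le> 1 / (real n + 1)"
        using k that unfolding radial_osc_def by blast
      then show ?thesis using n unfolding dist_norm by linarith
    qed
    ultimately show "\<exists>P. eventually P (at_left 1) \<and> (\<forall>x y. P x \<and> P y \<longrightarrow> dist (f (of_real x * \<zeta>)) (f (of_real y * \<zeta>)) < e)"
      by blast
  qed
  moreover have "?F \<noteq> bot" by (simp add: filtermap_bot_iff)
  ultimately obtain l where "?F \<le> nhds l"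
    using complete_UNIV cauchy_filter_complete_converges[of ?F UNIV] by auto
  then show "\<exists>l. has_radial_limit f \<zeta> l"
    unfolding has_radial_limit_def filterlim_def by blast
qed

lemma radial_limit_sets:
  assumes "f holomorphic_on unit_disc"
  shows "{\<zeta> \<in> unit_circle. \<exists>l. has_radial_limit f \<zeta> l} \<in> sets mT"
proof -
  have "{\<zeta> \<in> unit_circle. \<exists>l. has_radial_limit f \<zeta> l} = (\<Inter>n. \<Union>k. radial_osc f n k)"
  proof (rule set_eqI)
    fix \<zeta>
    have "\<zeta> \<in> unit_circle" if *: "\<zeta> \<in> (\<Inter>n. \<Union>k. radial_osc f n k)"
    proof -
      have "\<zeta> \<in> (\<Union>k. radial_osc f 0 k)" using * by (rule INT_D) simp
      then show ?thesis by (auto simp: radial_osc_def)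
    qed
    then show "\<zeta> \<in> {\<zeta> \<in> unit_circle. \<exists>l. has_radial_limit f \<zeta> l} \<longleftrightarrow> \<zeta> \<in> (\<Inter>n. \<Union>k. radial_osc f n k)"
      using radial_limit_iff_osc[of \<zeta> f] unfolding mem_Collect_eq by argo
  qed
  also have "\<dots> \<in> sets mT"
    using radial_osc_sets[OF assms] by (intro sets.countable_INT sets.countable_UN) auto
  finally show ?thesis .
qed

lemma bv_measurable:
  assumes "f holomorphic_on unit_disc"
  shows "bv f \<in> borel_measurable mT"
proof -
  let ?E = "{\<zeta> \<in> unit_circle. \<exists>l. has_radial_limit f \<zeta> l}"
  let ?r = "\<lambda>j. 1 - 1 / (real j + 3)"
  have rj: "0 \<le> ?r j" "?r j < 1" for j by (auto simp: field_simps)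
  have [measurable]: "(\<lambda>\<zeta>. f (of_real (?r j) * \<zeta>)) \<in> borel_measurable mT" for j
    using dilate_measurable[OF assms rj[of j]] .
  \<comment> \<open>Off the convergence set \<open>Lim\<close> has the fixed value
    \<open>THE l. False\<close>, so \<open>bv f\<close> is measurable on the whole circle,
    exceptional points included.\<close>
  have "(\<lambda>\<zeta>. if \<zeta> \<in> ?E then lim (\<lambda>j. f (of_real (?r j) * \<zeta>)) else (THE l. False)) \<in> borel_measurable mT"
  proof (intro measurable_If_set borel_measurable_lim_metric)
    show "?E \<inter> space mT \<in> sets mT"
      using radial_limit_sets[OF assms] sets.sets_into_space[OF radial_limit_sets[OF assms]] by (simp add: Int_absorb2)
    show "(\<lambda>\<zeta>. f (of_real (?r j) * \<zeta>)) \<in> borel_measurable mT" for j by measurable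
  qed auto
  moreover have "bv f \<zeta> = (if \<zeta> \<in> ?E then lim (\<lambda>j. f (of_real (?r j) * \<zeta>)) else (THE l. False))"
    if "\<zeta> \<in> unit_circle" for \<zeta>
  proof (cases "\<exists>l. has_radial_limit f \<zeta> l")
    case True
    then obtain l where l: "has_radial_limit f \<zeta> l" by blast
    have "(\<lambda>j. f (of_real (?r j) * \<zeta>)) \<longlonglongrightarrow> l"
      using filterlim_compose[OF l[unfolded has_radial_limit_def] radial_seq] .
    then show ?thesis using that True bv_eqI[OF l] by (auto simp: limI)
  next
    case False
    then have "bv f \<zeta> = (THE l. False)"
      unfolding bv_def Topological_Spaces.Lim_def has_radial_limit_def by simp
    then show ?thesis using False by auto
  qed
  ultimately show ?thesis
    by (subst measurable_cong) auto
qed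

text \<open>The Poisson kernel is twice the real part of the Cauchy kernel minus 1; its integrals
  against Fourier series then follow from the geometric series.\<close>

lemma poisson_kernel_eq:
  assumes "\<zeta> \<in> unit_circle" "cmod w < 1"
  shows "complex_of_real ((1 - (cmod w)\<^sup>2) / (cmod (\<zeta> - w))\<^sup>2) = 1 / (1 - cnj \<zeta> * w) + cnj (1 / (1 - cnj \<zeta> * w)) - 1"
proof -
  have z: "\<zeta> * cnj \<zeta> = 1" using assms(1) by (rule circle_cnj_mult)
  have ne: "1 - cnj \<zeta> * w \<noteq> 0"
  proof
    assume "1 - cnj \<zeta> * w = 0"
    then have "cmod (cnj \<zeta> * w) = 1" by simp
    then show False using assms by (simp add: norm_mult)
  qed
  have "cmod (\<zeta> - w) = cmod (\<zeta> * (1 - cnj \<zeta> * w))"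
    using z by (simp add: right_diff_distrib mult.assoc[symmetric])
  then have c: "cmod (\<zeta> - w) = cmod (1 - cnj \<zeta> * w)" using assms by (simp add: norm_mult)
  let ?a = "1 - cnj \<zeta> * w"
  have ww: "w * cnj w = of_real ((cmod w)\<^sup>2)" by (simp add: complex_norm_square[symmetric])
  have aa: "?a * cnj ?a = of_real ((cmod ?a)\<^sup>2)" by (simp only: complex_norm_square[symmetric])
  have cne: "cnj ?a \<noteq> 0" using ne by (metis complex_cnj_zero_iff)
  have "1 / a + 1 / b - 1 = (b + a - a * b) / (a * b)" if "a \<noteq> 0" "b \<noteq> 0" for a b :: complex
    using that by (simp add: field_simps)
  from this[OF ne cne] have "1 / ?a + cnj (1 / ?a) - 1 = (cnj ?a + ?a - ?a * cnj ?a) / (?a * cnj ?a)"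
    by (simp only: complex_cnj_divide complex_cnj_one)
  also have "cnj ?a + ?a - ?a * cnj ?a = 1 - (w * cnj w) * (\<zeta> * cnj \<zeta>)"
    by (simp add: algebra_simps)
  finally have "1 / ?a + cnj (1 / ?a) - 1 = (1 - of_real ((cmod w)\<^sup>2)) / of_real ((cmod ?a)\<^sup>2)"
    by (simp only: z aa ww mult_1_right)
  then show ?thesis by (simp add: c)
qed

lemma circle_dist_pos: "\<zeta> \<in> unit_circle \<Longrightarrow> cmod w < 1 \<Longrightarrow> 0 < cmod (\<zeta> - w)"
  by auto

lemma poisson_kernel_continuous:
  assumes "cmod w < 1"
  shows "continuous_on unit_circle (\<lambda>\<zeta>. (1 - (cmod w)\<^sup>2) / (cmod (\<zeta> - w))\<^sup>2)"
  using assms by (intro continuous_intros) auto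

lemma poisson_kernel_nonneg: "cmod w < 1 \<Longrightarrow> 0 \<le> (1 - (cmod w)\<^sup>2) / (cmod (\<zeta> - w))\<^sup>2"
  by (auto simp: power_le_one)

lemma cauchy_kernel_continuous:
  assumes "cmod w < 1"
  shows "continuous_on unit_circle (\<lambda>\<zeta>. 1 / (1 - cnj \<zeta> * w))"
proof -
  have "1 - cnj \<zeta> * w \<noteq> 0" if "\<zeta> \<in> unit_circle" for \<zeta>
  proof
    assume "1 - cnj \<zeta> * w = 0"
    then have "cmod (cnj \<zeta> * w) = 1" by simp
    then show False using assms that by (simp add: norm_mult)
  qed
  then show ?thesis by (intro continuous_intros) auto
qed

lemma poisson_one:
  assumes "cmod w < 1"
  shows "(LINT \<zeta>|mT. (1 - (cmod w)\<^sup>2) / (cmod (\<zeta> - w))\<^sup>2) = 1"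
proof -
  have k: "integrable mT (\<lambda>\<zeta>. 1 / (1 - cnj \<zeta> * w))"
    using cauchy_kernel_continuous[OF assms] by (rule integrable_circle_continuous)
  have "(\<lambda>n. fcoeff (\<lambda>_. 1) n * w ^ n) sums riesz_proj (\<lambda>_. 1) w"
    by (rule riesz_proj_sums) (use assms in auto)
  moreover have "fcoeff (\<lambda>_. 1) n = (if n = 0 then 1 else 0)" for n
    using integral_circle_orth[of 0 n] by (auto simp: fcoeff_def)
  moreover have "(\<lambda>n. (if n = 0 then 1 else 0) * w ^ n) = (\<lambda>n. if n = 0 then 1 else 0)" by auto
  ultimately have "(\<lambda>n. if n = 0 then 1 else 0) sums riesz_proj (\<lambda>_. 1) w" by simp
  then have one: "(LINT \<zeta>|mT. 1 / (1 - cnj \<zeta> * w)) = 1"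
    using sums_single[of 0 "\<lambda>_. 1::complex"] unfolding riesz_proj_def by (metis (no_types) sums_unique2)
  have "complex_of_real (LINT \<zeta>|mT. (1 - (cmod w)\<^sup>2) / (cmod (\<zeta> - w))\<^sup>2) =
     (LINT \<zeta>|mT. 1 / (1 - cnj \<zeta> * w) + cnj (1 / (1 - cnj \<zeta> * w)) - 1)"
    by (subst integral_complex_of_real[symmetric], intro Bochner_Integration.integral_cong)
       (use poisson_kernel_eq assms in auto)
  also have "\<dots> = (LINT \<zeta>|mT. 1 / (1 - cnj \<zeta> * w)) + (LINT \<zeta>|mT. cnj (1 / (1 - cnj \<zeta> * w))) - 1"
  proof -
    have k': "integrable mT (\<lambda>\<zeta>. cnj (1 / (1 - cnj \<zeta> * w)))"
      using k by (rule Bochner_Integration.integrable_cnj)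
    show ?thesis
      using mT.prob_space
      by (simp only: Bochner_Integration.integral_diff[OF Bochner_Integration.integrable_add[OF k k'] mT.integrable_const]
          Bochner_Integration.integral_add[OF k k']) simp
  qed
  also have "\<dots> = 1"
    by (subst Bochner_Integration.integral_cnj) (simp add: one)
  finally show ?thesis by (metis of_real_eq_1_iff)
qed

section \<open>Fatou's theorem\<close>

text \<open>Integrating against \<open>dkern z\<close> applies \<open>z d/dz\<close> to the Poisson extension of an analytic function.\<close>

definition dkern :: "complex \<Rightarrow> complex \<Rightarrow> complex" where
  "dkern z \<zeta> = (z * cnj \<zeta>) / (1 - z * cnj \<zeta>)\<^sup>2 - cnj ((z * cnj \<zeta>) / (1 - z * cnj \<zeta>)\<^sup>2)"

lemma koebe_sums:
  fixes x :: "'a::{real_normed_field,banach}"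
  assumes "norm x < 1"
  shows "(\<lambda>n. of_nat n * x ^ n) sums (x / (1 - x)\<^sup>2)"
proof -
  have "(\<lambda>n. x * (of_nat (Suc n) * x ^ n)) sums (x * (1 / (1 - x)\<^sup>2))"
    by (intro sums_mult geometric_deriv_sums assms)
  then have "(\<lambda>n. of_nat (Suc n) * x ^ Suc n) sums (x / (1 - x)\<^sup>2)"
    by (simp add: mult_ac)
  from sums_Suc[OF this] show ?thesis by simp
qed

lemma koebe_summable_norm:
  assumes "cmod x < 1"
  shows "summable (\<lambda>n. cmod (of_nat n * x ^ n))"
  using koebe_sums[of "cmod x"] assms by (simp add: norm_mult norm_power sums_iff)

lemma one_minus_ne: 
  assumes "cmod z < 1" "\<zeta> \<in> unit_circle"
  shows "1 - z * cnj \<zeta> \<noteq> 0"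
proof
  assume "1 - z * cnj \<zeta> = 0"
  then have "cmod (z * cnj \<zeta>) = 1" by simp
  then show False using assms by (simp add: norm_mult)
qed

lemma dkern_continuous: "cmod z < 1 \<Longrightarrow> continuous_on unit_circle (dkern z)"
  unfolding dkern_def using one_minus_ne[of z] by (intro continuous_intros) auto

text \<open>The first summand of \<open>dkern\<close> expands into the terms
  \<open>n * z ^ n * cnj \<zeta> ^ n\<close> and picks out the index \<open>k\<close>. The conjugate
  summand contains only powers of \<open>\<zeta>\<close>, and its constant term carries the factor
  0. The cases 0 and 1 make the kernel exact on affine functions.\<close>

lemma dkern_moment:
  assumes "cmod z < 1"
  shows "(LINT \<zeta>|mT. dkern z \<zeta> * \<zeta> ^ k) = of_nat k * z ^ k"
proof -
  let ?S = "\<lambda>\<zeta>. (z * cnj \<zeta>) / (1 - z * cnj \<zeta>)\<^sup>2"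
  have ser: "(\<lambda>n. (of_nat n * z ^ n) * cnj \<zeta> ^ n) sums ?S \<zeta>" if "\<zeta> \<in> unit_circle" for \<zeta>
    using koebe_sums[of "z * cnj \<zeta>"] assms that by (simp add: norm_mult power_mult_distrib mult_ac)
  have cont: "continuous_on unit_circle ?S"
    using one_minus_ne[OF assms] by (intro continuous_intros) auto
  have "(\<lambda>n. (of_nat n * z ^ n) * (LINT \<zeta>|mT. \<zeta> ^ k * cnj \<zeta> ^ n)) sums (LINT \<zeta>|mT. \<zeta> ^ k * (\<Sum>n. (of_nat n * z ^ n) * cnj \<zeta> ^ n))"
    by (rule integral_times_series)
       (auto intro!: koebe_summable_norm assms integrable_circle_continuous continuous_intros simp: norm_power)
  moreover have "(LINT \<zeta>|mT. \<zeta> ^ k * (\<Sum>n. (of_nat n * z ^ n) * cnj \<zeta> ^ n)) = (LINT \<zeta>|mT. \<zeta> ^ k * ?S \<zeta>)"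
    by (intro Bochner_Integration.integral_cong) (simp_all add: sums_unique[OF ser, symmetric])
  moreover have "(\<lambda>n. (of_nat n * z ^ n) * (LINT \<zeta>|mT. \<zeta> ^ k * cnj \<zeta> ^ n)) = (\<lambda>n. if n = k then of_nat n * z ^ n else 0)"
    by (auto simp: integral_circle_orth)
  ultimately have "(\<lambda>n. if n = k then of_nat n * z ^ n else 0) sums (LINT \<zeta>|mT. \<zeta> ^ k * ?S \<zeta>)" by simp
  then have 1: "(LINT \<zeta>|mT. \<zeta> ^ k * ?S \<zeta>) = of_nat k * z ^ k"
    using sums_single[of k "\<lambda>n. of_nat n * z ^ n"] sums_unique2 by blast
  have ser2: "(\<lambda>n. (of_nat n * cnj z ^ n) * \<zeta> ^ n) sums cnj (?S \<zeta>)" if "\<zeta> \<in> unit_circle" for \<zeta>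
    by (subst sums_cnj[symmetric]) (use ser[OF that] in simp)
  have "(\<lambda>n. (of_nat n * cnj z ^ n) * (LINT \<zeta>|mT. \<zeta> ^ k * \<zeta> ^ n)) sums (LINT \<zeta>|mT. \<zeta> ^ k * (\<Sum>n. (of_nat n * cnj z ^ n) * \<zeta> ^ n))"
    using assms by (intro integral_times_series)
       (auto intro!: koebe_summable_norm integrable_circle_continuous continuous_intros simp: norm_power)
  moreover have "(LINT \<zeta>|mT. \<zeta> ^ k * (\<Sum>n. (of_nat n * cnj z ^ n) * \<zeta> ^ n)) = (LINT \<zeta>|mT. \<zeta> ^ k * cnj (?S \<zeta>))"
    by (intro Bochner_Integration.integral_cong refl) (simp only: sums_unique[OF ser2, symmetric] space_circle)
  moreover have "(\<lambda>n. (of_nat n * cnj z ^ n) * (LINT \<zeta>|mT. \<zeta> ^ k * \<zeta> ^ n)) = (\<lambda>n. 0)"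
    by (auto simp: power_add[symmetric] integral_circle_power)
  ultimately have "(\<lambda>n. 0) sums (LINT \<zeta>|mT. \<zeta> ^ k * cnj (?S \<zeta>))" by (simp only:)
  then have 2: "(LINT \<zeta>|mT. \<zeta> ^ k * cnj (?S \<zeta>)) = 0"
    using sums_unique2[OF _ sums_zero] by blast
  have "(LINT \<zeta>|mT. dkern z \<zeta> * \<zeta> ^ k) = (LINT \<zeta>|mT. \<zeta> ^ k * ?S \<zeta> - \<zeta> ^ k * cnj (?S \<zeta>))"
    unfolding dkern_def mult.commute[of _ "_ ^ k"] right_diff_distrib ..
  also have "\<dots> = of_nat k * z ^ k - 0"
    unfolding 1[symmetric] 2[symmetric]
    by (intro Bochner_Integration.integral_diff integrable_circle_continuous continuous_on_mult
        continuous_on_cnj continuous_on_power continuous_on_id cont)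
  finally show ?thesis by simp
qed

lemma dkern_series:
  assumes "cmod z < 1" "summable (\<lambda>n. cmod (c n))"
  shows "(\<lambda>k. of_nat k * c k * z ^ k) sums (LINT \<zeta>|mT. dkern z \<zeta> * (\<Sum>k. c k * \<zeta> ^ k))"
proof -
  have "(\<lambda>k. c k * (LINT \<zeta>|mT. dkern z \<zeta> * \<zeta> ^ k)) sums (LINT \<zeta>|mT. dkern z \<zeta> * (\<Sum>k. c k * \<zeta> ^ k))"
    using assms by (intro integral_times_series integrable_circle_continuous dkern_continuous)
      (auto intro!: continuous_intros simp: norm_power)
  then show ?thesis unfolding dkern_moment[OF assms(1)] by (simp add: mult_ac)
qed

lemma cmod_one_minus_eq:
  assumes "\<zeta> \<in> unit_circle"
  shows "cmod (1 - z * cnj \<zeta>) = cmod (\<zeta> - z)"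
proof -
  have "\<zeta> - z = \<zeta> * (1 - z * cnj \<zeta>)"
    using circle_cnj_mult[OF assms] by (simp add: right_diff_distrib mult.left_commute[of \<zeta> z])
  then show ?thesis using assms by (simp add: norm_mult)
qed

text \<open>Subtracting the conjugate produces the numerator
  \<open>(x - cnj x) * (1 - x * cnj x)\<close>: the first factor is small near
  \<open>\<zeta>'\<close> and the second near the circle. Against an error of first order at
  \<open>\<zeta>'\<close> this leaves a Poisson kernel.\<close>

lemma dkern_bound:
  assumes "\<zeta> \<in> unit_circle" "\<zeta>' \<in> unit_circle" "0 \<le> r" "r < 1"
  shows "cmod (dkern (of_real r * \<zeta>') \<zeta>) \<le> 2 * cmod (\<zeta> - \<zeta>') * (1 - r\<^sup>2) / (cmod (\<zeta> - of_real r * \<zeta>')) ^ 4"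
proof -
  define x where "x = of_real r * \<zeta>' * cnj \<zeta>"
  have nx: "cmod x = r" using assms by (simp add: x_def norm_mult)
  have ne: "1 - x \<noteq> 0" using nx assms(4) by auto
  have cne: "1 - cnj x \<noteq> 0" using ne by (metis complex_cnj_diff complex_cnj_one complex_cnj_zero_iff)
  have d: "cmod (1 - x) = cmod (\<zeta> - of_real r * \<zeta>')" unfolding x_def by (rule cmod_one_minus_eq[OF assms(1)])
  have "dkern (of_real r * \<zeta>') \<zeta> = x / (1 - x)\<^sup>2 - cnj x / (1 - cnj x)\<^sup>2"
    by (simp add: dkern_def x_def)
  also have "\<dots> = (x * (1 - cnj x)\<^sup>2 - cnj x * (1 - x)\<^sup>2) / ((1 - x)\<^sup>2 * (1 - cnj x)\<^sup>2)"
    using ne cne by (simp add: diff_frac_eq)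
  also have "x * (1 - cnj x)\<^sup>2 - cnj x * (1 - x)\<^sup>2 = (x - cnj x) * (1 - x * cnj x)"
    by (simp add: algebra_simps power2_eq_square)
  also have "1 - x * cnj x = of_real (1 - r\<^sup>2)"
    using nx by (simp add: complex_norm_square[symmetric])
  finally have "cmod (dkern (of_real r * \<zeta>') \<zeta>) = cmod (x - cnj x) * \<bar>1 - r\<^sup>2\<bar> / (cmod (1 - x)) ^ 4"
  proof -
    assume *: "dkern (of_real r * \<zeta>') \<zeta> = (x - cnj x) * of_real (1 - r\<^sup>2) / ((1 - x)\<^sup>2 * (1 - cnj x)\<^sup>2)"
    have "cmod (1 - cnj x) = cmod (1 - x)"
      by (metis complex_cnj_diff complex_cnj_one complex_mod_cnj)
    then have "cmod ((1 - x)\<^sup>2 * (1 - cnj x)\<^sup>2) = cmod (1 - x) ^ 4"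
      by (simp add: norm_mult norm_power power_add[symmetric])
    then show ?thesis unfolding * by (simp only: norm_divide norm_mult norm_of_real)
  qed
  moreover have "\<bar>1 - r\<^sup>2\<bar> = 1 - r\<^sup>2" using assms by (simp add: power_le_one)
  moreover have "cmod (x - cnj x) \<le> 2 * cmod (\<zeta> - \<zeta>')"
  proof -
    have "x - cnj x = (x - of_real r) - cnj (x - of_real r)" by simp
    then have "cmod (x - cnj x) \<le> cmod (x - of_real r) + cmod (cnj (x - of_real r))"
      using norm_triangle_ineq4 by metis
    also have "\<dots> = 2 * cmod (x - of_real r)" unfolding complex_mod_cnj by simp
    also have "x - of_real r = - (of_real r * (1 - \<zeta>' * cnj \<zeta>))"
      by (simp add: x_def algebra_simps)
    also have "cmod \<dots> = r * cmod (\<zeta> - \<zeta>')"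
      using assms cmod_one_minus_eq[OF assms(1), of \<zeta>'] by (simp add: norm_mult)
    also have "2 * (r * cmod (\<zeta> - \<zeta>')) \<le> 2 * (1 * cmod (\<zeta> - \<zeta>'))"
      using assms by (intro mult_left_mono mult_right_mono) auto
    finally show ?thesis by simp
  qed
  ultimately show ?thesis
    using assms by (auto simp: d power_le_one intro!: divide_right_mono mult_right_mono)
qed

text \<open>The function \<open>z * f z\<close> is the integral of the boundary primitive against
  \<open>dkern z\<close>. The affine approximation at \<open>\<zeta>'\<close> contributes exactly
  \<open>A * z\<close>; the remainder is of smaller order near \<open>\<zeta>'\<close>, where the
  kernel bound turns it into a small multiple of the Poisson kernel.\<close>

lemma radial_limit_of_primitive_derivative:
  assumes hol: "f holomorphic_on unit_disc"
    and c: "summable (\<lambda>n. cmod (c n))" "\<And>n. c (Suc n) = tcoeff f n / of_nat (Suc n)"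
    and \<zeta>': "\<zeta>' \<in> unit_circle"
    and diff: "\<And>\<epsilon>. 0 < \<epsilon> \<Longrightarrow> \<exists>\<delta>>0. \<forall>\<zeta>\<in>unit_circle. cmod (\<zeta> - \<zeta>') < \<delta> \<longrightarrow>
      cmod ((\<Sum>n. c n * \<zeta> ^ n) - (\<Sum>n. c n * \<zeta>' ^ n) - A * (\<zeta> - \<zeta>')) \<le> \<epsilon> * cmod (\<zeta> - \<zeta>')"
  shows "has_radial_limit f \<zeta>' A"
  unfolding has_radial_limit_def
proof (rule tendstoI)
  fix e :: real assume e: "e > 0"
  define G where "G = (\<lambda>\<zeta>. \<Sum>n. c n * \<zeta> ^ n)"
  define E where "E = (\<lambda>\<zeta>. G \<zeta> - G \<zeta>' - A * (\<zeta> - \<zeta>'))"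
  \<comment> \<open>The estimate below ends with \<open>20 * \<epsilon>\<close>, so 21 leaves a
    strict inequality.\<close>
  define \<epsilon> where "\<epsilon> = e / 21"
  have \<epsilon>: "\<epsilon> > 0" using e by (simp add: \<epsilon>_def)
  obtain \<delta> where \<delta>: "\<delta> > 0" "\<And>\<zeta>. \<zeta> \<in> unit_circle \<Longrightarrow> cmod (\<zeta> - \<zeta>') < \<delta> \<Longrightarrow> cmod (E \<zeta>) \<le> \<epsilon> * cmod (\<zeta> - \<zeta>')"
    using diff[OF \<epsilon>] unfolding E_def G_def by blast
  define M where "M = 2 * (\<Sum>n. cmod (c n)) + 2 * cmod A"
  have GM: "cmod (G \<zeta>) \<le> (\<Sum>n. cmod (c n))" if "\<zeta> \<in> unit_circle" for \<zeta>
    unfolding G_def using that by (intro circle_series_bound c) auto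
  have two: "cmod (\<zeta> - \<zeta>') \<le> 2" if "\<zeta> \<in> unit_circle" for \<zeta>
    using norm_triangle_ineq4[of \<zeta> \<zeta>'] that \<zeta>' by simp
  have EM: "cmod (E \<zeta>) \<le> M" if "\<zeta> \<in> unit_circle" for \<zeta>
  proof -
    have "cmod (E \<zeta>) \<le> cmod (G \<zeta>) + cmod (G \<zeta>') + cmod (A * (\<zeta> - \<zeta>'))"
      unfolding E_def using norm_triangle_ineq4[of "G \<zeta> - G \<zeta>'" "A * (\<zeta> - \<zeta>')"] norm_triangle_ineq4[of "G \<zeta>" "G \<zeta>'"] by linarith
    moreover have "cmod (A * (\<zeta> - \<zeta>')) \<le> cmod A * 2"
      unfolding norm_mult using two[OF that] by (intro mult_left_mono) auto
    ultimately show ?thesis using GM[OF that] GM[OF \<zeta>'] by (simp add: M_def)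
  qed
  have M0: "M \<ge> 0" using EM[OF \<zeta>'] norm_ge_zero order_trans by blast
  \<comment> \<open>Away from \<open>\<zeta>'\<close> the kernel is at most
    \<open>4 * (1 - r\<^sup>2) / (\<delta> / 2) ^ 4\<close> and the error at most \<open>M\<close>;
    64 is \<open>4 * 2 ^ 4\<close>.\<close>
  define C where "C = 64 * M / \<delta> ^ 4"
  have C0: "C \<ge> 0" using M0 \<delta> by (simp add: C_def)
  have point: "cmod (dkern (of_real r * \<zeta>') \<zeta> * E \<zeta>) \<le> 8 * \<epsilon> * ((1 - r\<^sup>2) / (cmod (\<zeta> - of_real r * \<zeta>'))\<^sup>2) + C * (1 - r\<^sup>2)"
    if r: "0 \<le> r" "r < 1" and \<zeta>: "\<zeta> \<in> unit_circle" for r \<zeta>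
  proof -
    define d where "d = cmod (\<zeta> - of_real r * \<zeta>')"
    define t where "t = cmod (\<zeta> - \<zeta>')"
    have t0: "0 \<le> t" by (simp add: t_def)
    have d0: "0 < d" unfolding d_def using \<zeta> r \<zeta>' by (intro circle_dist_pos) (auto simp: norm_mult)
    have r2: "0 \<le> 1 - r\<^sup>2" using r by (simp add: power_le_one)
    \<comment> \<open>The aim is \<open>t \<le> 2 * d\<close>: the dilated point is no farther from
      \<open>\<zeta>'\<close> than from \<open>\<zeta>\<close>.\<close>
    have "1 - r \<le> d"
      using norm_triangle_ineq2[of \<zeta> "of_real r * \<zeta>'"] \<zeta> \<zeta>' r by (simp add: d_def norm_mult)
    moreover have "t \<le> d + (1 - r)"
    proof -
      have "\<zeta> - \<zeta>' = (\<zeta> - of_real r * \<zeta>') - of_real (1 - r) * \<zeta>'" by (simp add: algebra_simps)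
      then have "t \<le> d + cmod (of_real (1 - r) * \<zeta>')"
        unfolding t_def d_def using norm_triangle_ineq4 by metis
      also have "cmod (of_real (1 - r) * \<zeta>') = 1 - r"
        using \<zeta>' r unfolding norm_mult norm_of_real by simp
      finally show ?thesis .
    qed
    ultimately have td: "t \<le> 2 * d" by linarith
    have k: "cmod (dkern (of_real r * \<zeta>') \<zeta>) \<le> 2 * t * (1 - r\<^sup>2) / d ^ 4"
      using dkern_bound[OF \<zeta> \<zeta>' r] by (simp add: t_def d_def)
    show ?thesis
    proof (cases "t < \<delta>")
      case True
      have "cmod (dkern (of_real r * \<zeta>') \<zeta> * E \<zeta>) \<le> (2 * t * (1 - r\<^sup>2) / d ^ 4) * (\<epsilon> * t)"
        unfolding norm_mult using \<delta>(2)[OF \<zeta>] True k t0 r2 by (intro mult_mono) (auto simp: t_def)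
      also have "\<dots> = 2 * \<epsilon> * (1 - r\<^sup>2) / d ^ 4 * t\<^sup>2" by (simp add: power2_eq_square)
      also have "\<dots> \<le> 2 * \<epsilon> * (1 - r\<^sup>2) / d ^ 4 * (2 * d)\<^sup>2"
        using td t0 r2 \<epsilon> by (intro mult_left_mono power_mono) auto
      also have "\<dots> = 8 * \<epsilon> * ((1 - r\<^sup>2) / d\<^sup>2)"
        using d0 by (simp add: field_simps power2_eq_square eval_nat_numeral)
      finally show ?thesis using C0 r2 by (simp add: d_def add_increasing2)
    next
      case False
      then have "\<delta> / 2 \<le> d" using td by linarith
      then have "(\<delta> / 2) ^ 4 \<le> d ^ 4" using \<delta> by (intro power_mono) auto
      then have "2 * t * (1 - r\<^sup>2) / d ^ 4 \<le> 4 * (1 - r\<^sup>2) / (\<delta> / 2) ^ 4"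
        using two[OF \<zeta>] r2 d0 \<delta> t0 by (intro frac_le mult_right_mono) (auto simp: t_def)
      then have "cmod (dkern (of_real r * \<zeta>') \<zeta> * E \<zeta>) \<le> (4 * (1 - r\<^sup>2) / (\<delta> / 2) ^ 4) * M"
        unfolding norm_mult using EM[OF \<zeta>] k r2 \<delta> by (intro mult_mono) auto
      also have "\<dots> = C * (1 - r\<^sup>2)" using \<delta> by (simp add: C_def power_divide)
      finally show ?thesis using \<epsilon> r2 by (simp add: add_increasing)
    qed
  qed
  have bound: "cmod (of_real r * \<zeta>' * f (of_real r * \<zeta>') - A * (of_real r * \<zeta>')) \<le> 8 * \<epsilon> + C * (1 - r\<^sup>2)"
    if r: "0 \<le> r" "r < 1" for r
  proof -
    define z where "z = of_real r * \<zeta>'"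
    have z: "cmod z < 1" using r \<zeta>' by (simp add: z_def norm_mult)
    have nz: "cmod z = r" using r \<zeta>' by (simp add: z_def norm_mult)
    have zf: "z * f z = (LINT \<zeta>|mT. dkern z \<zeta> * G \<zeta>)"
    proof -
      have "(\<lambda>n. z * (tcoeff f n * z ^ n)) sums (z * f z)" by (intro sums_mult tcoeff_sums hol z)
      moreover have "z * (tcoeff f n * z ^ n) = of_nat (Suc n) * c (Suc n) * z ^ Suc n" for n
        unfolding c(2) by (simp del: of_nat_Suc)
      ultimately have "(\<lambda>n. of_nat n * c n * z ^ n) sums (z * f z + of_nat 0 * c 0 * z ^ 0)"
        by (intro sums_Suc) simp
      then show ?thesis using dkern_series[OF z c(1)] unfolding G_def by (simp add: sums_unique2)
    qed
    have iK: "integrable mT (dkern z)" by (intro integrable_circle_continuous dkern_continuous z)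
    have iG: "integrable mT (\<lambda>\<zeta>. dkern z \<zeta> * G \<zeta>)"
      unfolding G_def using circle_series_bound[OF c(1)]
      by (intro integrable_times_bounded[OF iK, where K="\<Sum>n. cmod (c n)"] circle_series_measurable AE_I2) auto
    have iL: "integrable mT (\<lambda>\<zeta>. dkern z \<zeta> * (G \<zeta>' + A * (\<zeta> - \<zeta>')))"
      by (intro integrable_times_continuous iK continuous_intros)
    have L: "(LINT \<zeta>|mT. dkern z \<zeta> * (G \<zeta>' + A * (\<zeta> - \<zeta>'))) = A * z"
    proof -
      have "(LINT \<zeta>|mT. dkern z \<zeta> * (G \<zeta>' + A * (\<zeta> - \<zeta>'))) = (LINT \<zeta>|mT. A * (dkern z \<zeta> * \<zeta> ^ 1) + (G \<zeta>' - A * \<zeta>') * (dkern z \<zeta> * \<zeta> ^ 0))"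
        by (simp add: algebra_simps)
      also have "\<dots> = A * (LINT \<zeta>|mT. dkern z \<zeta> * \<zeta> ^ 1) + (G \<zeta>' - A * \<zeta>') * (LINT \<zeta>|mT. dkern z \<zeta> * \<zeta> ^ 0)"
        by (subst Bochner_Integration.integral_add)
           (auto intro!: integrable_mult_right integrable_times_continuous[of _ "\<lambda>\<zeta>. \<zeta>"] iK continuous_intros)
      finally show ?thesis unfolding dkern_moment[OF z] by simp
    qed
    have "z * f z - A * z = (LINT \<zeta>|mT. dkern z \<zeta> * G \<zeta> - dkern z \<zeta> * (G \<zeta>' + A * (\<zeta> - \<zeta>')))"
      unfolding zf L[symmetric] by (rule Bochner_Integration.integral_diff[OF iG iL, symmetric])
    also have "\<dots> = (LINT \<zeta>|mT. dkern z \<zeta> * E \<zeta>)"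
      by (simp add: E_def algebra_simps)
    finally have eq: "z * f z - A * z = (LINT \<zeta>|mT. dkern z \<zeta> * E \<zeta>)" .
    have iP: "integrable mT (\<lambda>\<zeta>. (1 - (cmod z)\<^sup>2) / (cmod (\<zeta> - z))\<^sup>2)"
      by (intro integrable_circle_continuous poisson_kernel_continuous z)
    have "cmod (LINT \<zeta>|mT. dkern z \<zeta> * E \<zeta>) \<le> (LINT \<zeta>|mT. 8 * \<epsilon> * ((1 - (cmod z)\<^sup>2) / (cmod (\<zeta> - z))\<^sup>2) + C * (1 - r\<^sup>2))"
    proof (rule order_trans[OF integral_norm_bound], rule Bochner_Integration.integral_mono)
      show "integrable mT (\<lambda>\<zeta>. cmod (dkern z \<zeta> * E \<zeta>))"
        using integrable_norm[OF Bochner_Integration.integrable_diff[OF iG iL]] by (simp add: E_def algebra_simps)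
      show "cmod (dkern z \<zeta> * E \<zeta>) \<le> 8 * \<epsilon> * ((1 - (cmod z)\<^sup>2) / (cmod (\<zeta> - z))\<^sup>2) + C * (1 - r\<^sup>2)"
        if "\<zeta> \<in> space mT" for \<zeta>
        using point[OF r, of \<zeta>] that unfolding z_def[symmetric] nz by simp
    qed (intro Bochner_Integration.integrable_add integrable_mult_right iP mT.integrable_const)
    also have "\<dots> = 8 * \<epsilon> * (LINT \<zeta>|mT. (1 - (cmod z)\<^sup>2) / (cmod (\<zeta> - z))\<^sup>2) + C * (1 - r\<^sup>2)"
      using mT.prob_space
      by (simp only: Bochner_Integration.integral_add[OF integrable_mult_right[OF iP] mT.integrable_const]
          integral_mult_right_zero lebesgue_integral_const) simp
    also have "\<dots> = 8 * \<epsilon> + C * (1 - r\<^sup>2)" by (simp only: poisson_one[OF z] mult_1_right)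
    finally show ?thesis unfolding eq[symmetric] unfolding z_def by (simp add: mult.assoc)
  qed
  \<comment> \<open>The first threshold makes the far term at most \<open>2 * \<epsilon>\<close>;
    the second permits division by \<open>r\<close> at the cost of a factor 2.\<close>
  have "1 - \<epsilon> / (C + 1) < 1" "(1::real)/2 < 1" using \<epsilon> C0 by auto
  from radial_eventually[OF this(1)] radial_eventually[OF this(2)]
  show "\<forall>\<^sub>F r in at_left 1. dist (f (of_real r * \<zeta>')) A < e"
  proof eventually_elim
    case (elim r)
    then have r: "0 \<le> r" "r < 1" "1/2 < r" and *: "1 - \<epsilon> / (C + 1) < r" by auto
    have "(1 - r) * (C + 1) < \<epsilon>" using * C0 by (simp add: field_simps)
    then have "(1 - r) * C < \<epsilon>" using r by (simp add: algebra_simps)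
    moreover have "1 - r\<^sup>2 \<le> 2 * (1 - r)"
      using zero_le_power2[of "1 - r"] by (simp add: power2_eq_square algebra_simps)
    then have "C * (1 - r\<^sup>2) \<le> C * (2 * (1 - r))" by (rule mult_left_mono[OF _ C0])
    ultimately have "C * (1 - r\<^sup>2) \<le> 2 * \<epsilon>" by (simp add: algebra_simps)
    then have b: "cmod (of_real r * \<zeta>' * f (of_real r * \<zeta>') - A * (of_real r * \<zeta>')) \<le> 10 * \<epsilon>"
      using bound[OF r(1,2)] by linarith
    have "of_real r * \<zeta>' * f (of_real r * \<zeta>') - A * (of_real r * \<zeta>') = of_real r * \<zeta>' * (f (of_real r * \<zeta>') - A)"
      by (simp add: algebra_simps)
    then have "r * dist (f (of_real r * \<zeta>')) A \<le> 10 * \<epsilon>"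
      using b \<zeta>' r by (simp add: norm_mult dist_norm)
    moreover have "1/2 * dist (f (of_real r * \<zeta>')) A \<le> r * dist (f (of_real r * \<zeta>')) A"
      using r by (intro mult_right_mono) auto
    ultimately have "dist (f (of_real r * \<zeta>')) A \<le> 20 * \<epsilon>" by linarith
    then show ?case using e by (simp add: \<epsilon>_def)
  qed
qed

section \<open>The boundary primitive as an indefinite integral\<close>

lemma cis_monomial_integral:
  assumes "0 \<le> \<theta>"
  shows "(LINT t|lborel. indicator {0..\<theta>} t *\<^sub>R (\<i> * cis t * cis t ^ n)) = (cis \<theta> ^ Suc n - 1) / of_nat (Suc n)"
proof -
  have "(LINT t|lborel. indicator {0..\<theta>} t *\<^sub>R (\<i> * cis t * cis t ^ n)) = cis \<theta> ^ Suc n / of_nat (Suc n) - cis 0 ^ Suc n / of_nat (Suc n)"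
  proof (rule integral_FTC_Icc[OF assms])
    fix x :: real
    have "((\<lambda>t. exp (\<i> * of_nat (Suc n) * t) / of_nat (Suc n)) has_field_derivative \<i> * exp (\<i> * of_nat (Suc n) * x)) (at (of_real x))"
      by (auto intro!: derivative_eq_intros simp del: of_nat_Suc)
    then have "((\<lambda>t. exp (\<i> * of_nat (Suc n) * of_real t) / of_nat (Suc n)) has_vector_derivative \<i> * exp (\<i> * of_nat (Suc n) * x)) (at x within {0..\<theta>})"
      using has_vector_derivative_real_field has_vector_derivative_at_within by blast
    moreover have "exp (\<i> * of_nat (Suc n) * of_real t) = cis t ^ Suc n" for t
    proof -
      have "cis t ^ Suc n = cis (real (Suc n) * t)" by (rule Complex.DeMoivre)
      then show ?thesis by (simp add: cis_conv_exp mult_ac del: of_nat_Suc power_Suc)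
    qed
    ultimately show "((\<lambda>t. cis t ^ Suc n / of_nat (Suc n)) has_vector_derivative \<i> * cis x * cis x ^ n) (at x within {0..\<theta>})"
      by (simp add: mult.assoc)
  qed (auto intro!: continuous_intros)
  then show ?thesis by (simp add: diff_divide_distrib)
qed

lemma sum_blocks:
  fixes N :: "nat \<Rightarrow> nat"
  assumes "N 0 = 0" "\<And>k. N k \<le> N (Suc k)"
  shows "(\<Sum>k<K. \<Sum>n\<in>{N k..<N (Suc k)}. g n) = (\<Sum>n<N K. g n :: 'a::comm_monoid_add)"
proof (induction K)
  case 0 then show ?case using assms by simp
next
  case (Suc K)
  have "(\<Sum>n<N (Suc K). g n) = sum g {0..<N K} + sum g {N K..<N (Suc K)}"
    using sum.atLeastLessThan_concat[of 0 "N K" "N (Suc K)" g] assms(2) by (simp add: atLeast0LessThan)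
  then show ?case using Suc by (simp add: atLeast0LessThan)
qed

text \<open>The Cauchy criterion selects the cuts. The rate \<open>(1/4) ^ k\<close> for squared
  norms makes the norms themselves at most \<open>(1/2) ^ k\<close>, hence summable; the block of
  index 0 is left uncontrolled.\<close>

lemma square_summable_rapid_blocks:
  fixes b :: "nat \<Rightarrow> real"
  assumes "summable b" "\<And>n. 0 \<le> b n"
  obtains N :: "nat \<Rightarrow> nat" where "N 0 = 0" "strict_mono N"
    "\<And>k. (\<Sum>n\<in>{N (Suc k)..<N (Suc (Suc k))}. b n) \<le> (1/4) ^ k"
proof -
  have "\<exists>M. \<forall>m\<ge>M. \<forall>n. norm (sum b {m..<n}) < (1/4) ^ k" for k
    using assms(1) unfolding summable_Cauchy by simp
  then obtain M where M: "\<And>k m n. M k \<le> m \<Longrightarrow> norm (sum b {m..<n}) < (1/4) ^ k" by metis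
  \<comment> \<open>Adding \<open>Suc (M j)\<close> makes \<open>N\<close> strictly increasing and
    at the same time puts \<open>N (Suc k)\<close> beyond \<open>M k\<close>.\<close>
  define N where "N k = (\<Sum>j<k. Suc (M j))" for k
  have "N (Suc k) \<ge> M k" for k by (simp add: N_def)
  then have "norm (\<Sum>n\<in>{N (Suc k)..<N (Suc (Suc k))}. b n) < (1/4) ^ k" for k
    by (rule M)
  then have "(\<Sum>n\<in>{N (Suc k)..<N (Suc (Suc k))}. b n) \<le> (1/4) ^ k" for k
    by (smt (verit) real_norm_def)
  moreover have "strict_mono N" by (simp add: strict_mono_Suc_iff N_def)
  ultimately show ?thesis using that[of N] by (simp add: N_def)
qed

lemma sqn_block:
  "sqn (\<lambda>\<zeta>. \<Sum>n\<in>{M..<N}. a n * \<zeta> ^ n) = (\<Sum>n\<in>{M..<N}. (cmod (a n))\<^sup>2)"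
proof -
  have "(\<Sum>n\<in>{M..<N}. a n * \<zeta> ^ n) = (\<Sum>n<N. (if M \<le> n then a n else 0) * \<zeta> ^ n)" for \<zeta>
    by (rule sum.mono_neutral_cong_left) auto
  moreover have "(\<Sum>n\<in>{M..<N}. (cmod (a n))\<^sup>2) = (\<Sum>n<N. (cmod (if M \<le> n then a n else 0))\<^sup>2)"
    by (rule sum.mono_neutral_cong_left) auto
  ultimately show ?thesis by (simp only: sqn_sum)
qed

text \<open>Riesz--Fischer along a lacunary sequence of partial sums: \<open>\<psi>\<close> is their limit in \<open>L\<^sup>1\<close>.\<close>

lemma primitive_boundary_integral:
  fixes a c :: "nat \<Rightarrow> complex"
  assumes a: "summable (\<lambda>n. (cmod (a n))\<^sup>2)"
    and c: "summable (\<lambda>n. cmod (c n))" "\<And>n. c (Suc n) = a n / of_nat (Suc n)"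
  obtains \<psi> :: "real \<Rightarrow> complex" where "integrable lborel \<psi>"
    "\<And>\<theta>. 0 \<le> \<theta> \<Longrightarrow> \<theta> \<le> 2 * pi \<Longrightarrow> (LINT t|lborel. indicator {0..\<theta>} t *\<^sub>R \<psi> t) = (\<Sum>n. c n * cis \<theta> ^ n) - (\<Sum>n. c n)"
proof -
  obtain N where N: "N 0 = 0" "strict_mono N"
    "\<And>k. (\<Sum>n\<in>{N (Suc k)..<N (Suc (Suc k))}. (cmod (a n))\<^sup>2) \<le> (1/4) ^ k"
    using square_summable_rapid_blocks[OF a] by auto
  define D where "D k \<zeta> = (\<Sum>n\<in>{N k..<N (Suc k)}. a n * \<zeta> ^ n)" for k \<zeta>
  \<comment> \<open>The factor \<open>\<i> * cis t\<close> is the derivative of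
    \<open>cis t\<close>, so integrating in \<open>t\<close> integrates the block along the arc and
    raises each power by one.\<close>
  define d where "d k t = indicator {0..2*pi} t *\<^sub>R (\<i> * cis t * D k (cis t))" for k t
  have int: "integrable lborel (d k)" for k
    unfolding d_def[abs_def] D_def
    by (intro borel_integrable_compact continuous_intros) auto
  have norm_d: "(LINT t|lborel. norm (d k t)) = 2 * pi * (LINT \<zeta>|mT. cmod (D k \<zeta>))" for k
  proof -
    have "(LINT \<zeta>|mT. cmod (D k \<zeta>)) = (LINT t|lborel. indicator {0..2 * pi} t *\<^sub>R cmod (D k (cis t))) /\<^sub>R (2 * pi)"
      unfolding D_def by (intro integral_circle continuous_imp_measurable_circle continuous_intros)
    moreover have "norm (d k t) = indicator {0..2 * pi} t *\<^sub>R cmod (D k (cis t))" for t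
      by (simp add: d_def norm_mult indicator_def)
    ultimately show ?thesis using pi_gt_zero by (simp add: field_simps)
  qed
  have D_le: "(LINT \<zeta>|mT. cmod (D (Suc k) \<zeta>)) \<le> (1/2) ^ k" for k
  proof -
    have "sq_integrable (D (Suc k))"
      unfolding D_def by (intro sq_integrable_continuous continuous_intros)
    from integral_norm_le_sqn[OF this] have "(LINT \<zeta>|mT. cmod (D (Suc k) \<zeta>))\<^sup>2 \<le> (1/4) ^ k"
      using N(3)[of k] unfolding D_def sqn_block by linarith
    also have "(1/4) ^ k = ((1/2) ^ k :: real)\<^sup>2"
      unfolding power2_eq_square power_mult_distrib[symmetric] by simp
    finally show ?thesis by (rule power2_le_imp_le) auto
  qed
  have summ: "summable (\<lambda>k. LINT t|lborel. norm (d k t))"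
  proof (subst summable_Suc_iff[symmetric], rule summable_comparison_test')
    show "summable (\<lambda>k. 2 * pi * (1/2) ^ k)" by (intro summable_mult summable_geometric) auto
    show "norm (LINT t|lborel. norm (d (Suc k) t)) \<le> 2 * pi * (1/2) ^ k" for k
      using D_le[of k] by (simp add: norm_d abs_mult)
  qed
  \<comment> \<open>By Tonelli the sum of the norms has a finite integral, hence is finite almost
    everywhere.\<close>
  have ae: "AE t in lborel. summable (\<lambda>k. norm (d k t))"
  proof -
    have [measurable]: "d k \<in> borel_measurable lborel" for k using int by auto
    have "(\<integral>\<^sup>+t. (\<Sum>k. ennreal (norm (d k t))) \<partial>lborel) = (\<Sum>k. \<integral>\<^sup>+t. ennreal (norm (d k t)) \<partial>lborel)"
      by (rule nn_integral_suminf) auto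
    also have "\<dots> = (\<Sum>k. ennreal (LINT t|lborel. norm (d k t)))"
      by (intro suminf_cong nn_integral_eq_integral integrable_norm int) auto
    also have "\<dots> = ennreal (\<Sum>k. LINT t|lborel. norm (d k t))"
      by (intro suminf_ennreal2 summ) auto
    finally have "(\<integral>\<^sup>+t. (\<Sum>k. ennreal (norm (d k t))) \<partial>lborel) \<noteq> \<infinity>" by simp
    then have "AE t in lborel. (\<Sum>k. ennreal (norm (d k t))) \<noteq> \<infinity>"
      by (intro nn_integral_PInf_AE) auto
    then show ?thesis
      by eventually_elim (rule summable_suminf_not_top, auto)
  qed
  define \<psi> where "\<psi> t = (\<Sum>k. d k t)" for t
  show ?thesis
  proof (rule that[of \<psi>])
    show "integrable lborel \<psi>"
      unfolding \<psi>_def[abs_def] by (rule integrable_suminf[OF int ae summ])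
    fix \<theta> :: real assume \<theta>: "0 \<le> \<theta>" "\<theta> \<le> 2 * pi"
    define e where "e k t = indicator {0..\<theta>} t *\<^sub>R d k t" for k t
    have inte: "integrable lborel (e k)" for k
      unfolding e_def[abs_def] using int by (intro integrable_mult_indicator) auto
    have le: "norm (e k t) \<le> norm (d k t)" for k t by (simp add: e_def indicator_def)
    have "(\<lambda>k. LINT t|lborel. e k t) sums (LINT t|lborel. (\<Sum>k. e k t))"
    proof (rule sums_integral[OF inte])
      show "AE t in lborel. summable (\<lambda>k. norm (e k t))"
        using ae by eventually_elim (rule summable_comparison_test', auto simp: le)
      show "summable (\<lambda>k. LINT t|lborel. norm (e k t))"
        by (rule summable_comparison_test'[OF summ])
           (auto intro!: Bochner_Integration.integral_mono integrable_norm inte int le)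
    qed
    moreover have "(\<Sum>k. e k t) = indicator {0..\<theta>} t *\<^sub>R \<psi> t" for t
      by (auto simp: e_def \<psi>_def indicator_def)
    moreover have "(LINT t|lborel. e k t) = (\<Sum>n\<in>{N k..<N (Suc k)}. c (Suc n) * cis \<theta> ^ Suc n - c (Suc n))" for k
    proof -
      have "e k t = (\<Sum>n\<in>{N k..<N (Suc k)}. a n * (indicator {0..\<theta>} t *\<^sub>R (\<i> * cis t * cis t ^ n)))" for t
        using \<theta> by (auto simp: e_def d_def D_def indicator_def sum_distrib_left mult_ac)
      then have "(LINT t|lborel. e k t) = (\<Sum>n\<in>{N k..<N (Suc k)}. LINT t|lborel. a n * (indicator {0..\<theta>} t *\<^sub>R (\<i> * cis t * cis t ^ n)))"
        by (simp only:) (intro Bochner_Integration.integral_sum integrable_mult_right borel_integrable_compact continuous_intros; simp)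
      also have "\<dots> = (\<Sum>n\<in>{N k..<N (Suc k)}. a n * ((cis \<theta> ^ Suc n - 1) / of_nat (Suc n)))"
        using cis_monomial_integral[OF \<theta>(1)] by (intro sum.cong refl) (simp only: integral_mult_right_zero)
      also have "\<dots> = (\<Sum>n\<in>{N k..<N (Suc k)}. c (Suc n) * cis \<theta> ^ Suc n - c (Suc n))"
        by (intro sum.cong refl) (simp add: c(2) diff_divide_distrib right_diff_distrib del: of_nat_Suc power_Suc)
      finally show ?thesis .
    qed
    ultimately have "(\<lambda>K. \<Sum>k<K. \<Sum>n\<in>{N k..<N (Suc k)}. c (Suc n) * cis \<theta> ^ Suc n - c (Suc n)) \<longlonglongrightarrow> (LINT t|lborel. indicator {0..\<theta>} t *\<^sub>R \<psi> t)"
      unfolding sums_def by simp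
    moreover have "N k \<le> N (Suc k)" for k using N(2) by (simp add: strict_mono_less_eq)
    ultimately have 1: "(\<lambda>K. \<Sum>n<N K. c (Suc n) * cis \<theta> ^ Suc n - c (Suc n)) \<longlonglongrightarrow> (LINT t|lborel. indicator {0..\<theta>} t *\<^sub>R \<psi> t)"
      by (subst (asm) sum_blocks[where N=N, OF N(1)]) auto
    have "(\<lambda>n. c n * cis \<theta> ^ n - c n) sums ((\<Sum>n. c n * cis \<theta> ^ n) - (\<Sum>n. c n))"
      using circle_series_bound(1)[OF c(1), of "cis \<theta>"] summable_norm_cancel[OF c(1)]
      by (intro sums_diff summable_sums) auto
    \<comment> \<open>The term of index 0 is \<open>c 0 - c 0\<close>, so the shift leaves the sum
      unchanged.\<close>
    then have "(\<lambda>n. c (Suc n) * cis \<theta> ^ Suc n - c (Suc n)) sums ((\<Sum>n. c n * cis \<theta> ^ n) - (\<Sum>n. c n))"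
      using sums_Suc_iff[of "\<lambda>n. c n * cis \<theta> ^ n - c n" "(\<Sum>n. c n * cis \<theta> ^ n) - (\<Sum>n. c n)"]
      by (simp del: power_Suc)
    then have "(\<lambda>K. \<Sum>n<N K. c (Suc n) * cis \<theta> ^ Suc n - c (Suc n)) \<longlonglongrightarrow> ((\<Sum>n. c n * cis \<theta> ^ n) - (\<Sum>n. c n))"
      unfolding sums_def using LIMSEQ_subseq_LIMSEQ[OF _ N(2)] by (fastforce simp: o_def)
    from LIMSEQ_unique[OF 1 this]
    show "(LINT t|lborel. indicator {0..\<theta>} t *\<^sub>R \<psi> t) = (\<Sum>n. c n * cis \<theta> ^ n) - (\<Sum>n. c n)" .
  qed
qed

section \<open>Lebesgue differentiation, carried from the angle to the circle\<close>

lemma AE_lborel_notin_negligible: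
  fixes N :: "real set"
  assumes "negligible N" shows "AE x in lborel. x \<notin> N"
proof -
  have "AE x in lebesgue. x \<notin> N"
    using assms by (intro AE_not_in) (simp add: negligible_iff_null_sets)
  then show ?thesis by (simp add: AE_completion_iff)
qed

text \<open>Differentiation along right-hand intervals is applied to \<open>\<psi>\<close> and to
  its reflection; the latter yields the left-hand intervals, outside the reflected exceptional
  set.\<close>

lemma Lebesgue_differentiation_real:
  fixes \<psi> :: "real \<Rightarrow> complex"
  assumes "integrable lborel \<psi>"
  shows "AE x in lborel. \<forall>e>0. \<exists>d>0. \<forall>h. 0 < h \<and> h < d \<longrightarrow>
     cmod (integral {x..x+h} \<psi> - h *\<^sub>R \<psi> x) \<le> e * h \<and> cmod (integral {x-h..x} \<psi> - h *\<^sub>R \<psi> x) \<le> e * h"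
proof -
  have on: "\<psi> integrable_on cbox a b" for a b
    using integrable_on_lborel[OF assms] integrable_on_subcbox by blast
  have on': "(\<lambda>x. \<psi> (- x)) integrable_on cbox a b" for a b
    using on[of "- b" "- a"] Henstock_Kurzweil_Integration.integrable_reflect_real[where f=\<psi> and a="- b" and b="- a"] by simp
  have scale: "cmod (I - h *\<^sub>R p) \<le> e * h" if "0 < h" "cmod (I /\<^sub>R h - p) < e" for I p :: complex and h e
  proof -
    have "I - h *\<^sub>R p = h *\<^sub>R (I /\<^sub>R h - p)" using that(1) by (simp add: scaleR_right_diff_distrib)
    then have "cmod (I - h *\<^sub>R p) = h * cmod (I /\<^sub>R h - p)" using that(1) by simp
    then show ?thesis using that by (simp add: mult.commute mult_left_mono)
  qed
  obtain N1 where N1: "negligible N1"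
    "\<And>x e. x \<notin> N1 \<Longrightarrow> 0 < e \<Longrightarrow> \<exists>d>0. \<forall>h. 0 < h \<and> h < d \<longrightarrow> norm (integral (cbox x (x + h *\<^sub>R One)) \<psi> /\<^sub>R h ^ DIM(real) - \<psi> x) < e"
    using integrable_ccontinuous_explicit[of \<psi>] on by blast
  obtain N2 where N2: "negligible N2"
    "\<And>x e. x \<notin> N2 \<Longrightarrow> 0 < e \<Longrightarrow> \<exists>d>0. \<forall>h. 0 < h \<and> h < d \<longrightarrow> norm (integral (cbox x (x + h *\<^sub>R One)) (\<lambda>x. \<psi> (- x)) /\<^sub>R h ^ DIM(real) - \<psi> (- x)) < e"
    using integrable_ccontinuous_explicit[of "\<lambda>x. \<psi> (- x)"] on' by blast
  have "negligible (uminus ` N2)" 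
    by (intro negligible_differentiable_image_negligible N2) (auto intro!: differentiable_on_minus differentiable_on_ident)
  from AE_lborel_notin_negligible[OF N1(1)] AE_lborel_notin_negligible[OF this] show ?thesis
  proof eventually_elim
    case (elim x)
    show ?case
    proof (intro allI impI)
      fix e :: real assume "e > 0"
      have "- x \<notin> N2" using elim(2) by (metis image_eqI minus_minus)
      obtain d1 where d1: "d1 > 0" "\<And>h. 0 < h \<Longrightarrow> h < d1 \<Longrightarrow> cmod (integral {x..x+h} \<psi> /\<^sub>R h - \<psi> x) < e"
        using N1(2)[OF elim(1) \<open>e > 0\<close>] by auto
      obtain d2 where d2: "d2 > 0" "\<And>h. 0 < h \<Longrightarrow> h < d2 \<Longrightarrow> cmod (integral {-x..-x+h} (\<lambda>x. \<psi> (- x)) /\<^sub>R h - \<psi> x) < e"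
        using N2(2)[OF \<open>- x \<notin> N2\<close> \<open>e > 0\<close>] by auto
      have refl: "integral {-x..-x+h} (\<lambda>x. \<psi> (- x)) = integral {x-h..x} \<psi>" for h
        using Henstock_Kurzweil_Integration.integral_reflect_real[where f=\<psi> and a="x - h" and b=x] by (simp add: add.commute)
      show "\<exists>d>0. \<forall>h. 0 < h \<and> h < d \<longrightarrow>
          cmod (integral {x..x+h} \<psi> - h *\<^sub>R \<psi> x) \<le> e * h \<and> cmod (integral {x-h..x} \<psi> - h *\<^sub>R \<psi> x) \<le> e * h"
        using d1 d2 scale unfolding refl
        by (intro exI[of _ "min d1 d2"]) auto
    qed
  qed
qed

text \<open>A product is at most the sum of the squares of its factors, and both squares are
  summable here. Thus the primitive of an H2 function converges absolutely up to the circle.\<close>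

lemma primitive_coeff_summable:
  fixes a c :: "nat \<Rightarrow> complex"
  assumes "summable (\<lambda>n. (cmod (a n))\<^sup>2)" "\<And>n. c (Suc n) = a n / of_nat (Suc n)"
  shows "summable (\<lambda>n. cmod (c n))"
proof (subst summable_Suc_iff[symmetric], rule summable_comparison_test')
  have "summable (\<lambda>n. 1 / real (Suc n) ^ 2)"
    using inverse_power_summable[of 2, where 'a=real] by (subst summable_Suc_iff) (simp add: inverse_eq_divide)
  then show "summable (\<lambda>n. (cmod (a n))\<^sup>2 + 1 / real (Suc n) ^ 2)"
    by (intro summable_add assms)
  fix n
  have "cmod (c (Suc n)) = cmod (a n) * (1 / real (Suc n))"
    by (simp add: assms(2) norm_divide del: of_nat_Suc)
  also have "\<dots> \<le> (cmod (a n))\<^sup>2 + (1 / real (Suc n))\<^sup>2"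
  proof -
    have "0 \<le> cmod (a n) * (1 / real (Suc n))" by simp
    then show ?thesis
      using sum_squares_bound[of "cmod (a n)" "1 / real (Suc n)"] unfolding mult.assoc by linarith
  qed
  finally show "norm (cmod (c (Suc n))) \<le> (cmod (a n))\<^sup>2 + 1 / real (Suc n) ^ 2"
    by (simp add: power_divide del: of_nat_Suc)
qed

lemma Arg2pi_cis_unit: "\<zeta> \<in> unit_circle \<Longrightarrow> cis (Arg2pi \<zeta>) = \<zeta>"
  using Arg2pi_eq[of \<zeta>] by (simp add: cis_conv_exp)

lemma Arg2pi_cis: "0 \<le> t \<Longrightarrow> t < 2 * pi \<Longrightarrow> Arg2pi (cis t) = t"
  using Arg2pi_unique[of 1 t "cis t"] by (simp add: cis_conv_exp)

text \<open>Change of variable from the angle to the boundary point. Since \<open>cis\<close> has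
  derivative \<open>\<i> * cis \<theta>\<close>, the slope becomes
  \<open>p / (\<i> * cis \<theta>)\<close>; continuity of \<open>Arg2pi\<close> keeps the angles
  close when the points are close.\<close>

lemma circle_expansion:
  fixes G :: "complex \<Rightarrow> complex"
  assumes \<theta>: "0 < \<theta>" "\<theta> < 2 * pi"
    and diff: "\<And>e. 0 < e \<Longrightarrow> \<exists>d>0. \<forall>y. 0 \<le> y \<and> y < 2 * pi \<and> \<bar>y - \<theta>\<bar> < d \<longrightarrow>
        cmod (G (cis y) - G (cis \<theta>) - (y - \<theta>) *\<^sub>R p) \<le> e * \<bar>y - \<theta>\<bar>"
    and e: "0 < e"
  shows "\<exists>\<delta>>0. \<forall>\<zeta>\<in>unit_circle. cmod (\<zeta> - cis \<theta>) < \<delta> \<longrightarrow>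
      cmod (G \<zeta> - G (cis \<theta>) - p / (\<i> * cis \<theta>) * (\<zeta> - cis \<theta>)) \<le> e * cmod (\<zeta> - cis \<theta>)"
proof -
  define A where "A = p / (\<i> * cis \<theta>)"
  have pA: "p = A * (\<i> * cis \<theta>)" by (simp add: A_def)
  \<comment> \<open>The two errors add up to
    \<open>(1 + cmod A) * e1 * \<bar>y - \<theta>\<bar>\<close>, and the angle is at most twice the
    chord.\<close>
  define e1 where "e1 = e / (2 * (1 + cmod A))"
  have e1: "e1 > 0" using e by (simp add: e1_def add_pos_nonneg)
  obtain d1 where d1: "d1 > 0" "\<And>y. 0 \<le> y \<Longrightarrow> y < 2 * pi \<Longrightarrow> \<bar>y - \<theta>\<bar> < d1 \<Longrightarrow>
        cmod (G (cis y) - G (cis \<theta>) - (y - \<theta>) *\<^sub>R p) \<le> e1 * \<bar>y - \<theta>\<bar>"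
    using diff[OF e1] by blast
  have "(cis has_vector_derivative \<i> * cis \<theta>) (at \<theta>)"
    unfolding cis_conv_exp
    by (rule has_vector_derivative_real_field[where f="\<lambda>z. exp (\<i> * z)"]) (auto intro!: derivative_eq_intros)
  then have alt: "\<exists>d>0. \<forall>y. \<bar>y - \<theta>\<bar> < d \<longrightarrow> cmod (cis y - cis \<theta> - (y - \<theta>) *\<^sub>R (\<i> * cis \<theta>)) \<le> e * \<bar>y - \<theta>\<bar>"
    if "e > 0" for e
    using that unfolding has_vector_derivative_def has_derivative_at_alt by simp
  obtain d2 where d2: "d2 > 0" "\<And>y. \<bar>y - \<theta>\<bar> < d2 \<Longrightarrow> cmod (cis y - cis \<theta> - (y - \<theta>) *\<^sub>R (\<i> * cis \<theta>)) \<le> e1 * \<bar>y - \<theta>\<bar>"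
    using alt[OF e1] by blast
  \<comment> \<open>Accuracy 1/2 in the expansion of \<open>cis\<close> suffices to bound the angle
    by twice the chord.\<close>
  obtain d3 where d3: "d3 > 0" "\<And>y. \<bar>y - \<theta>\<bar> < d3 \<Longrightarrow> cmod (cis y - cis \<theta> - (y - \<theta>) *\<^sub>R (\<i> * cis \<theta>)) \<le> 1/2 * \<bar>y - \<theta>\<bar>"
    using alt[of "1/2"] by auto
  define d where "d = min d1 (min d2 d3)"
  have "d > 0" using d1 d2 d3 by (simp add: d_def)
  \<comment> \<open>The bounds on \<open>\<theta>\<close> keep the point off the positive real axis,
    where \<open>Arg2pi\<close> jumps.\<close>
  have "cis \<theta> \<notin> \<real>\<^sub>\<ge>\<^sub>0"
  proof
    assume "cis \<theta> \<in> \<real>\<^sub>\<ge>\<^sub>0"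
    then have "Arg2pi (cis \<theta>) = 0" by (auto elim!: nonneg_Reals_cases simp: Arg2pi_of_real)
    then show False using \<theta> by (simp add: Arg2pi_cis)
  qed
  then have "isCont Arg2pi (cis \<theta>)" by (rule continuous_at_Arg2pi)
  then obtain \<delta> where \<delta>: "\<delta> > 0" "\<And>\<zeta>. dist \<zeta> (cis \<theta>) < \<delta> \<Longrightarrow> dist (Arg2pi \<zeta>) (Arg2pi (cis \<theta>)) < d"
    using \<open>d > 0\<close> unfolding continuous_at_eps_delta by metis
  show ?thesis
  proof (intro exI[of _ \<delta>] conjI ballI impI \<delta>(1))
    fix \<zeta> assume \<zeta>: "\<zeta> \<in> unit_circle" "cmod (\<zeta> - cis \<theta>) < \<delta>"
    define y where "y = Arg2pi \<zeta>"
    have y: "0 \<le> y" "y < 2 * pi" "cis y = \<zeta>"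
      using Arg2pi_cis_unit[OF \<zeta>(1)] Arg2pi_ge_0 Arg2pi_lt_2pi by (auto simp: y_def)
    have yd: "\<bar>y - \<theta>\<bar> < d"
      using \<delta>(2)[of \<zeta>] \<zeta> \<theta> Arg2pi_cis[of \<theta>] by (simp add: dist_norm y_def)
    have t: "\<bar>y - \<theta>\<bar> \<le> 2 * cmod (\<zeta> - cis \<theta>)"
    proof -
      have "cmod ((y - \<theta>) *\<^sub>R (\<i> * cis \<theta>)) = \<bar>y - \<theta>\<bar>" by (simp add: norm_mult)
      moreover have "\<bar>y - \<theta>\<bar> < d3" using yd by (simp add: d_def)
      moreover note d3(2)[OF this]
      moreover have "a \<le> 2 * c" if "n = a" "a < d3" "m \<le> 1/2 * a" "n \<le> c + k" "k = m" for a c n m k :: real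
        using that by linarith
      ultimately show ?thesis
        using norm_triangle_sub[of "(y - \<theta>) *\<^sub>R (\<i> * cis \<theta>)" "\<zeta> - cis \<theta>"]
          norm_minus_commute[of "(y - \<theta>) *\<^sub>R (\<i> * cis \<theta>)" "\<zeta> - cis \<theta>"]
        unfolding y(3) by blast
    qed
    have "G \<zeta> - G (cis \<theta>) - A * (\<zeta> - cis \<theta>) = (G (cis y) - G (cis \<theta>) - (y - \<theta>) *\<^sub>R p) - A * (cis y - cis \<theta> - (y - \<theta>) *\<^sub>R (\<i> * cis \<theta>))"
      by (simp add: y(3) pA algebra_simps scaleR_conv_of_real)
    also have "cmod \<dots> \<le> cmod (G (cis y) - G (cis \<theta>) - (y - \<theta>) *\<^sub>R p) + cmod A * cmod (cis y - cis \<theta> - (y - \<theta>) *\<^sub>R (\<i> * cis \<theta>))"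
      unfolding norm_mult[symmetric] by (rule norm_triangle_ineq4)
    also have "\<dots> \<le> e1 * \<bar>y - \<theta>\<bar> + cmod A * (e1 * \<bar>y - \<theta>\<bar>)"
      using yd y by (intro add_mono mult_left_mono d1 d2) (auto simp: d_def)
    also have "\<dots> = (1 + cmod A) * e1 * \<bar>y - \<theta>\<bar>" by (simp add: algebra_simps)
    also have "(1 + cmod A) * e1 = e / 2"
      using add_pos_nonneg[of 1 "cmod A"] by (simp add: e1_def field_simps)
    also have "e / 2 * \<bar>y - \<theta>\<bar> \<le> e / 2 * (2 * cmod (\<zeta> - cis \<theta>))"
      using t e by (intro mult_left_mono) auto
    finally show "cmod (G \<zeta> - G (cis \<theta>) - p / (\<i> * cis \<theta>) * (\<zeta> - cis \<theta>)) \<le> e * cmod (\<zeta> - cis \<theta>)"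
      by (simp add: A_def)
  qed
qed

theorem hardy2_radial_limit:
  assumes "f \<in> hardy 2"
  shows "AE \<zeta> in mT. has_radial_limit f \<zeta> (bv f \<zeta>)"
proof -
  have hol: "f holomorphic_on unit_disc" using assms by (rule hardy2_hol)
  \<comment> \<open>Taylor coefficients of the primitive of \<open>f\<close> that vanishes at
    0.\<close>
  define c where "c = (\<lambda>n. case n of 0 \<Rightarrow> 0 | Suc m \<Rightarrow> tcoeff f m / of_nat (Suc m))"
  have c: "c (Suc n) = tcoeff f n / of_nat (Suc n)" for n by (simp add: c_def del: of_nat_Suc)
  have cs: "summable (\<lambda>n. cmod (c n))"
    by (rule primitive_coeff_summable[OF hardy2D(1)[OF assms] c])
  define G where "G \<zeta> = (\<Sum>n. c n * \<zeta> ^ n)" for \<zeta>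
  obtain \<psi> where \<psi>: "integrable lborel \<psi>"
    "\<And>\<theta>. 0 \<le> \<theta> \<Longrightarrow> \<theta> \<le> 2 * pi \<Longrightarrow> (LINT t|lborel. indicator {0..\<theta>} t *\<^sub>R \<psi> t) = G (cis \<theta>) - (\<Sum>n. c n)"
    unfolding G_def using primitive_boundary_integral[OF hardy2D(1)[OF assms] cs c] by blast
  have on: "\<psi> integrable_on {a..b}" for a b
    using integrable_on_lborel[OF \<psi>(1)] integrable_on_subcbox[of \<psi> UNIV a b] by (simp add: cbox_interval)
  have si: "(LINT t|lborel. indicator {0..\<theta>} t *\<^sub>R \<psi> t) = integral {0..\<theta>} \<psi>" for \<theta>
    using set_borel_integral_eq_integral(2)[of "{0..\<theta>}" \<psi>] integrable_mult_indicator[OF _ \<psi>(1), of "{0..\<theta>}"]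
    by (simp add: set_lebesgue_integral_def set_integrable_def)
  have incr: "G (cis b) - G (cis a) = integral {a..b} \<psi>" if "0 \<le> a" "a \<le> b" "b \<le> 2 * pi" for a b
  proof -
    have "integral {0..a} \<psi> + integral {a..b} \<psi> = integral {0..b} \<psi>"
      using that on by (intro Henstock_Kurzweil_Integration.integral_combine) auto
    then show ?thesis using that \<psi>(2)[of a] \<psi>(2)[of b] unfolding si by (simp add: algebra_simps)
  qed
  have "AE t in lborel. t \<in> {0<..<2 * pi} \<longrightarrow> (\<exists>l. has_radial_limit f (cis t) l)"
    using Lebesgue_differentiation_real[OF \<psi>(1)]
  proof eventually_elim
    case (elim \<theta>)
    show ?case
    proof
      assume \<theta>: "\<theta> \<in> {0<..<2 * pi}"
      have diff: "\<exists>d>0. \<forall>y. 0 \<le> y \<and> y < 2 * pi \<and> \<bar>y - \<theta>\<bar> < d \<longrightarrow>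
        cmod (G (cis y) - G (cis \<theta>) - (y - \<theta>) *\<^sub>R \<psi> \<theta>) \<le> e * \<bar>y - \<theta>\<bar>" if "0 < e" for e
      proof -
        from elim[THEN spec, THEN mp, OF that] obtain d where d: "d > 0" "\<forall>h. 0 < h \<and> h < d \<longrightarrow>
           cmod (integral {\<theta>..\<theta>+h} \<psi> - h *\<^sub>R \<psi> \<theta>) \<le> e * h \<and> cmod (integral {\<theta>-h..\<theta>} \<psi> - h *\<^sub>R \<psi> \<theta>) \<le> e * h"
          by iprover
        have "cmod (G (cis y) - G (cis \<theta>) - (y - \<theta>) *\<^sub>R \<psi> \<theta>) \<le> e * \<bar>y - \<theta>\<bar>"
          if y: "0 \<le> y" "y < 2 * pi" "\<bar>y - \<theta>\<bar> < d" for y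
        proof (cases rule: linorder_cases[of y \<theta>])
          case less
          have eq: "G (cis y) - G (cis \<theta>) - (y - \<theta>) *\<^sub>R \<psi> \<theta> = - (integral {y..\<theta>} \<psi> - (\<theta> - y) *\<^sub>R \<psi> \<theta>)"
            using incr[of y \<theta>] y less \<theta> by (simp add: algebra_simps)
          have "cmod (integral {\<theta> - (\<theta> - y)..\<theta>} \<psi> - (\<theta> - y) *\<^sub>R \<psi> \<theta>) \<le> e * (\<theta> - y)"
            using d(2)[THEN spec, of "\<theta> - y"] y less by auto
          then show ?thesis using less unfolding eq norm_minus_cancel by simp
        next
          case equal then show ?thesis by simp
        next
          case greater
          have "G (cis y) - G (cis \<theta>) = integral {\<theta>..\<theta> + (y - \<theta>)} \<psi>"
            using incr[of \<theta> y] y greater \<theta> by simp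
          then show ?thesis using d(2)[THEN spec, of "y - \<theta>"] y greater by simp
        qed
        then show ?thesis using d(1) by blast
      qed
      have "has_radial_limit f (cis \<theta>) (\<psi> \<theta> / (\<i> * cis \<theta>))"
      proof (rule radial_limit_of_primitive_derivative[OF hol cs c])
        fix \<epsilon> :: real assume "0 < \<epsilon>"
        from circle_expansion[where G=G, OF _ _ diff this] \<theta>
        show "\<exists>\<delta>>0. \<forall>\<zeta>\<in>unit_circle. cmod (\<zeta> - cis \<theta>) < \<delta> \<longrightarrow>
            cmod ((\<Sum>n. c n * \<zeta> ^ n) - (\<Sum>n. c n * cis \<theta> ^ n) - \<psi> \<theta> / (\<i> * cis \<theta>) * (\<zeta> - cis \<theta>)) \<le> \<epsilon> * cmod (\<zeta> - cis \<theta>)"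
          unfolding G_def by simp
      qed simp
      then show "\<exists>l. has_radial_limit f (cis \<theta>) l" by blast
    qed
  qed
  then have "AE \<zeta> in mT. \<exists>l. has_radial_limit f \<zeta> l"
    by (rule AE_circle_cis[OF radial_limit_sets[OF hol]])
  then show ?thesis by eventually_elim (use bv_eqI in blast)
qed

section \<open>Boundary values of \<open>H\<^sup>2\<close> functions\<close>

lemma has_radial_limit_diff:
  "has_radial_limit f \<zeta> a \<Longrightarrow> has_radial_limit g \<zeta> b \<Longrightarrow> has_radial_limit (\<lambda>z. f z - g z) \<zeta> (a - b)"
  unfolding has_radial_limit_def by (rule tendsto_diff)

lemma has_radial_limit_mult:
  "has_radial_limit f \<zeta> a \<Longrightarrow> has_radial_limit g \<zeta> b \<Longrightarrow> has_radial_limit (\<lambda>z. f z * g z) \<zeta> (a * b)"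
  unfolding has_radial_limit_def by (rule tendsto_mult)

lemma has_radial_limit_divide:
  "has_radial_limit f \<zeta> a \<Longrightarrow> has_radial_limit g \<zeta> b \<Longrightarrow> b \<noteq> 0 \<Longrightarrow> has_radial_limit (\<lambda>z. f z / g z) \<zeta> (a / b)"
  unfolding has_radial_limit_def by (rule tendsto_divide)

lemma radial_path: "((\<lambda>r. of_real r * \<zeta>) \<longlongrightarrow> \<zeta>) (at_left (1::real))" for \<zeta> :: complex
proof -
  have "((\<lambda>r. of_real r * \<zeta>) \<longlongrightarrow> of_real 1 * \<zeta>) (at_left (1::real))"
    by (intro tendsto_intros)
  then show ?thesis by simp
qed

lemma has_radial_limit_isCont:
  "isCont g \<zeta> \<Longrightarrow> has_radial_limit g \<zeta> (g \<zeta>)"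
  unfolding has_radial_limit_def by (rule isCont_tendsto_compose[OF _ radial_path])

lemma has_radial_limit_cong:
  assumes "has_radial_limit f \<zeta> l" "\<zeta> \<in> unit_circle" "\<And>z. cmod z < 1 \<Longrightarrow> f z = g z"
  shows "has_radial_limit g \<zeta> l"
  using assms(1) unfolding has_radial_limit_def
proof (rule Lim_transform_eventually)
  show "\<forall>\<^sub>F r in at_left 1. f (of_real r * \<zeta>) = g (of_real r * \<zeta>)"
    using radial_eventually[of 0, OF zero_less_one]
    by eventually_elim (use assms(2) in \<open>auto intro!: assms(3) simp: norm_mult\<close>)
qed

lemma bv_cong:
  assumes "\<zeta> \<in> unit_circle" "\<And>z. cmod z < 1 \<Longrightarrow> f z = g z"
  shows "bv f \<zeta> = bv g \<zeta>"
proof -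
  have "has_radial_limit f \<zeta> l \<longleftrightarrow> has_radial_limit g \<zeta> l" for l
    using has_radial_limit_cong[of f \<zeta> l g] has_radial_limit_cong[of g \<zeta> l f] assms by metis
  then show ?thesis unfolding bv_def Topological_Spaces.Lim_def has_radial_limit_def by simp
qed

lemma has_radial_limit_norm_le:
  assumes "has_radial_limit f \<zeta> l" "\<zeta> \<in> unit_circle" "\<And>z. cmod z < 1 \<Longrightarrow> cmod (f z) \<le> K"
  shows "cmod l \<le> K"
proof (rule tendsto_upperbound)
  show "((\<lambda>r. cmod (f (of_real r * \<zeta>))) \<longlongrightarrow> cmod l) (at_left 1)"
    using assms(1) unfolding has_radial_limit_def by (rule tendsto_norm)
  show "\<forall>\<^sub>F r in at_left 1. cmod (f (of_real r * \<zeta>)) \<le> K"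
    using radial_eventually[of 0, OF zero_less_one]
    by eventually_elim (use assms(2) in \<open>auto intro!: assms(3) simp: norm_mult\<close>)
qed auto

text \<open>Fatou's lemma along the fixed sequence of radii, whose members eventually exceed
  \<open>s\<close>.\<close>

lemma radial_Fatou:
  assumes hol: "f holomorphic_on unit_disc" and lim: "AE \<zeta> in mT. has_radial_limit f \<zeta> (bv f \<zeta>)"
    and B: "s < 1" "\<And>r. s \<le> r \<Longrightarrow> 0 \<le> r \<Longrightarrow> r < 1 \<Longrightarrow> sqn (\<lambda>\<zeta>. f (of_real r * \<zeta>)) \<le> B"
  shows "sq_integrable (bv f)" "sqn (bv f) \<le> B"
proof -
  let ?r = "\<lambda>j. 1 - 1 / (real j + 3)"
  have rj: "0 \<le> ?r j" "?r j < 1" for j by (auto simp: field_simps)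
  have [measurable]: "(\<lambda>\<zeta>. f (of_real (?r j) * \<zeta>)) \<in> borel_measurable mT" for j
    using dilate_measurable[OF hol rj[of j]] .
  have [measurable]: "bv f \<in> borel_measurable mT" by (rule bv_measurable[OF hol])
  have B0: "B \<ge> 0"
    using order_trans[OF sqn_nonneg B(2)[of "max s 0"]] B(1) by simp
  have "eventually (\<lambda>r. s < r) (at_left (1::real))" using radial_eventually[OF B(1)] by eventually_elim auto
  then have ev: "eventually (\<lambda>j. s < ?r j) sequentially"
    using radial_seq unfolding filterlim_iff by blast
  have "(\<integral>\<^sup>+\<zeta>. ennreal ((cmod (bv f \<zeta>))\<^sup>2) \<partial>mT) = (\<integral>\<^sup>+\<zeta>. liminf (\<lambda>j. ennreal ((cmod (f (of_real (?r j) * \<zeta>)))\<^sup>2)) \<partial>mT)"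
  proof (rule nn_integral_cong_AE)
    show "AE \<zeta> in mT. ennreal ((cmod (bv f \<zeta>))\<^sup>2) = liminf (\<lambda>j. ennreal ((cmod (f (of_real (?r j) * \<zeta>)))\<^sup>2))"
      using lim
    proof eventually_elim
      case (elim \<zeta>)
      then have "(\<lambda>j. f (of_real (?r j) * \<zeta>)) \<longlonglongrightarrow> bv f \<zeta>"
        unfolding has_radial_limit_def by (rule filterlim_compose[OF _ radial_seq])
      then have "(\<lambda>j. ennreal ((cmod (f (of_real (?r j) * \<zeta>)))\<^sup>2)) \<longlonglongrightarrow> ennreal ((cmod (bv f \<zeta>))\<^sup>2)"
        by (intro tendsto_ennrealI tendsto_power tendsto_norm)
      then show ?case by (rule lim_imp_Liminf[OF sequentially_bot, symmetric])
    qed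
  qed
  also have "\<dots> \<le> liminf (\<lambda>j. \<integral>\<^sup>+\<zeta>. ennreal ((cmod (f (of_real (?r j) * \<zeta>)))\<^sup>2) \<partial>mT)"
    by (rule nn_integral_liminf) measurable
  also have "\<dots> = liminf (\<lambda>j. ennreal (sqn (\<lambda>\<zeta>. f (of_real (?r j) * \<zeta>))))"
    by (simp only: sqn_nn[OF sq_integrable_dilate[OF hol rj]])
  also have "\<dots> \<le> ennreal B"
  proof (rule Liminf_le)
    show "\<forall>\<^sub>F j in sequentially. ennreal (sqn (\<lambda>\<zeta>. f (of_real (?r j) * \<zeta>))) \<le> ennreal B"
      using ev by eventually_elim (intro ennreal_leI B(2) rj less_imp_le)
  qed simp
  finally have le: "(\<integral>\<^sup>+\<zeta>. ennreal ((cmod (bv f \<zeta>))\<^sup>2) \<partial>mT) \<le> ennreal B" .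
  then show sq: "sq_integrable (bv f)"
    by (subst sq_integrable_nn) (auto simp: less_top[symmetric] top_unique)
  show "sqn (bv f) \<le> B" using le B0 by (simp add: sqn_nn[OF sq])
qed

lemma hardy2_bv:
  assumes "f \<in> hardy 2"
  shows "sq_integrable (bv f)" "sqn (bv f) \<le> hsum f"
  using radial_Fatou[OF hardy2_hol[OF assms] hardy2_radial_limit[OF assms], of 0 "hsum f"] hardy2D(2)[OF assms]
  by auto

text \<open>The remainder is itself in H2 and keeps only the tail of the coefficients, so
  \<open>hardy2_bv\<close> bounds its boundary norm by the tail of a convergent series. This
  identifies the radial limits with the L2 sum of the Taylor series.\<close>

lemma hardy2_partial_sums:
  assumes "f \<in> hardy 2"
  shows "(\<lambda>N. sqn (\<lambda>\<zeta>. bv f \<zeta> - (\<Sum>n<N. tcoeff f n * \<zeta> ^ n))) \<longlonglongrightarrow> 0"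
proof -
  let ?a = "tcoeff f"
  note hol = hardy2_hol[OF assms]
  have le: "sqn (\<lambda>\<zeta>. bv f \<zeta> - (\<Sum>n<N. ?a n * \<zeta> ^ n)) \<le> (\<Sum>n. (cmod (?a (n + N)))\<^sup>2)" for N
  proof -
    define s where "s z = (\<Sum>n<N. ?a n * z ^ n)" for z
    define h where "h z = f z - s z" for z
    have hhol: "h holomorphic_on unit_disc"
      unfolding h_def s_def by (intro holomorphic_intros hol)
    have tc: "tcoeff h n = (if n < N then 0 else ?a n)" for n
    proof (rule tcoeff_unique[OF hhol])
      fix z :: complex assume z: "cmod z < 1"
      have "(\<lambda>n. if n \<in> {..<N} then ?a n * z ^ n else 0) sums s z"
        unfolding s_def by (rule sums_If_finite_set) auto
      then have "(\<lambda>n. ?a n * z ^ n - (if n \<in> {..<N} then ?a n * z ^ n else 0)) sums h z"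
        unfolding h_def by (intro sums_diff tcoeff_sums[OF hol z])
      moreover have "?a n * z ^ n - (if n \<in> {..<N} then ?a n * z ^ n else 0) = (if n < N then 0 else ?a n) * z ^ n" for n
        by auto
      ultimately show "(\<lambda>n. (if n < N then 0 else ?a n) * z ^ n) sums h z" by simp
    qed
    have hs: "summable (\<lambda>n. (cmod (tcoeff h n))\<^sup>2)"
      by (rule summable_comparison_test'[OF hardy2D(1)[OF assms]]) (simp add: tc)
    have hh: "h \<in> hardy 2" by (rule hardy2_summableI[OF hhol hs])
    have "AE \<zeta> in mT. bv h \<zeta> = bv f \<zeta> - s \<zeta>"
      using hardy2_radial_limit[OF assms]
    proof eventually_elim
      case (elim \<zeta>)
      have "isCont s \<zeta>" unfolding s_def by (intro continuous_intros)
      then show ?case unfolding h_def using elim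
        by (intro bv_eqI has_radial_limit_diff has_radial_limit_isCont)
    qed
    then have "sqn (\<lambda>\<zeta>. bv f \<zeta> - s \<zeta>) = sqn (bv h)"
      unfolding s_def
      by (intro sqn_AE_cong bv_measurable hhol borel_measurable_diff hol continuous_imp_measurable_circle continuous_intros)
         (auto elim: eventually_mono)
    also have "\<dots> \<le> hsum h" by (rule hardy2_bv(2)[OF hh])
    also have "\<dots> = (\<Sum>n. (cmod (?a (n + N)))\<^sup>2)"
      unfolding hsum_def using suminf_split_initial_segment[OF hs, of N] by (simp add: tc)
    finally show ?thesis by (simp add: s_def)
  qed
  have "(\<lambda>N. \<Sum>n. (cmod (?a (n + N)))\<^sup>2) \<longlonglongrightarrow> 0"
    by (rule suminf_exist_split2[OF hardy2D(1)[OF assms]])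
  then show ?thesis
    by (rule Lim_null_comparison[OF always_eventually, rotated]) (use le in \<open>simp only: real_norm_def abs_of_nonneg[OF sqn_nonneg] simp_thms\<close>)
qed

lemma hardy2_tail_sq_integrable:
  assumes "f \<in> hardy 2"
  shows "sq_integrable (\<lambda>\<zeta>. bv f \<zeta> - (\<Sum>n<N. a n * \<zeta> ^ n))"
  by (intro sq_integrable_diff hardy2_bv assms sq_integrable_continuous continuous_intros)

lemma hardy2_pairing_limit:
  assumes "f \<in> hardy 2" "sq_integrable F"
  shows "(\<lambda>N. LINT \<zeta>|mT. F \<zeta> * (\<Sum>n<N. tcoeff f n * \<zeta> ^ n)) \<longlonglongrightarrow> (LINT \<zeta>|mT. F \<zeta> * bv f \<zeta>)"
proof -
  let ?s = "\<lambda>N \<zeta>. \<Sum>n<N. tcoeff f n * \<zeta> ^ n"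
  have "(\<lambda>N. sqrt (sqn F * sqn (\<lambda>\<zeta>. bv f \<zeta> - ?s N \<zeta>))) \<longlonglongrightarrow> sqrt (sqn F * 0)"
    by (intro tendsto_intros hardy2_partial_sums assms)
  then have lim: "(\<lambda>N. sqrt (sqn F * sqn (\<lambda>\<zeta>. bv f \<zeta> - ?s N \<zeta>))) \<longlonglongrightarrow> 0" by simp
  have le: "cmod ((LINT \<zeta>|mT. F \<zeta> * bv f \<zeta>) - (LINT \<zeta>|mT. F \<zeta> * ?s N \<zeta>)) \<le> sqrt (sqn F * sqn (\<lambda>\<zeta>. bv f \<zeta> - ?s N \<zeta>))" for N
  proof -
    have "(LINT \<zeta>|mT. F \<zeta> * bv f \<zeta>) - (LINT \<zeta>|mT. F \<zeta> * ?s N \<zeta>) = (LINT \<zeta>|mT. F \<zeta> * bv f \<zeta> - F \<zeta> * ?s N \<zeta>)"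
      by (intro Bochner_Integration.integral_diff[symmetric] integrable_mult_sq assms hardy2_bv sq_integrable_continuous continuous_intros)
    also have "\<dots> = (LINT \<zeta>|mT. F \<zeta> * (bv f \<zeta> - ?s N \<zeta>))" by (simp only: right_diff_distrib)
    finally show ?thesis
      using real_sqrt_le_mono[OF Cauchy_Schwarz_circle[OF assms(2) hardy2_tail_sq_integrable[OF assms(1)]]] by simp
  qed
  have "(\<lambda>N. (LINT \<zeta>|mT. F \<zeta> * bv f \<zeta>) - (LINT \<zeta>|mT. F \<zeta> * ?s N \<zeta>)) \<longlonglongrightarrow> 0"
    by (rule Lim_null_comparison[OF _ lim]) (auto simp: le)
  from tendsto_diff[OF tendsto_const[of "LINT \<zeta>|mT. F \<zeta> * bv f \<zeta>"] this] show ?thesis by simp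
qed

lemma integral_times_poly:
  assumes "integrable mT F"
  shows "(LINT \<zeta>|mT. F \<zeta> * (\<Sum>n<N. a n * \<zeta> ^ n)) = (\<Sum>n<N. a n * (LINT \<zeta>|mT. F \<zeta> * \<zeta> ^ n))"
proof -
  have "(LINT \<zeta>|mT. F \<zeta> * (\<Sum>n<N. a n * \<zeta> ^ n)) = (LINT \<zeta>|mT. (\<Sum>n<N. a n * (F \<zeta> * \<zeta> ^ n)))"
    by (simp add: sum_distrib_left mult_ac)
  also have "\<dots> = (\<Sum>n<N. a n * (LINT \<zeta>|mT. F \<zeta> * \<zeta> ^ n))"
    by (subst Bochner_Integration.integral_sum)
       (auto intro!: integrable_mult_right integrable_times_continuous assms continuous_intros)
  finally show ?thesis .
qed

lemma hardy2_fcoeff: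
  assumes "f \<in> hardy 2"
  shows "fcoeff (bv f) k = tcoeff f k"
proof -
  have "(\<lambda>N. LINT \<zeta>|mT. cnj \<zeta> ^ k * (\<Sum>n<N. tcoeff f n * \<zeta> ^ n)) \<longlonglongrightarrow> (LINT \<zeta>|mT. cnj \<zeta> ^ k * bv f \<zeta>)"
    by (intro hardy2_pairing_limit assms sq_integrable_continuous continuous_intros)
  moreover have "(LINT \<zeta>|mT. cnj \<zeta> ^ k * (\<Sum>n<N. tcoeff f n * \<zeta> ^ n)) = (if k < N then tcoeff f k else 0)" for N
    using fcoeff_sum[of "tcoeff f" N k] by (simp add: fcoeff_def mult.commute)
  ultimately have "(\<lambda>N. if k < N then tcoeff f k else 0) \<longlonglongrightarrow> fcoeff (bv f) k"
    by (simp add: fcoeff_def mult.commute)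
  moreover have "(\<lambda>N. if k < N then tcoeff f k else 0) \<longlonglongrightarrow> tcoeff f k"
  proof (rule tendsto_eventually)
    show "\<forall>\<^sub>F N in sequentially. (if k < N then tcoeff f k else 0) = tcoeff f k"
      using eventually_gt_at_top[of k] by eventually_elim simp
  qed
  ultimately show ?thesis by (rule LIMSEQ_unique)
qed

lemma hardy2_negative_fcoeff:
  assumes "f \<in> hardy 2" "k > 0"
  shows "(LINT \<zeta>|mT. bv f \<zeta> * \<zeta> ^ k) = 0"
proof -
  have "(\<lambda>N. LINT \<zeta>|mT. \<zeta> ^ k * (\<Sum>n<N. tcoeff f n * \<zeta> ^ n)) \<longlonglongrightarrow> (LINT \<zeta>|mT. \<zeta> ^ k * bv f \<zeta>)"
    by (intro hardy2_pairing_limit assms sq_integrable_continuous continuous_intros)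
  moreover have "(LINT \<zeta>|mT. \<zeta> ^ k * (\<Sum>n<N. tcoeff f n * \<zeta> ^ n)) = 0" for N
    using assms(2)
    by (subst integral_times_poly)
       (auto intro!: integrable_circle_continuous continuous_intros simp: power_add[symmetric] integral_circle_power)
  ultimately have "(\<lambda>N. 0) \<longlonglongrightarrow> (LINT \<zeta>|mT. \<zeta> ^ k * bv f \<zeta>)" by simp
  from LIMSEQ_unique[OF tendsto_const this] show ?thesis by (simp add: mult.commute)
qed

text \<open>Fatou's lemma gives one inequality, Bessel's the other once the Fourier coefficients are
  known to be the Taylor coefficients.\<close>

lemma hardy2_hsum:
  assumes "f \<in> hardy 2"
  shows "sqn (bv f) = hsum f"
  using hardy2_bv[OF assms] Bessel(2)[OF hardy2_bv(1)[OF assms]] hardy2_fcoeff[OF assms]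
  by (simp add: hsum_def)

lemma hardy2_norm_sqn: "hardy2_norm f = sqrt (sqn (bv f))"
  by (simp add: hardy2_norm_def sqn_def)

section \<open>Reproducing formulas of Cauchy and Poisson\<close>

lemma riesz_proj_bv:
  assumes "f \<in> hardy 2" "cmod z < 1"
  shows "riesz_proj (bv f) z = f z"
  using riesz_proj_sums[OF sq_integrable_imp_integrable[OF hardy2_bv(1)[OF assms(1)]] assms(2)]
    tcoeff_sums[OF hardy2_hol[OF assms(1)] assms(2)] hardy2_fcoeff[OF assms(1)]
  by (simp add: sums_unique2)

lemma riesz_proj_contraction:
  assumes "sq_integrable F"
  shows "sqn (bv (riesz_proj F)) \<le> sqn F"
  using hardy2_hsum[OF riesz_proj_hardy2(1)[OF assms]] riesz_proj_hardy2(2)[OF assms] by simp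

lemma hardy2_orthogonal:
  assumes "sq_integrable F" "\<And>n. fcoeff F n = 0" "g \<in> hardy 2"
  shows "(LINT \<zeta>|mT. F \<zeta> * cnj (bv g \<zeta>)) = 0"
proof -
  have "(\<lambda>N. LINT \<zeta>|mT. cnj (F \<zeta>) * (\<Sum>n<N. tcoeff g n * \<zeta> ^ n)) \<longlonglongrightarrow> (LINT \<zeta>|mT. cnj (F \<zeta>) * bv g \<zeta>)"
    using assms by (intro hardy2_pairing_limit) auto
  moreover have "(LINT \<zeta>|mT. cnj (F \<zeta>) * (\<Sum>n<N. tcoeff g n * \<zeta> ^ n)) = 0" for N
  proof -
    have "(LINT \<zeta>|mT. cnj (F \<zeta>) * \<zeta> ^ n) = cnj (fcoeff F n)" for n
      unfolding fcoeff_def by (subst Bochner_Integration.integral_cnj[symmetric]) simp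
    then show ?thesis
      using assms sq_integrable_imp_integrable[OF sq_integrable_cnj[OF assms(1)]]
      by (subst integral_times_poly) auto
  qed
  ultimately have "(\<lambda>N. 0) \<longlonglongrightarrow> (LINT \<zeta>|mT. cnj (F \<zeta>) * bv g \<zeta>)" by simp
  from LIMSEQ_unique[OF tendsto_const this] have "(LINT \<zeta>|mT. cnj (F \<zeta>) * bv g \<zeta>) = 0" by simp
  moreover have "(LINT \<zeta>|mT. F \<zeta> * cnj (bv g \<zeta>)) = cnj (LINT \<zeta>|mT. cnj (F \<zeta>) * bv g \<zeta>)"
    by (subst Bochner_Integration.integral_cnj[symmetric]) simp
  ultimately show ?thesis by simp
qed

text \<open>In the decomposition of \<open>poisson_kernel_eq\<close> the Cauchy kernel reproduces
  \<open>f\<close>. The conjugate kernel sees only the mean, as the coefficients of negative index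
  vanish, and this cancels against the summand -1.\<close>

lemma hardy2_poisson:
  assumes "f \<in> hardy 2" "cmod w < 1"
  shows "f w = (LINT \<zeta>|mT. bv f \<zeta> * of_real ((1 - (cmod w)\<^sup>2) / (cmod (\<zeta> - w))\<^sup>2))"
proof -
  have i: "integrable mT (bv f)" by (intro sq_integrable_imp_integrable hardy2_bv assms)
  let ?k = "\<lambda>\<zeta>. 1 / (1 - cnj \<zeta> * w)"
  note kc = cauchy_kernel_continuous[OF assms(2)]
  have ck: "(LINT \<zeta>|mT. bv f \<zeta> * cnj (?k \<zeta>)) = (LINT \<zeta>|mT. bv f \<zeta>)"
  proof -
    have "(\<lambda>n. cnj w ^ n * (LINT \<zeta>|mT. bv f \<zeta> * \<zeta> ^ n)) sums (LINT \<zeta>|mT. bv f \<zeta> * (\<Sum>n. cnj w ^ n * \<zeta> ^ n))"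
      using assms by (intro integral_times_series i) (auto intro!: continuous_intros simp: norm_power)
    moreover have "(LINT \<zeta>|mT. bv f \<zeta> * (\<Sum>n. cnj w ^ n * \<zeta> ^ n)) = (LINT \<zeta>|mT. bv f \<zeta> * cnj (?k \<zeta>))"
    proof (intro Bochner_Integration.integral_cong refl)
      fix \<zeta> assume "\<zeta> \<in> space mT"
      then have "(\<lambda>n. (cnj w * \<zeta>) ^ n) sums (1 / (1 - cnj w * \<zeta>))"
        using assms by (intro geometric_sums) (auto simp: norm_mult)
      then show "bv f \<zeta> * (\<Sum>n. cnj w ^ n * \<zeta> ^ n) = bv f \<zeta> * cnj (?k \<zeta>)"
        by (simp add: sums_iff power_mult_distrib mult.commute)
    qed
    moreover have "(\<lambda>n. cnj w ^ n * (LINT \<zeta>|mT. bv f \<zeta> * \<zeta> ^ n)) = (\<lambda>n. if n = 0 then (LINT \<zeta>|mT. bv f \<zeta>) else 0)"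
      using hardy2_negative_fcoeff[OF assms(1)] by auto
    ultimately have "(\<lambda>n. if n = 0 then (LINT \<zeta>|mT. bv f \<zeta>) else 0) sums (LINT \<zeta>|mT. bv f \<zeta> * cnj (?k \<zeta>))" by simp
    then show ?thesis using sums_single[of 0 "\<lambda>_. LINT \<zeta>|mT. bv f \<zeta>"] sums_unique2 by blast
  qed
  have k1: "integrable mT (\<lambda>\<zeta>. bv f \<zeta> * ?k \<zeta>)" by (rule integrable_times_continuous[OF i kc])
  have k2: "integrable mT (\<lambda>\<zeta>. bv f \<zeta> * cnj (?k \<zeta>))"
    by (rule integrable_times_continuous[OF i continuous_on_cnj[OF kc]])
  have "(LINT \<zeta>|mT. bv f \<zeta> * of_real ((1 - (cmod w)\<^sup>2) / (cmod (\<zeta> - w))\<^sup>2)) = (LINT \<zeta>|mT. bv f \<zeta> * ?k \<zeta> + bv f \<zeta> * cnj (?k \<zeta>) - bv f \<zeta>)"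
    using poisson_kernel_eq[OF _ assms(2)]
    by (intro Bochner_Integration.integral_cong refl) (simp only: space_circle right_diff_distrib distrib_left mult_1_right)
  also have "\<dots> = (LINT \<zeta>|mT. bv f \<zeta> * ?k \<zeta>) + (LINT \<zeta>|mT. bv f \<zeta> * cnj (?k \<zeta>)) - (LINT \<zeta>|mT. bv f \<zeta>)"
    by (simp only: Bochner_Integration.integral_diff[OF Bochner_Integration.integrable_add[OF k1 k2] i] Bochner_Integration.integral_add[OF k1 k2])
  also have "\<dots> = f w"
    using riesz_proj_bv[OF assms] by (simp only: ck riesz_proj_def) simp
  finally show ?thesis by simp
qed

lemma hardy2_bounded_of_bv:
  assumes "f \<in> hardy 2" "AE \<zeta> in mT. cmod (bv f \<zeta>) \<le> K" "cmod w < 1"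
  shows "cmod (f w) \<le> K"
proof -
  let ?P = "\<lambda>\<zeta>. (1 - (cmod w)\<^sup>2) / (cmod (\<zeta> - w))\<^sup>2"
  have i: "integrable mT (bv f)" by (intro sq_integrable_imp_integrable hardy2_bv assms)
  have iP: "integrable mT ?P" by (intro integrable_circle_continuous poisson_kernel_continuous assms)
  have i2: "integrable mT (\<lambda>\<zeta>. bv f \<zeta> * of_real (?P \<zeta>))"
    using poisson_kernel_continuous[OF assms(3)] by (intro integrable_times_continuous i continuous_on_of_real)
  have "cmod (f w) \<le> (LINT \<zeta>|mT. cmod (bv f \<zeta> * of_real (?P \<zeta>)))"
    unfolding hardy2_poisson[OF assms(1,3)] by (rule integral_norm_bound)
  also have "\<dots> \<le> (LINT \<zeta>|mT. K * ?P \<zeta>)"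
  proof (rule integral_mono_AE[OF integrable_norm[OF i2] integrable_mult_right[OF iP]])
    show "AE \<zeta> in mT. cmod (bv f \<zeta> * of_real (?P \<zeta>)) \<le> K * ?P \<zeta>"
      using assms(2)
    proof eventually_elim
      case (elim \<zeta>)
      show ?case
        using mult_right_mono[OF elim poisson_kernel_nonneg[OF assms(3), of \<zeta>]] poisson_kernel_nonneg[OF assms(3), of \<zeta>]
        by (simp only: norm_mult norm_of_real abs_of_nonneg)
    qed
  qed
  also have "\<dots> = K" by (simp only: integral_mult_right_zero poisson_one[OF assms(3)] mult_1_right)
  finally show ?thesis .
qed

lemma poisson_integrable:
  assumes "sq_integrable F" "cmod w < 1"
  shows "integrable mT (\<lambda>\<zeta>. (1 - (cmod w)\<^sup>2) / (cmod (\<zeta> - w))\<^sup>2 * (cmod (F \<zeta>))\<^sup>2)"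
proof -
  have "(\<lambda>\<zeta>. of_real ((cmod (F \<zeta>))\<^sup>2) :: complex) = (\<lambda>\<zeta>. F \<zeta> * cnj (F \<zeta>))"
    by (simp only: complex_norm_square)
  then have "integrable mT (\<lambda>\<zeta>. of_real ((cmod (F \<zeta>))\<^sup>2) :: complex)"
    using integrable_mult_sq[OF assms(1) sq_integrable_cnj[OF assms(1)]] by simp
  then have "integrable mT (\<lambda>\<zeta>. of_real ((cmod (F \<zeta>))\<^sup>2) * complex_of_real ((1 - (cmod w)\<^sup>2) / (cmod (\<zeta> - w))\<^sup>2))"
    by (intro integrable_times_continuous continuous_on_of_real poisson_kernel_continuous assms(2))
  from Bochner_Integration.integrable_Re[OF this] show ?thesis
    by (simp only: of_real_mult[symmetric] Re_complex_of_real mult.commute)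
qed

text \<open>Jensen's inequality for the probability measure with Poisson density, obtained from
  Cauchy-Schwarz by splitting the kernel into two square roots.\<close>

lemma hardy2_poisson_square:
  assumes "f \<in> hardy 2" "cmod w < 1"
  shows "(cmod (f w))\<^sup>2 \<le> poisson (\<lambda>\<zeta>. (cmod (bv f \<zeta>))\<^sup>2) w"
proof -
  let ?P = "\<lambda>\<zeta>. (1 - (cmod w)\<^sup>2) / (cmod (\<zeta> - w))\<^sup>2"
  note P0 = poisson_kernel_nonneg[OF assms(2)]
  have c: "continuous_on unit_circle (\<lambda>\<zeta>. complex_of_real (sqrt (?P \<zeta>)))"
    by (intro continuous_on_of_real continuous_on_real_sqrt poisson_kernel_continuous assms(2))
  have s1: "sq_integrable (\<lambda>\<zeta>. complex_of_real (sqrt (?P \<zeta>)))" by (rule sq_integrable_continuous[OF c])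
  have meas: "bv f \<in> borel_measurable mT" by (rule bv_measurable[OF hardy2_hol[OF assms(1)]])
  have eq: "(cmod (bv f \<zeta> * of_real (sqrt (?P \<zeta>))))\<^sup>2 = ?P \<zeta> * (cmod (bv f \<zeta>))\<^sup>2" for \<zeta>
    using P0[of \<zeta>] by (simp only: norm_mult norm_of_real power_mult_distrib power2_abs real_sqrt_pow2 mult.commute)
  have s2: "sq_integrable (\<lambda>\<zeta>. bv f \<zeta> * of_real (sqrt (?P \<zeta>)))"
    unfolding sq_integrable_def eq
    using poisson_integrable[OF hardy2_bv(1)[OF assms(1)] assms(2)] meas continuous_imp_measurable_circle[OF c] by auto
  have "f w = (LINT \<zeta>|mT. (bv f \<zeta> * of_real (sqrt (?P \<zeta>))) * of_real (sqrt (?P \<zeta>)))"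
    unfolding hardy2_poisson[OF assms]
  proof (intro Bochner_Integration.integral_cong refl)
    fix \<zeta>
    have "of_real (?P \<zeta>) = (of_real (sqrt (?P \<zeta>)) * of_real (sqrt (?P \<zeta>)) :: complex)"
      by (simp only: of_real_mult[symmetric] real_sqrt_mult_self abs_of_nonneg[OF P0])
    then show "bv f \<zeta> * of_real (?P \<zeta>) = (bv f \<zeta> * of_real (sqrt (?P \<zeta>))) * of_real (sqrt (?P \<zeta>))"
      by (simp only: mult.assoc)
  qed
  then have "(cmod (f w))\<^sup>2 \<le> sqn (\<lambda>\<zeta>. bv f \<zeta> * of_real (sqrt (?P \<zeta>))) * sqn (\<lambda>\<zeta>. of_real (sqrt (?P \<zeta>)))"
    using Cauchy_Schwarz_circle[OF s2 s1] by simp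
  also have "sqn (\<lambda>\<zeta>. of_real (sqrt (?P \<zeta>))) = 1"
  proof -
    have "sqn (\<lambda>\<zeta>. of_real (sqrt (?P \<zeta>))) = (LINT \<zeta>|mT. ?P \<zeta>)"
      unfolding sqn_def using P0 by (intro Bochner_Integration.integral_cong refl) (simp only: norm_of_real power2_abs real_sqrt_pow2)
    then show ?thesis using poisson_one[OF assms(2)] by simp
  qed
  finally show ?thesis unfolding sqn_def poisson_def eq by simp
qed

section \<open>Toeplitz operators with conjugate analytic symbol\<close>

lemma fcoeff_diff:
  assumes "integrable mT F" "integrable mT G"
  shows "fcoeff (\<lambda>\<zeta>. F \<zeta> - G \<zeta>) n = fcoeff F n - fcoeff G n"
  unfolding fcoeff_def left_diff_distrib
  by (intro Bochner_Integration.integral_diff integrable_times_continuous assms continuous_intros)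

lemma riesz_proj_integrable:
  assumes "integrable mT F" "cmod z < 1"
  shows "integrable mT (\<lambda>\<zeta>. F \<zeta> / (1 - cnj \<zeta> * z))"
  using integrable_times_continuous[OF assms(1) cauchy_kernel_continuous[OF assms(2)]] by simp

lemma riesz_proj_diff:
  assumes "integrable mT F" "integrable mT G" "cmod z < 1"
  shows "riesz_proj (\<lambda>\<zeta>. F \<zeta> - G \<zeta>) z = riesz_proj F z - riesz_proj G z"
  unfolding riesz_proj_def diff_divide_distrib
  by (intro Bochner_Integration.integral_diff riesz_proj_integrable assms)

lemma riesz_proj_AE_cong:
  assumes "AE \<zeta> in mT. F \<zeta> = G \<zeta>" "integrable mT F" "integrable mT G" "cmod z < 1"
  shows "riesz_proj F z = riesz_proj G z"
  unfolding riesz_proj_def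
proof (rule integral_cong_AE)
  show "AE \<zeta> in mT. F \<zeta> / (1 - cnj \<zeta> * z) = G \<zeta> / (1 - cnj \<zeta> * z)"
    using assms(1) by eventually_elim simp
qed (intro borel_measurable_integrable riesz_proj_integrable assms)+

lemma conj_toeplitz_integrable:
  assumes "v \<in> hardy 2" "sq_integrable F"
  shows "integrable mT (\<lambda>\<zeta>. cnj (bv v \<zeta>) * F \<zeta>)"
  by (intro integrable_mult_sq sq_integrable_cnj hardy2_bv assms)

lemma disc_kernel_bound:
  assumes "cmod w < 1" "cmod z < 1"
  shows "1 - cmod w \<le> cmod (1 - cnj w * z)" "1 - cnj w * z \<noteq> 0"
proof -
  have "cmod (cnj w * z) \<le> cmod w"
    using assms mult_left_mono[of "cmod z" 1 "cmod w"] by (simp add: norm_mult)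
  then show *: "1 - cmod w \<le> cmod (1 - cnj w * z)"
    using norm_triangle_ineq2[of 1 "cnj w * z"] by simp
  then show "1 - cnj w * z \<noteq> 0" using assms by auto
qed

lemma hardy2_times_kernel:
  assumes "v \<in> hardy 2" "cmod w < 1"
  shows "(\<lambda>z. v z / (1 - cnj w * z)) \<in> hardy 2"
    and "AE \<zeta> in mT. bv (\<lambda>z. v z / (1 - cnj w * z)) \<zeta> = bv v \<zeta> / (1 - cnj w * \<zeta>)"
proof -
  note b = disc_kernel_bound[OF assms(2)]
  have "(\<lambda>z. (1 / (1 - cnj w * z)) * v z) \<in> hardy 2"
  proof (rule hardy2_mult_bounded[OF assms(1), where K="1 / (1 - cmod w)"])
    show "(\<lambda>z. 1 / (1 - cnj w * z)) holomorphic_on unit_disc"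
      using b by (intro holomorphic_intros) auto
    show "cmod (1 / (1 - cnj w * z)) \<le> 1 / (1 - cmod w)" if "cmod z < 1" for z
      unfolding norm_divide norm_one using b[OF that] assms by (intro frac_le) auto
  qed
  then show "(\<lambda>z. v z / (1 - cnj w * z)) \<in> hardy 2" by simp
  show "AE \<zeta> in mT. bv (\<lambda>z. v z / (1 - cnj w * z)) \<zeta> = bv v \<zeta> / (1 - cnj w * \<zeta>)"
    using hardy2_radial_limit[OF assms(1)] AE_space
  proof eventually_elim
    case (elim \<zeta>)
    have ne: "1 - cnj w * \<zeta> \<noteq> 0"
      using one_minus_ne[of "cnj w" "cnj \<zeta>"] elim assms by simp
    have "isCont (\<lambda>z. 1 - cnj w * z) \<zeta>" by (intro continuous_intros)
    from has_radial_limit_isCont[OF this] show ?case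
      using elim ne by (intro bv_eqI has_radial_limit_divide)
  qed
qed

text \<open>The difference of \<open>F\<close> and its projection is orthogonal to H2, and the
  symbol times the Cauchy kernel is the conjugate of an H2 function. So bounds for arguments in H2
  extend to square-integrable \<open>F\<close>.\<close>

lemma conj_toeplitz_riesz_proj:
  assumes v: "v \<in> hardy 2" and F: "sq_integrable F" and z: "cmod z < 1"
  shows "conj_toeplitz (bv v) (riesz_proj F) z = riesz_proj (\<lambda>\<zeta>. cnj (bv v \<zeta>) * F \<zeta>) z"
proof -
  define G where "G \<zeta> = F \<zeta> - bv (riesz_proj F) \<zeta>" for \<zeta>
  have h: "riesz_proj F \<in> hardy 2" by (rule riesz_proj_hardy2(1)[OF F])
  have G: "sq_integrable G" unfolding G_def by (intro sq_integrable_diff F hardy2_bv h)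
  have G0: "fcoeff G n = 0" for n
    unfolding G_def
    by (subst fcoeff_diff) (auto intro!: sq_integrable_imp_integrable F hardy2_bv h
        simp: hardy2_fcoeff[OF h] tcoeff_riesz_proj[OF sq_integrable_imp_integrable[OF F]])
  have "(LINT \<zeta>|mT. G \<zeta> * cnj (bv (\<lambda>z'. v z' / (1 - cnj z * z')) \<zeta>)) = 0"
    by (rule hardy2_orthogonal[OF G G0 hardy2_times_kernel(1)[OF v z]])
  also have "(LINT \<zeta>|mT. G \<zeta> * cnj (bv (\<lambda>z'. v z' / (1 - cnj z * z')) \<zeta>)) = (LINT \<zeta>|mT. (cnj (bv v \<zeta>) * G \<zeta>) / (1 - cnj \<zeta> * z))"
  proof (rule integral_cong_AE)
    show "(\<lambda>\<zeta>. G \<zeta> * cnj (bv (\<lambda>z'. v z' / (1 - cnj z * z')) \<zeta>)) \<in> borel_measurable mT"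
      using sq_integrableD(1)[OF G] bv_measurable[OF hardy2_hol[OF hardy2_times_kernel(1)[OF v z]]] by measurable
    show "(\<lambda>\<zeta>. (cnj (bv v \<zeta>) * G \<zeta>) / (1 - cnj \<zeta> * z)) \<in> borel_measurable mT"
      by (intro borel_measurable_integrable riesz_proj_integrable conj_toeplitz_integrable v G z)
    show "AE \<zeta> in mT. G \<zeta> * cnj (bv (\<lambda>z'. v z' / (1 - cnj z * z')) \<zeta>) = (cnj (bv v \<zeta>) * G \<zeta>) / (1 - cnj \<zeta> * z)"
      using hardy2_times_kernel(2)[OF v z] by eventually_elim (simp add: mult.commute)
  qed
  finally have "riesz_proj (\<lambda>\<zeta>. cnj (bv v \<zeta>) * G \<zeta>) z = 0" by (simp add: riesz_proj_def)
  moreover have "riesz_proj (\<lambda>\<zeta>. cnj (bv v \<zeta>) * G \<zeta>) z =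
      riesz_proj (\<lambda>\<zeta>. cnj (bv v \<zeta>) * F \<zeta>) z - riesz_proj (\<lambda>\<zeta>. cnj (bv v \<zeta>) * bv (riesz_proj F) \<zeta>) z"
    unfolding G_def right_diff_distrib
    by (intro riesz_proj_diff conj_toeplitz_integrable v F hardy2_bv h z)
  ultimately show ?thesis by (simp add: conj_toeplitz_def)
qed

section \<open>Outer functions\<close>

definition herglotz :: "(complex \<Rightarrow> real) \<Rightarrow> complex \<Rightarrow> complex" where
  "herglotz \<psi> z = (LINT \<zeta>|mT. (\<zeta> + z) / (\<zeta> - z) * of_real (\<psi> \<zeta>))"

text \<open>Reduces the Herglotz integral to the Riesz projection, from which it inherits
  holomorphy.\<close>

lemma herglotz_kernel:
  assumes "\<zeta> \<in> unit_circle" "cmod z < 1"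
  shows "(\<zeta> + z) / (\<zeta> - z) = 2 / (1 - cnj \<zeta> * z) - 1"
proof -
  have e: "\<zeta> - z = \<zeta> * (1 - cnj \<zeta> * z)" "\<zeta> + z = \<zeta> * (1 + cnj \<zeta> * z)"
    using circle_cnj_mult[OF assms(1)] by (simp_all add: distrib_left right_diff_distrib mult.assoc[symmetric])
  have ne: "\<zeta> \<noteq> 0" "1 - cnj \<zeta> * z \<noteq> 0"
    using assms one_minus_ne[OF assms(2,1)] by (auto simp: mult.commute)
  have "(\<zeta> + z) / (\<zeta> - z) = (1 + cnj \<zeta> * z) / (1 - cnj \<zeta> * z)"
    unfolding e by (rule mult_divide_mult_cancel_left[OF ne(1)])
  also have "\<dots> = 2 / (1 - cnj \<zeta> * z) - 1"
    using ne by (simp add: field_simps)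
  finally show ?thesis .
qed

lemma herglotz_integrable:
  assumes "integrable mT \<psi>" "cmod z < 1"
  shows "integrable mT (\<lambda>\<zeta>. (\<zeta> + z) / (\<zeta> - z) * of_real (\<psi> \<zeta>))"
proof -
  have "continuous_on unit_circle (\<lambda>\<zeta>. (\<zeta> + z) / (\<zeta> - z))"
    using assms(2) by (intro continuous_intros) auto
  then have "integrable mT (\<lambda>\<zeta>. of_real (\<psi> \<zeta>) * ((\<zeta> + z) / (\<zeta> - z)))"
    using assms(1) by (intro integrable_times_continuous) auto
  then show ?thesis by (simp add: mult.commute)
qed

lemma herglotz_eq:
  assumes "integrable mT \<psi>" "cmod z < 1"
  shows "herglotz \<psi> z = 2 * riesz_proj (\<lambda>\<zeta>. of_real (\<psi> \<zeta>)) z - of_real (LINT \<zeta>|mT. \<psi> \<zeta>)"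
proof -
  have i: "integrable mT (\<lambda>\<zeta>. of_real (\<psi> \<zeta>) :: complex)" using assms(1) by auto
  have "herglotz \<psi> z = (LINT \<zeta>|mT. 2 * (of_real (\<psi> \<zeta>) / (1 - cnj \<zeta> * z)) - of_real (\<psi> \<zeta>))"
    unfolding herglotz_def
    by (intro Bochner_Integration.integral_cong refl) (simp add: herglotz_kernel assms(2) left_diff_distrib)
  also have "\<dots> = 2 * riesz_proj (\<lambda>\<zeta>. of_real (\<psi> \<zeta>)) z - of_real (LINT \<zeta>|mT. \<psi> \<zeta>)"
    unfolding riesz_proj_def integral_complex_of_real[symmetric] integral_mult_right_zero[symmetric]
    by (intro Bochner_Integration.integral_diff integrable_mult_right riesz_proj_integrable i assms(2))
  finally show ?thesis .
qed

lemma herglotz_hol: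
  assumes "integrable mT \<psi>"
  shows "herglotz \<psi> holomorphic_on unit_disc"
proof -
  have i: "integrable mT (\<lambda>\<zeta>. of_real (\<psi> \<zeta>) :: complex)" using assms by auto
  have "(\<lambda>z. 2 * riesz_proj (\<lambda>\<zeta>. of_real (\<psi> \<zeta>)) z - of_real (LINT \<zeta>|mT. \<psi> \<zeta>)) holomorphic_on unit_disc"
    by (intro holomorphic_intros riesz_proj_hol i)
  then show ?thesis
    by (rule holomorphic_transform) (simp add: herglotz_eq[OF assms])
qed

lemma herglotz_diff:
  assumes "integrable mT \<phi>" "integrable mT \<psi>" "cmod z < 1"
  shows "herglotz (\<lambda>\<zeta>. \<phi> \<zeta> - \<psi> \<zeta>) z = herglotz \<phi> z - herglotz \<psi> z"
  unfolding herglotz_def of_real_diff right_diff_distrib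
  by (intro Bochner_Integration.integral_diff herglotz_integrable assms)

lemma herglotz_0: "herglotz \<psi> 0 = of_real (LINT \<zeta>|mT. \<psi> \<zeta>)"
proof -
  have "herglotz \<psi> 0 = (LINT \<zeta>|mT. of_real (\<psi> \<zeta>))"
    unfolding herglotz_def by (intro Bochner_Integration.integral_cong refl) auto
  then show ?thesis by simp
qed

lemma Re_herglotz_kernel:
  assumes "\<zeta> \<in> unit_circle" "cmod z < 1"
  shows "Re ((\<zeta> + z) / (\<zeta> - z)) = (1 - (cmod z)\<^sup>2) / (cmod (\<zeta> - z))\<^sup>2"
proof -
  have "complex_of_real ((1 - (cmod z)\<^sup>2) / (cmod (\<zeta> - z))\<^sup>2) = 1 / (1 - cnj \<zeta> * z) + cnj (1 / (1 - cnj \<zeta> * z)) - 1"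
    by (rule poisson_kernel_eq[OF assms])
  then have "(1 - (cmod z)\<^sup>2) / (cmod (\<zeta> - z))\<^sup>2 = Re (1 / (1 - cnj \<zeta> * z) + cnj (1 / (1 - cnj \<zeta> * z)) - 1)"
    by (metis Re_complex_of_real)
  also have "\<dots> = 2 * Re (1 / (1 - cnj \<zeta> * z)) - 1"
    by (simp only: minus_complex.sel plus_complex.sel cnj.sel one_complex.sel mult_2)
  also have "\<dots> = Re ((\<zeta> + z) / (\<zeta> - z))"
    unfolding herglotz_kernel[OF assms]
    using Re_divide_of_real[of 2] by (simp add: Re_divide)
  finally show ?thesis by simp
qed

lemma Re_herglotz_ge:
  assumes "integrable mT \<psi>" "cmod z < 1" "\<And>\<zeta>. \<zeta> \<in> unit_circle \<Longrightarrow> K \<le> \<psi> \<zeta>"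
  shows "K \<le> Re (herglotz \<psi> z)"
proof -
  let ?P = "\<lambda>\<zeta>. (1 - (cmod z)\<^sup>2) / (cmod (\<zeta> - z))\<^sup>2"
  note i = herglotz_integrable[OF assms(1,2)]
  have iP: "integrable mT ?P" by (intro integrable_circle_continuous poisson_kernel_continuous assms)
  have "K = (LINT \<zeta>|mT. K * ?P \<zeta>)" by (simp only: integral_mult_right_zero poisson_one[OF assms(2)] mult_1_right)
  also have "\<dots> \<le> (LINT \<zeta>|mT. Re ((\<zeta> + z) / (\<zeta> - z) * of_real (\<psi> \<zeta>)))"
  proof (rule Bochner_Integration.integral_mono[OF integrable_mult_right[OF iP] Bochner_Integration.integrable_Re[OF i]])
    fix \<zeta> assume "\<zeta> \<in> space mT"
    then have \<zeta>: "\<zeta> \<in> unit_circle" by simp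
    have "Re ((\<zeta> + z) / (\<zeta> - z) * of_real (\<psi> \<zeta>)) = ?P \<zeta> * \<psi> \<zeta>"
      unfolding Re_herglotz_kernel[OF \<zeta> assms(2), symmetric] times_complex.sel by simp
    then show "K * ?P \<zeta> \<le> Re ((\<zeta> + z) / (\<zeta> - z) * of_real (\<psi> \<zeta>))"
      using mult_right_mono[OF assms(3)[OF \<zeta>] poisson_kernel_nonneg[OF assms(2), of \<zeta>]] by (simp only: mult.commute)
  qed
  also have "\<dots> = Re (herglotz \<psi> z)"
    unfolding herglotz_def by (rule Bochner_Integration.integral_Re[OF i])
  finally show ?thesis .
qed

text \<open>Truncating the logarithm of the modulus of an outer function \<open>v\<close> from below gives bounded
  functions \<open>p n\<close> that almost invert \<open>v\<close>.\<close>

lemma outer_approximate_inverses: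
  assumes "outer v"
  shows "\<exists>c p. cmod c = 1 \<and> (\<forall>n. p n holomorphic_on unit_disc \<and>
      (\<forall>z. cmod z < 1 \<longrightarrow> cmod (p n z) \<le> exp (real n) \<and> cmod (p n z * v z) \<le> 1)) \<and> (\<lambda>n. p n 0 * v 0) \<longlonglongrightarrow> c"
proof -
  obtain c \<phi> where c: "cmod c = 1" and \<phi>: "\<phi> \<in> borel_measurable mT" "integrable mT (\<lambda>\<zeta>. ln (\<phi> \<zeta>))"
    and v: "\<And>z. cmod z < 1 \<Longrightarrow> v z = c * exp (herglotz (\<lambda>\<zeta>. ln (\<phi> \<zeta>)) z)"
    using assms unfolding outer_def herglotz_def by auto
  define L where "L \<zeta> = ln (\<phi> \<zeta>)" for \<zeta>
  \<comment> \<open>As \<open>M n\<close> is at least \<open>- n\<close>, the function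
    \<open>p n\<close> below is at most \<open>exp n\<close>; as \<open>M n\<close> is at least
    \<open>L\<close>, its product with \<open>v\<close> is at most 1.\<close>
  define M where "M n \<zeta> = max (L \<zeta>) (- real n)" for n \<zeta>
  have iL: "integrable mT L" using \<phi>(2) by (simp add: L_def[abs_def])
  then have mL [measurable]: "L \<in> borel_measurable mT" by (rule borel_measurable_integrable)
  have bM: "\<bar>M n \<zeta>\<bar> \<le> \<bar>L \<zeta>\<bar> + real n" for n \<zeta> unfolding M_def by linarith
  have iM: "integrable mT (M n)" for n
  proof (rule Bochner_Integration.integrable_bound)
    show "integrable mT (\<lambda>\<zeta>. \<bar>L \<zeta>\<bar> + real n)" using iL by auto
    show "M n \<in> borel_measurable mT" unfolding M_def by measurable
    show "AE \<zeta> in mT. norm (M n \<zeta>) \<le> norm (\<bar>L \<zeta>\<bar> + real n)" using bM by (auto intro!: AE_I2)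
  qed
  define p where "p n z = exp (- herglotz (M n) z)" for n z
  have pv: "p n z * v z = c * exp (herglotz (\<lambda>\<zeta>. L \<zeta> - M n \<zeta>) z)" if "cmod z < 1" for n z
    unfolding herglotz_diff[OF iL iM that] exp_diff
    by (simp add: p_def v[OF that] L_def[symmetric] exp_minus field_simps)
  show ?thesis
  proof (intro exI[of _ c] exI[of _ p] conjI allI impI c)
    show "p n holomorphic_on unit_disc" for n
      unfolding p_def by (intro holomorphic_intros herglotz_hol iM)
    show "cmod (p n z) \<le> exp (real n)" if "cmod z < 1" for n z
      unfolding p_def norm_exp_eq_Re
      using Re_herglotz_ge[OF iM that, of "- real n" n] by (simp add: M_def)
    show "cmod (p n z * v z) \<le> 1" if "cmod z < 1" for n z
    proof -
      have "0 \<le> Re (herglotz (\<lambda>\<zeta>. M n \<zeta> - L \<zeta>) z)"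
        by (intro Re_herglotz_ge that Bochner_Integration.integrable_diff iM iL) (simp add: M_def)
      then have "Re (herglotz (\<lambda>\<zeta>. L \<zeta> - M n \<zeta>) z) \<le> 0"
        by (simp add: herglotz_diff iM iL that)
      then show ?thesis unfolding pv[OF that] norm_mult norm_exp_eq_Re by (simp add: c)
    qed
    \<comment> \<open>At 0 the product is \<open>c\<close> times the exponential of the mean of
      \<open>L - M n\<close>; this mean tends to 0 by dominated convergence because \<open>L\<close>
      is integrable.\<close>
    have "(\<lambda>n. LINT \<zeta>|mT. L \<zeta> - M n \<zeta>) \<longlonglongrightarrow> (LINT \<zeta>|mT. 0)"
    proof (rule integral_dominated_convergence[where w="\<lambda>\<zeta>. \<bar>L \<zeta>\<bar>"])
      show "AE \<zeta> in mT. (\<lambda>n. L \<zeta> - M n \<zeta>) \<longlonglongrightarrow> 0"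
      proof (rule AE_I2)
        fix \<zeta>
        obtain N :: nat where N: "- L \<zeta> \<le> real N" using real_arch_simple by blast
        have "eventually (\<lambda>n. L \<zeta> - M n \<zeta> = 0) sequentially"
          using eventually_ge_at_top[of N]
        proof eventually_elim
          case (elim n)
          then have "real N \<le> real n" by simp
          then have "- real n \<le> L \<zeta>" using N by linarith
          then show ?case by (simp add: M_def)
        qed
        then show "(\<lambda>n. L \<zeta> - M n \<zeta>) \<longlonglongrightarrow> 0" by (rule tendsto_eventually)
      qed
      show "AE \<zeta> in mT. norm (L \<zeta> - M n \<zeta>) \<le> \<bar>L \<zeta>\<bar>" for n
        by (intro AE_I2) (auto simp: M_def max_def)
    qed (use iL iM in auto)
    then have "(\<lambda>n. c * exp (of_real (LINT \<zeta>|mT. L \<zeta> - M n \<zeta>))) \<longlonglongrightarrow> c * exp (of_real 0)"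
      by (intro tendsto_intros) simp
    then show "(\<lambda>n. p n 0 * v 0) \<longlonglongrightarrow> c"
      by (simp add: pv herglotz_0)
  qed
qed

text \<open>A function in the unit ball whose mean is close to a unimodular constant is close to it
  in L2: expanding the square bounds the squared distance by
  \<open>2 - 2 * Re (q 0 * cnj c)\<close>, where \<open>q\<close> is the product.\<close>

lemma outer_L2_approx:
  assumes v: "v \<in> hardy 2" and "outer v"
  shows "\<exists>c p. cmod c = 1 \<and>
    (\<forall>n. p n holomorphic_on unit_disc \<and> (\<forall>z. cmod z < 1 \<longrightarrow> cmod (p n z) \<le> exp (real n)) \<and>
      (AE \<zeta> in mT. bv (\<lambda>z. p n z * v z) \<zeta> = bv (p n) \<zeta> * bv v \<zeta>) \<and> (\<lambda>z. p n z * v z) \<in> hardy 2) \<and>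
    (\<lambda>n. sqn (\<lambda>\<zeta>. bv (\<lambda>z. p n z * v z) \<zeta> - c)) \<longlonglongrightarrow> 0"
proof -
  obtain c p where c: "cmod c = 1" and pp: "\<forall>n. p n holomorphic_on unit_disc \<and>
      (\<forall>z. cmod z < 1 \<longrightarrow> cmod (p n z) \<le> exp (real n) \<and> cmod (p n z * v z) \<le> 1)"
    and lim: "(\<lambda>n. p n 0 * v 0) \<longlonglongrightarrow> c"
    using outer_approximate_inverses[OF assms(2)] by blast
  have p: "\<And>n::nat. p n holomorphic_on unit_disc"
    "\<And>n z. cmod z < 1 \<Longrightarrow> cmod (p n z) \<le> exp (real n)" "\<And>n z. cmod z < 1 \<Longrightarrow> cmod (p n z * v z) \<le> 1"
    using pp by blast+
  let ?q = "\<lambda>n z. p n z * v z"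
  have q: "?q n \<in> hardy 2" for n by (rule hardy2_mult_bounded[OF v p(1,2)])
  have hp: "p n \<in> hardy 2" for n by (rule hardy2_bounded_hol[OF p(1,2)])
  have le: "sqn (\<lambda>\<zeta>. bv (?q n) \<zeta> - c) \<le> 2 - 2 * Re (?q n 0 * cnj c)" for n
  proof -
    have "AE \<zeta> in mT. cmod (bv (?q n) \<zeta>) \<le> 1"
      using hardy2_radial_limit[OF q] AE_space
      by eventually_elim (auto intro: has_radial_limit_norm_le p(3))
    then have "sqn (bv (?q n)) \<le> 1\<^sup>2 * sqn (\<lambda>_. 1)"
      by (intro sq_integrable_bound(2) sq_integrable_continuous bv_measurable hardy2_hol q) auto
    moreover have "sqn (\<lambda>_. 1) = 1" "sqn (\<lambda>_. c) = 1" using mT.prob_space by (simp_all add: sqn_def c)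
    moreover have "(LINT \<zeta>|mT. bv (?q n) \<zeta> * cnj c) = ?q n 0 * cnj c"
      using hardy2_fcoeff[OF q, of n 0] by (simp add: fcoeff_def tcoeff_def)
    ultimately show ?thesis
      by (subst sqn_diff) (auto intro: hardy2_bv q sq_integrable_continuous)
  qed
  have "(\<lambda>n. 2 - 2 * Re (?q n 0 * cnj c)) \<longlonglongrightarrow> 2 - 2 * Re (c * cnj c)"
    by (intro tendsto_intros lim)
  moreover have "Re (c * cnj c) = 1" using c by (simp add: complex_norm_square[symmetric])
  ultimately have lim0: "(\<lambda>n. 2 - 2 * Re (?q n 0 * cnj c)) \<longlonglongrightarrow> 0" by (simp del: times_complex.sel)
  have "(\<lambda>n. sqn (\<lambda>\<zeta>. bv (?q n) \<zeta> - c)) \<longlonglongrightarrow> 0"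
    by (rule Lim_null_comparison[OF always_eventually lim0]) (use le in \<open>simp only: real_norm_def abs_of_nonneg[OF sqn_nonneg] simp_thms\<close>)
  moreover have "AE \<zeta> in mT. bv (?q n) \<zeta> = bv (p n) \<zeta> * bv v \<zeta>" for n
    using hardy2_radial_limit[OF hp] hardy2_radial_limit[OF v]
    by eventually_elim (intro bv_eqI has_radial_limit_mult)
  ultimately show ?thesis using c p q by blast
qed

text \<open>Where \<open>bv v\<close> vanishes, almost everywhere so do the approximants, and there
  the squared distance to \<open>c\<close> is 1. Hence the measure of that set is below every member
  of a null sequence.\<close>

lemma outer_bv_nonzero:
  assumes v: "v \<in> hardy 2" and "outer v"
  shows "AE \<zeta> in mT. bv v \<zeta> \<noteq> 0"
proof -
  obtain c p where c: "cmod c = 1" and pp: "\<forall>n. p n holomorphic_on unit_disc \<and> (\<forall>z. cmod z < 1 \<longrightarrow> cmod (p n z) \<le> exp (real n)) \<and>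
      (AE \<zeta> in mT. bv (\<lambda>z. p n z * v z) \<zeta> = bv (p n) \<zeta> * bv v \<zeta>) \<and> (\<lambda>z. p n z * v z) \<in> hardy 2"
    and lim: "(\<lambda>n. sqn (\<lambda>\<zeta>. bv (\<lambda>z. p n z * v z) \<zeta> - c)) \<longlonglongrightarrow> 0"
    using outer_L2_approx[OF assms] by blast
  have p: "\<And>n. p n holomorphic_on unit_disc" "\<And>n z. cmod z < 1 \<Longrightarrow> cmod (p n z) \<le> exp (real n)"
    and ae: "\<And>n. AE \<zeta> in mT. bv (\<lambda>z. p n z * v z) \<zeta> = bv (p n) \<zeta> * bv v \<zeta>"
    and q: "\<And>n. (\<lambda>z. p n z * v z) \<in> hardy 2"
    using pp by blast+
  have [measurable]: "bv v \<in> borel_measurable mT" by (rule bv_measurable[OF hardy2_hol[OF v]])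
  let ?E = "{\<zeta> \<in> space mT. bv v \<zeta> = 0}"
  have E: "?E \<in> sets mT" by measurable
  have "measure mT ?E \<le> sqn (\<lambda>\<zeta>. bv (\<lambda>z. p n z * v z) \<zeta> - c)" for n
  proof -
    have "sq_integrable (\<lambda>\<zeta>. bv (\<lambda>z. p n z * v z) \<zeta> - c)"
      by (intro sq_integrable_diff hardy2_bv q sq_integrable_continuous continuous_intros)
    then have i: "integrable mT (\<lambda>\<zeta>. (cmod (bv (\<lambda>z. p n z * v z) \<zeta> - c))\<^sup>2)" by (rule sq_integrableD(2))
    have "measure mT ?E = (LINT \<zeta>|mT. indicator ?E \<zeta>)"
      by (simp only: Bochner_Integration.integral_indicator Int_absorb2[OF sets.sets_into_space[OF E]])
    also have "\<dots> \<le> sqn (\<lambda>\<zeta>. bv (\<lambda>z. p n z * v z) \<zeta> - c)"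
      unfolding sqn_def
    proof (rule integral_mono_AE[OF _ i])
      show "integrable mT (indicator ?E :: complex \<Rightarrow> real)" using E by (simp add: mT.emeasure_finite less_top[symmetric])
      show "AE \<zeta> in mT. indicator ?E \<zeta> \<le> (cmod (bv (\<lambda>z. p n z * v z) \<zeta> - c))\<^sup>2"
        using ae[of n] by eventually_elim (auto simp: indicator_def c)
    qed
    finally show ?thesis .
  qed
  then have "measure mT ?E \<le> 0" by (intro tendsto_lowerbound[OF lim]) auto
  then have "emeasure mT ?E = 0"
    by (simp add: mT.emeasure_eq_measure measure_le_0_iff)
  then show ?thesis using E by (auto simp: AE_iff_null null_sets_def)
qed

section \<open>Injectivity of the conjugate analytic Toeplitz operator\<close>

lemma integral_cnj_bounded_hol_zero:
  assumes F: "integrable mT F" "\<And>n. fcoeff F n = 0"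
    and p: "p holomorphic_on unit_disc" "\<And>z. cmod z < 1 \<Longrightarrow> cmod (p z) \<le> K"
  shows "(LINT \<zeta>|mT. F \<zeta> * cnj (bv p \<zeta>)) = 0"
proof -
  let ?r = "\<lambda>j. 1 - 1 / (real j + 3)"
  have rj: "0 \<le> ?r j" "?r j < 1" for j by (auto simp: field_simps)
  have hp: "p \<in> hardy 2" by (rule hardy2_bounded_hol[OF p])
  \<comment> \<open>As \<open>F\<close> is only integrable, orthogonality is first checked on
    dilates of \<open>p\<close>, whose series converge absolutely on the circle; the bound
    \<open>K\<close> then permits dominated convergence.\<close>
  have zero: "(LINT \<zeta>|mT. F \<zeta> * cnj (p (of_real r * \<zeta>))) = 0" if r: "0 \<le> r" "r < 1" for r
  proof -
    note d = dilate_series[OF p(1) r]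
    have "(\<lambda>n. cnj (tcoeff p n * of_real r ^ n) * (LINT \<zeta>|mT. F \<zeta> * cnj \<zeta> ^ n)) sums
        (LINT \<zeta>|mT. F \<zeta> * (\<Sum>n. cnj (tcoeff p n * of_real r ^ n) * cnj \<zeta> ^ n))"
      using d(1) by (intro integral_times_series F) (auto intro!: continuous_intros simp: norm_power norm_mult)
    moreover have "(LINT \<zeta>|mT. F \<zeta> * cnj \<zeta> ^ n) = 0" for n using F(2)[of n] by (simp add: fcoeff_def)
    ultimately have "(\<lambda>n. 0) sums (LINT \<zeta>|mT. F \<zeta> * (\<Sum>n. cnj (tcoeff p n * of_real r ^ n) * cnj \<zeta> ^ n))" by simp
    then have "(LINT \<zeta>|mT. F \<zeta> * (\<Sum>n. cnj (tcoeff p n * of_real r ^ n) * cnj \<zeta> ^ n)) = 0"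
      using sums_unique2[OF _ sums_zero] by blast
    moreover have "(LINT \<zeta>|mT. F \<zeta> * (\<Sum>n. cnj (tcoeff p n * of_real r ^ n) * cnj \<zeta> ^ n)) = (LINT \<zeta>|mT. F \<zeta> * cnj (p (of_real r * \<zeta>)))"
    proof (intro Bochner_Integration.integral_cong refl)
      fix \<zeta> assume "\<zeta> \<in> space mT"
      then have \<zeta>: "\<zeta> \<in> unit_circle" by simp
      have "(\<lambda>n. tcoeff p n * of_real r ^ n * \<zeta> ^ n) sums p (of_real r * \<zeta>)"
        unfolding d(2)[OF \<zeta>] using circle_series_bound(1)[OF d(1), of \<zeta>] \<zeta> by (intro summable_sums) auto
      then have "(\<lambda>n. cnj (tcoeff p n * of_real r ^ n) * cnj \<zeta> ^ n) sums cnj (p (of_real r * \<zeta>))"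
        by (subst sums_cnj[symmetric]) simp
      then show "F \<zeta> * (\<Sum>n. cnj (tcoeff p n * of_real r ^ n) * cnj \<zeta> ^ n) = F \<zeta> * cnj (p (of_real r * \<zeta>))"
        by (simp add: sums_iff)
    qed
    ultimately show ?thesis by simp
  qed
  have "(\<lambda>j. LINT \<zeta>|mT. F \<zeta> * cnj (p (of_real (?r j) * \<zeta>))) \<longlonglongrightarrow> (LINT \<zeta>|mT. F \<zeta> * cnj (bv p \<zeta>))"
  proof (rule integral_dominated_convergence[where w="\<lambda>\<zeta>. cmod (F \<zeta>) * K"])
    have [measurable]: "F \<in> borel_measurable mT" using F(1) by (rule borel_measurable_integrable)
    show "(\<lambda>\<zeta>. F \<zeta> * cnj (bv p \<zeta>)) \<in> borel_measurable mT"
      using bv_measurable[OF p(1)] by measurable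
    show "(\<lambda>\<zeta>. F \<zeta> * cnj (p (of_real (?r j) * \<zeta>))) \<in> borel_measurable mT" for j
      using dilate_measurable[OF p(1) rj[of j]] by measurable
    show "integrable mT (\<lambda>\<zeta>. cmod (F \<zeta>) * K)" using F(1) by auto
    show "AE \<zeta> in mT. (\<lambda>j. F \<zeta> * cnj (p (of_real (?r j) * \<zeta>))) \<longlonglongrightarrow> F \<zeta> * cnj (bv p \<zeta>)"
      using hardy2_radial_limit[OF hp]
      by eventually_elim (unfold has_radial_limit_def, intro tendsto_intros filterlim_compose[OF _ radial_seq])
    show "AE \<zeta> in mT. norm (F \<zeta> * cnj (p (of_real (?r j) * \<zeta>))) \<le> cmod (F \<zeta>) * K" for j
    proof (rule AE_I2)
      fix \<zeta> assume "\<zeta> \<in> space mT"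
      then have "cmod (of_real (?r j) * \<zeta>) < 1" using rj[of j] by (subst cmod_dilate) auto
      from p(2)[OF this] show "norm (F \<zeta> * cnj (p (of_real (?r j) * \<zeta>))) \<le> cmod (F \<zeta>) * K"
        unfolding norm_mult complex_mod_cnj by (intro mult_left_mono) auto
    qed
  qed
  then have "(\<lambda>j. 0) \<longlonglongrightarrow> (LINT \<zeta>|mT. F \<zeta> * cnj (bv p \<zeta>))" by (simp only: zero[OF rj])
  from LIMSEQ_unique[OF tendsto_const this] show ?thesis by simp
qed

text \<open>If the projection vanishes, \<open>cnj v f\<close> is orthogonal to
  \<open>z ^ m * p n z\<close>, so \<open>f\<close> is orthogonal to
  \<open>z ^ m * p n z * v z\<close>. As \<open>p n * v\<close> tends to \<open>c\<close> in L2, the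
  coefficient of index \<open>m\<close> must be 0.\<close>

lemma conj_toeplitz_kernel:
  assumes v: "v \<in> hardy 2" "outer v" and f: "f \<in> hardy 2"
    and zero: "\<And>z. cmod z < 1 \<Longrightarrow> conj_toeplitz (bv v) f z = 0"
  shows "tcoeff f m = 0"
proof -
  obtain c p where c: "cmod c = 1" and pp: "\<forall>n. p n holomorphic_on unit_disc \<and> (\<forall>z. cmod z < 1 \<longrightarrow> cmod (p n z) \<le> exp (real n)) \<and>
      (AE \<zeta> in mT. bv (\<lambda>z. p n z * v z) \<zeta> = bv (p n) \<zeta> * bv v \<zeta>) \<and> (\<lambda>z. p n z * v z) \<in> hardy 2"
    and lim: "(\<lambda>n. sqn (\<lambda>\<zeta>. bv (\<lambda>z. p n z * v z) \<zeta> - c)) \<longlonglongrightarrow> 0"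
    using outer_L2_approx[OF v] by blast
  have p: "\<And>n. p n holomorphic_on unit_disc" "\<And>n z. cmod z < 1 \<Longrightarrow> cmod (p n z) \<le> exp (real n)"
    and ae: "\<And>n. AE \<zeta> in mT. bv (\<lambda>z. p n z * v z) \<zeta> = bv (p n) \<zeta> * bv v \<zeta>"
    and q: "\<And>n. (\<lambda>z. p n z * v z) \<in> hardy 2"
    using pp by blast+
  let ?F = "\<lambda>\<zeta>. cnj (bv v \<zeta>) * bv f \<zeta>"
  have F: "integrable mT ?F" by (intro conj_toeplitz_integrable v hardy2_bv f)
  have F0: "fcoeff ?F n = 0" for n
  proof -
    have "tcoeff (riesz_proj ?F) n = (\<lambda>_. 0) n"
      using zero by (intro tcoeff_unique riesz_proj_hol F) (simp add: conj_toeplitz_def)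
    then show ?thesis by (simp add: tcoeff_riesz_proj[OF F])
  qed
  let ?g = "\<lambda>\<zeta>. bv f \<zeta> * cnj \<zeta> ^ m"
  have gq: "sq_integrable ?g" "sqn ?g \<le> sqn (bv f)"
  proof -
    have m: "(\<lambda>\<zeta>. cnj \<zeta> ^ m) \<in> borel_measurable mT" by (intro continuous_imp_measurable_circle continuous_intros)
    have "AE \<zeta> in mT. cmod (cnj \<zeta> ^ m) \<le> 1" by (intro AE_I2) (simp add: norm_power)
    from sq_integrable_cmult[OF hardy2_bv(1)[OF f] m this]
    show "sq_integrable ?g" "sqn ?g \<le> sqn (bv f)" by (simp_all add: mult.commute)
  qed
  have orth: "(LINT \<zeta>|mT. ?g \<zeta> * cnj (bv (\<lambda>z. p n z * v z) \<zeta>)) = 0" for n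
  proof -
    have hol: "(\<lambda>z. z ^ m * p n z) holomorphic_on unit_disc" by (intro holomorphic_intros p)
    have bd: "cmod (z ^ m * p n z) \<le> exp (real n)" if "cmod z < 1" for z
    proof -
      have "cmod (z ^ m * p n z) \<le> 1 * cmod (p n z)"
        unfolding norm_mult norm_power using that by (intro mult_right_mono power_le_one) auto
      then show ?thesis using p(2)[OF that, of n] by simp
    qed
    have hp: "p n \<in> hardy 2" by (rule hardy2_bounded_hol[OF p])
    have "AE \<zeta> in mT. bv (\<lambda>z. z ^ m * p n z) \<zeta> = \<zeta> ^ m * bv (p n) \<zeta>"
      using hardy2_radial_limit[OF hp]
      by eventually_elim (intro bv_eqI has_radial_limit_mult has_radial_limit_isCont[where g="\<lambda>z. z ^ m"] continuous_intros)
    then have "AE \<zeta> in mT. ?F \<zeta> * cnj (bv (\<lambda>z. z ^ m * p n z) \<zeta>) = ?g \<zeta> * cnj (bv (\<lambda>z. p n z * v z) \<zeta>)"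
      using ae[of n] by eventually_elim simp
    then have "(LINT \<zeta>|mT. ?F \<zeta> * cnj (bv (\<lambda>z. z ^ m * p n z) \<zeta>)) = (LINT \<zeta>|mT. ?g \<zeta> * cnj (bv (\<lambda>z. p n z * v z) \<zeta>))"
    proof (intro integral_cong_AE)
      have [measurable]: "bv v \<in> borel_measurable mT" "bv f \<in> borel_measurable mT"
        "bv (\<lambda>z. z ^ m * p n z) \<in> borel_measurable mT" "bv (\<lambda>z. p n z * v z) \<in> borel_measurable mT"
        by (intro bv_measurable hardy2_hol v f q hol)+
      show "(\<lambda>\<zeta>. ?F \<zeta> * cnj (bv (\<lambda>z. z ^ m * p n z) \<zeta>)) \<in> borel_measurable mT"
        "(\<lambda>\<zeta>. ?g \<zeta> * cnj (bv (\<lambda>z. p n z * v z) \<zeta>)) \<in> borel_measurable mT" by measurable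
    qed
    then show ?thesis using integral_cnj_bounded_hol_zero[OF F F0 hol bd] by simp
  qed
  have sq: "sq_integrable (\<lambda>\<zeta>. bv (\<lambda>z. p n z * v z) \<zeta> - c)" for n
    by (intro sq_integrable_diff hardy2_bv q sq_integrable_continuous continuous_intros)
  have le: "(cmod (fcoeff (bv f) m * cnj c))\<^sup>2 \<le> sqn (bv f) * sqn (\<lambda>\<zeta>. bv (\<lambda>z. p n z * v z) \<zeta> - c)" for n
  proof -
    have i1: "integrable mT (\<lambda>\<zeta>. ?g \<zeta> * cnj (bv (\<lambda>z. p n z * v z) \<zeta>))"
      by (intro integrable_mult_sq gq sq_integrable_cnj hardy2_bv q)
    have i2: "integrable mT (\<lambda>\<zeta>. ?g \<zeta> * cnj c)"
      by (intro integrable_mult_sq gq sq_integrable_continuous continuous_intros)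
    have "(LINT \<zeta>|mT. ?g \<zeta> * cnj (bv (\<lambda>z. p n z * v z) \<zeta> - c)) = (LINT \<zeta>|mT. ?g \<zeta> * cnj (bv (\<lambda>z. p n z * v z) \<zeta>)) - (LINT \<zeta>|mT. ?g \<zeta> * cnj c)"
      unfolding complex_cnj_diff right_diff_distrib by (rule Bochner_Integration.integral_diff[OF i1 i2])
    also have "\<dots> = - (fcoeff (bv f) m * cnj c)"
      unfolding orth by (simp add: fcoeff_def)
    finally have "(cmod (fcoeff (bv f) m * cnj c))\<^sup>2 \<le> sqn ?g * sqn (\<lambda>\<zeta>. bv (\<lambda>z. p n z * v z) \<zeta> - c)"
      using Cauchy_Schwarz_circle[OF gq(1) sq_integrable_cnj[OF sq[of n]]] unfolding sqn_cnj by (simp only: norm_minus_cancel)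
    also have "\<dots> \<le> sqn (bv f) * sqn (\<lambda>\<zeta>. bv (\<lambda>z. p n z * v z) \<zeta> - c)"
      using gq(2) by (intro mult_right_mono) auto
    finally show ?thesis .
  qed
  have "(\<lambda>n. sqn (bv f) * sqn (\<lambda>\<zeta>. bv (\<lambda>z. p n z * v z) \<zeta> - c)) \<longlonglongrightarrow> sqn (bv f) * 0"
    by (intro tendsto_intros lim)
  then have "(cmod (fcoeff (bv f) m * cnj c))\<^sup>2 \<le> sqn (bv f) * 0"
    by (rule tendsto_lowerbound) (use le in auto)
  then show ?thesis using c hardy2_fcoeff[OF f, of m] by (auto simp: norm_mult)
qed

text \<open>The difference lies in the kernel, so all Taylor coefficients agree. Equality of norms
  is what evaluates the range norm, whichever preimage \<open>inv_into\<close> picks.\<close>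

lemma conj_toeplitz_injective:
  assumes v: "v \<in> hardy 2" "outer v" and f: "f \<in> hardy 2" "g \<in> hardy 2"
    and eq: "\<And>z. cmod z < 1 \<Longrightarrow> conj_toeplitz (bv v) f z = conj_toeplitz (bv v) g z"
  shows "sqn (bv f) = sqn (bv g)"
proof -
  let ?h = "\<lambda>z. f z - g z"
  have h: "?h \<in> hardy 2" by (rule hardy2_diff[OF f])
  have ae: "AE \<zeta> in mT. bv ?h \<zeta> = bv f \<zeta> - bv g \<zeta>"
    using hardy2_radial_limit[OF f(1)] hardy2_radial_limit[OF f(2)]
    by eventually_elim (intro bv_eqI has_radial_limit_diff)
  note i = conj_toeplitz_integrable[OF v(1) hardy2_bv(1)]
  have "conj_toeplitz (bv v) ?h z = 0" if z: "cmod z < 1" for z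
  proof -
    have "conj_toeplitz (bv v) ?h z = riesz_proj (\<lambda>\<zeta>. cnj (bv v \<zeta>) * bv f \<zeta> - cnj (bv v \<zeta>) * bv g \<zeta>) z"
      unfolding conj_toeplitz_def
    proof (rule riesz_proj_AE_cong[OF _ i[OF h] Bochner_Integration.integrable_diff[OF i[OF f(1)] i[OF f(2)]] z])
      show "AE \<zeta> in mT. cnj (bv v \<zeta>) * bv ?h \<zeta> = cnj (bv v \<zeta>) * bv f \<zeta> - cnj (bv v \<zeta>) * bv g \<zeta>"
        using ae by eventually_elim (simp add: right_diff_distrib)
    qed
    also have "\<dots> = conj_toeplitz (bv v) f z - conj_toeplitz (bv v) g z"
      unfolding conj_toeplitz_def by (rule riesz_proj_diff[OF i[OF f(1)] i[OF f(2)] z])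
    finally show ?thesis using eq[OF z] by simp
  qed
  then have "tcoeff ?h n = 0" for n by (rule conj_toeplitz_kernel[OF v h])
  then have "fcoeff (bv ?h) n = 0" for n using hardy2_fcoeff[OF h] by simp
  moreover have "fcoeff (bv ?h) n = fcoeff (bv f) n - fcoeff (bv g) n" for n
  proof -
    have "fcoeff (bv ?h) n = fcoeff (\<lambda>\<zeta>. bv f \<zeta> - bv g \<zeta>) n"
      unfolding fcoeff_def
    proof (rule integral_cong_AE)
      show "AE \<zeta> in mT. bv ?h \<zeta> * cnj \<zeta> ^ n = (bv f \<zeta> - bv g \<zeta>) * cnj \<zeta> ^ n" using ae by eventually_elim simp
    qed (intro borel_measurable_times borel_measurable_diff bv_measurable hardy2_hol h f continuous_imp_measurable_circle continuous_intros)+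
    then show ?thesis by (simp add: fcoeff_diff sq_integrable_imp_integrable hardy2_bv f)
  qed
  ultimately have "tcoeff f n = tcoeff g n" for n using hardy2_fcoeff f by (metis right_minus_eq)
  then show ?thesis by (simp add: hardy2_hsum f hsum_def)
qed

section \<open>Two-weight estimates\<close>

text \<open>An extended integral, so that a finite bound on it includes the existence of the
  weighted norm.\<close>

definition two_weight_form :: "(complex \<Rightarrow> complex) \<Rightarrow> (complex \<Rightarrow> complex) \<Rightarrow> (complex \<Rightarrow> complex) \<Rightarrow> ennreal" where
  "two_weight_form u v F =
     (\<integral>\<^sup>+\<zeta>. ennreal ((cmod (bv (riesz_proj (\<lambda>\<zeta>. cnj (bv v \<zeta>) * F \<zeta>)) \<zeta>))\<^sup>2 * (cmod (bv u \<zeta>))\<^sup>2) \<partial>mT)"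

text \<open>Boundedness keeps \<open>cnj v F\<close> square-integrable, so that its projection lies
  in H2.\<close>

definition circle_bounded :: "(complex \<Rightarrow> complex) \<Rightarrow> bool" where
  "circle_bounded F \<longleftrightarrow> F \<in> borel_measurable mT \<and> (\<exists>K. \<forall>\<zeta>\<in>unit_circle. cmod (F \<zeta>) \<le> K)"

lemma circle_bounded_sq_integrable:
  assumes "circle_bounded F"
  shows "sq_integrable F"
proof -
  obtain K where K: "F \<in> borel_measurable mT" "\<And>\<zeta>. \<zeta> \<in> unit_circle \<Longrightarrow> cmod (F \<zeta>) \<le> K"
    using assms unfolding circle_bounded_def by blast
  show ?thesis by (rule sq_integrable_bounded[OF K(1), of K]) (use K(2) in \<open>auto intro!: AE_I2\<close>)
qed

lemma circle_bounded_times_bv: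
  assumes "circle_bounded F" "v \<in> hardy 2"
  shows "sq_integrable (\<lambda>\<zeta>. cnj (bv v \<zeta>) * F \<zeta>)"
proof -
  obtain K where K: "F \<in> borel_measurable mT" "\<And>\<zeta>. \<zeta> \<in> unit_circle \<Longrightarrow> cmod (F \<zeta>) \<le> K"
    using assms(1) unfolding circle_bounded_def by blast
  have "sq_integrable (\<lambda>\<zeta>. F \<zeta> * cnj (bv v \<zeta>))"
    using K by (intro sq_integrable_cmult(1)[where K=K] sq_integrable_cnj hardy2_bv assms(2) AE_I2) auto
  then show ?thesis by (simp add: mult.commute)
qed

lemma circle_bounded_continuous:
  assumes "continuous_on unit_circle F"
  shows "circle_bounded F"
proof -
  have "bounded (F ` unit_circle)"
    using assms by (intro compact_imp_bounded compact_continuous_image) auto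
  then have "\<exists>K. \<forall>\<zeta>\<in>unit_circle. cmod (F \<zeta>) \<le> K" unfolding bounded_iff by blast
  then show ?thesis using assms by (auto simp: circle_bounded_def)
qed

section \<open>The rank-one operators attached to disc automorphisms\<close>

definition disc_aut :: "complex \<Rightarrow> complex \<Rightarrow> complex" where
  "disc_aut w z = (z - w) / (1 - cnj w * z)"

lemma disc_aut_unit:
  assumes "\<zeta> \<in> unit_circle" "cmod w < 1"
  shows "cmod (disc_aut w \<zeta>) = 1"
proof -
  have "cmod (1 - cnj w * \<zeta>) = cmod (cnj (1 - cnj w * \<zeta>))" by (simp only: complex_mod_cnj)
  also have "cnj (1 - cnj w * \<zeta>) = 1 - w * cnj \<zeta>" by simp
  finally have "cmod (1 - cnj w * \<zeta>) = cmod (\<zeta> - w)" by (simp only: cmod_one_minus_eq[OF assms(1)])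
  then show ?thesis using circle_dist_pos[OF assms] by (simp add: disc_aut_def norm_divide)
qed

text \<open>The numerator factors as \<open>(1 - w * cnj w) * (1 - cnj \<zeta> * z)\<close>, so the
  Cauchy denominator cancels and the kernel splits into a function of \<open>z\<close> times a
  function of \<open>\<zeta>\<close>. This is the source of rank one.\<close>

lemma disc_aut_kernel_identity:
  assumes "\<zeta> \<in> unit_circle" "cmod w < 1" "cmod z < 1"
  shows "(1 - disc_aut w z * cnj (disc_aut w \<zeta>)) / (1 - cnj \<zeta> * z) = (1 - (cmod w)\<^sup>2) / ((1 - cnj w * z) * (1 - w * cnj \<zeta>))"
proof -
  have ne: "1 - cnj w * z \<noteq> 0" "1 - w * cnj \<zeta> \<noteq> 0" "1 - cnj \<zeta> * z \<noteq> 0"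
    using disc_kernel_bound(2)[OF assms(2,3)] one_minus_ne[OF assms(2,1)] one_minus_ne[OF assms(3,1)]
    by (auto simp: mult.commute)
  have c: "cnj (disc_aut w \<zeta>) = (cnj \<zeta> - cnj w) / (1 - w * cnj \<zeta>)" by (simp add: disc_aut_def)
  have aux: "1 - x / a * (y / b) = (a * b - x * y) / (a * b)" if "a \<noteq> 0" "b \<noteq> 0" for x y a b :: complex
    using that by (simp add: field_simps)
  have "1 - disc_aut w z * cnj (disc_aut w \<zeta>) =
     ((1 - cnj w * z) * (1 - w * cnj \<zeta>) - (z - w) * (cnj \<zeta> - cnj w)) / ((1 - cnj w * z) * (1 - w * cnj \<zeta>))"
    unfolding c unfolding disc_aut_def by (rule aux[OF ne(1,2)])
  also have "(1 - cnj w * z) * (1 - w * cnj \<zeta>) - (z - w) * (cnj \<zeta> - cnj w) = (1 - w * cnj w) * (1 - cnj \<zeta> * z)"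
    by (simp add: algebra_simps)
  finally show ?thesis using ne(3) by (simp add: complex_norm_square del: of_real_power)
qed

text \<open>The conjugated operator multiplies by the automorphism outside the projection and by its
  complex conjugate inside; the difference therefore has the split kernel of
  \<open>disc_aut_kernel_identity\<close>.\<close>

lemma rank_one_identity:
  assumes v: "v \<in> hardy 2" and w: "cmod w < 1" and z: "cmod z < 1" and f: "continuous_on unit_circle f"
  shows "riesz_proj (\<lambda>\<zeta>. cnj (bv v \<zeta>) * f \<zeta>) z - disc_aut w z * riesz_proj (\<lambda>\<zeta>. cnj (bv v \<zeta>) * (cnj (disc_aut w \<zeta>) * f \<zeta>)) z
     = (1 - (cmod w)\<^sup>2) / (1 - cnj w * z) * (LINT \<zeta>|mT. f \<zeta> * cnj (bv v \<zeta> / (1 - cnj w * \<zeta>)))"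
proof -
  have m: "continuous_on unit_circle (\<lambda>\<zeta>. cnj (disc_aut w \<zeta>) * f \<zeta>)"
  proof -
    have "1 - cnj w * \<zeta> \<noteq> 0" if "\<zeta> \<in> unit_circle" for \<zeta>
      using one_minus_ne[of "cnj w" "cnj \<zeta>"] that w by simp
    then show ?thesis unfolding disc_aut_def by (intro continuous_intros f) auto
  qed
  note i1 = riesz_proj_integrable[OF conj_toeplitz_integrable[OF v sq_integrable_continuous[OF f]] z]
  note i2 = riesz_proj_integrable[OF conj_toeplitz_integrable[OF v sq_integrable_continuous[OF m]] z]
  have "riesz_proj (\<lambda>\<zeta>. cnj (bv v \<zeta>) * f \<zeta>) z - disc_aut w z * riesz_proj (\<lambda>\<zeta>. cnj (bv v \<zeta>) * (cnj (disc_aut w \<zeta>) * f \<zeta>)) z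
    = (LINT \<zeta>|mT. cnj (bv v \<zeta>) * f \<zeta> / (1 - cnj \<zeta> * z) - disc_aut w z * (cnj (bv v \<zeta>) * (cnj (disc_aut w \<zeta>) * f \<zeta>) / (1 - cnj \<zeta> * z)))"
    unfolding riesz_proj_def integral_mult_right_zero[symmetric]
    by (rule Bochner_Integration.integral_diff[OF i1 integrable_mult_right[OF i2], symmetric])
  also have "\<dots> = (LINT \<zeta>|mT. (1 - (cmod w)\<^sup>2) / (1 - cnj w * z) * (f \<zeta> * cnj (bv v \<zeta> / (1 - cnj w * \<zeta>))))"
  proof (intro Bochner_Integration.integral_cong refl)
    fix \<zeta> assume "\<zeta> \<in> space mT"
    then have \<zeta>: "\<zeta> \<in> unit_circle" by simp
    have "cnj (bv v \<zeta>) * f \<zeta> / (1 - cnj \<zeta> * z) - disc_aut w z * (cnj (bv v \<zeta>) * (cnj (disc_aut w \<zeta>) * f \<zeta>) / (1 - cnj \<zeta> * z))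
      = cnj (bv v \<zeta>) * f \<zeta> * ((1 - disc_aut w z * cnj (disc_aut w \<zeta>)) / (1 - cnj \<zeta> * z))"
      by (simp add: algebra_simps diff_divide_distrib)
    also have "\<dots> = (1 - (cmod w)\<^sup>2) / (1 - cnj w * z) * (f \<zeta> * cnj (bv v \<zeta> / (1 - cnj w * \<zeta>)))"
      unfolding disc_aut_kernel_identity[OF \<zeta> w z] by simp
    finally show "cnj (bv v \<zeta>) * f \<zeta> / (1 - cnj \<zeta> * z) - disc_aut w z * (cnj (bv v \<zeta>) * (cnj (disc_aut w \<zeta>) * f \<zeta>) / (1 - cnj \<zeta> * z))
      = (1 - (cmod w)\<^sup>2) / (1 - cnj w * z) * (f \<zeta> * cnj (bv v \<zeta> / (1 - cnj w * \<zeta>)))" .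
  qed
  finally show ?thesis by (simp only: integral_mult_right_zero)
qed

text \<open>The rank-one operator obtained by conjugating the Toeplitz product with a disc automorphism is
  tested on polynomials, for which every Riesz projection that occurs lies in \<open>H\<^sup>2\<close>.\<close>

lemma two_weight_imp_poisson:
  assumes u: "u \<in> hardy 2" and v: "v \<in> hardy 2" and C: "0 \<le> C"
    and bound: "\<And>F. circle_bounded F \<Longrightarrow> two_weight_form u v F \<le> ennreal (C * sqn F)"
    and w: "cmod w < 1"
  shows "poisson (\<lambda>\<zeta>. (cmod (bv u \<zeta>))\<^sup>2) w * poisson (\<lambda>\<zeta>. (cmod (bv v \<zeta>))\<^sup>2) w \<le> 4 * C"
proof -
  let ?g = "\<lambda>z. v z / (1 - cnj w * z)"
  note g = hardy2_times_kernel[OF v w]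
  define W where "W = 1 - (cmod w)\<^sup>2"
  have W: "W > 0" using w by (simp add: W_def power_less_one_iff abs_square_less_1)
  define pu where "pu = poisson (\<lambda>\<zeta>. (cmod (bv u \<zeta>))\<^sup>2) w"
  have ker: "W / (cmod (\<zeta> - w))\<^sup>2 = W * (cmod (1 / (1 - cnj w * \<zeta>)))\<^sup>2" if "\<zeta> \<in> unit_circle" for \<zeta>
  proof -
    have "cmod (1 - cnj w * \<zeta>) = cmod (cnj (1 - cnj w * \<zeta>))" by (simp only: complex_mod_cnj)
    also have "cnj (1 - cnj w * \<zeta>) = 1 - w * cnj \<zeta>" by simp
    finally show ?thesis by (simp add: cmod_one_minus_eq[OF that] norm_divide power_divide)
  qed
  have pu0: "pu \<ge> 0"
    unfolding pu_def poisson_def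
    by (rule Bochner_Integration.integral_nonneg) (rule mult_nonneg_nonneg[OF poisson_kernel_nonneg[OF w]], simp)
  have pv: "poisson (\<lambda>\<zeta>. (cmod (bv v \<zeta>))\<^sup>2) w = W * sqn (bv ?g)"
  proof -
    have "W * sqn (bv ?g) = W * sqn (\<lambda>\<zeta>. bv v \<zeta> / (1 - cnj w * \<zeta>))"
    proof (intro arg_cong2[where f="(*)"] refl sqn_AE_cong g(2) bv_measurable hardy2_hol g(1))
      have "continuous_on unit_circle (\<lambda>\<zeta>. 1 - cnj w * \<zeta>)" by (intro continuous_intros)
      then show "(\<lambda>\<zeta>. bv v \<zeta> / (1 - cnj w * \<zeta>)) \<in> borel_measurable mT"
        by (intro borel_measurable_divide continuous_imp_measurable_circle bv_measurable hardy2_hol v)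
    qed
    also have "\<dots> = (LINT \<zeta>|mT. W * (cmod (bv v \<zeta> / (1 - cnj w * \<zeta>)))\<^sup>2)"
      by (simp add: sqn_def)
    also have "\<dots> = poisson (\<lambda>\<zeta>. (cmod (bv v \<zeta>))\<^sup>2) w"
      unfolding poisson_def W_def[symmetric]
      by (intro Bochner_Integration.integral_cong refl) (simp add: ker norm_divide power_divide)
    finally show ?thesis by simp
  qed
  \<comment> \<open>Squared norms of the Taylor sections of \<open>?g\<close>. The extremal argument
    of the rank-one operator is the boundary function of \<open>?g\<close>; its sections approach it
    and are bounded.\<close>
  define S where "S N = (\<Sum>n<N. (cmod (tcoeff ?g n))\<^sup>2)" for N
  have main: "W * S N * pu \<le> 4 * C" for N
  proof -
    have S0: "S N \<ge> 0" by (simp add: S_def sum_nonneg)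
    define f where "f \<zeta> = (\<Sum>n<N. tcoeff ?g n * \<zeta> ^ n)" for \<zeta>
    have fc: "continuous_on unit_circle f" unfolding f_def by (intro continuous_intros)
    have fs: "sqn f = S N" unfolding f_def S_def by (rule sqn_sum)
    \<comment> \<open>The extra factor has modulus 1 on the circle, so the hypothesis applies to
      \<open>f'\<close> with the same right-hand side.\<close>
    define f' where "f' \<zeta> = cnj (disc_aut w \<zeta>) * f \<zeta>" for \<zeta>
    have fc': "continuous_on unit_circle f'"
    proof -
      have "1 - cnj w * \<zeta> \<noteq> 0" if "\<zeta> \<in> unit_circle" for \<zeta>
        using one_minus_ne[of "cnj w" "cnj \<zeta>"] that w by simp
      then show ?thesis unfolding f'_def disc_aut_def by (intro continuous_intros fc) auto
    qed
    have fs': "sqn f' = S N"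
      unfolding fs[symmetric] by (rule sqn_cong) (simp add: f'_def norm_mult disc_aut_unit[OF _ w])
    define P where "P = riesz_proj (\<lambda>\<zeta>. cnj (bv v \<zeta>) * f \<zeta>)"
    define P' where "P' = riesz_proj (\<lambda>\<zeta>. cnj (bv v \<zeta>) * f' \<zeta>)"
    have hP: "P \<in> hardy 2" "P' \<in> hardy 2"
      unfolding P_def P'_def
      by (intro riesz_proj_hardy2 circle_bounded_times_bv circle_bounded_continuous fc fc' v)+
    have pairing: "(LINT \<zeta>|mT. f \<zeta> * cnj (bv v \<zeta> / (1 - cnj w * \<zeta>))) = of_real (S N)"
    proof -
      have "(LINT \<zeta>|mT. f \<zeta> * cnj (bv v \<zeta> / (1 - cnj w * \<zeta>))) = (LINT \<zeta>|mT. cnj (bv ?g \<zeta> * cnj (f \<zeta>)))"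
      proof (rule integral_cong_AE)
        have [measurable]: "f \<in> borel_measurable mT" "bv ?g \<in> borel_measurable mT" "bv v \<in> borel_measurable mT"
          using fc by (auto intro: bv_measurable hardy2_hol g(1) v)
        show "(\<lambda>\<zeta>. f \<zeta> * cnj (bv v \<zeta> / (1 - cnj w * \<zeta>))) \<in> borel_measurable mT"
          "(\<lambda>\<zeta>. cnj (bv ?g \<zeta> * cnj (f \<zeta>))) \<in> borel_measurable mT" by measurable
        show "AE \<zeta> in mT. f \<zeta> * cnj (bv v \<zeta> / (1 - cnj w * \<zeta>)) = cnj (bv ?g \<zeta> * cnj (f \<zeta>))"
          using g(2) by eventually_elim simp
      qed
      also have "\<dots> = cnj (LINT \<zeta>|mT. bv ?g \<zeta> * cnj (f \<zeta>))" by (rule Bochner_Integration.integral_cnj)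
      also have "(LINT \<zeta>|mT. bv ?g \<zeta> * cnj (f \<zeta>)) = (\<Sum>n<N. cnj (tcoeff ?g n) * fcoeff (bv ?g) n)"
        unfolding f_def by (intro integral_times_cnj_sum sq_integrable_imp_integrable hardy2_bv g(1))
      also have "\<dots> = of_real (S N)"
        unfolding hardy2_fcoeff[OF g(1)] S_def by (simp add: complex_norm_square mult.commute del: of_real_power)
      finally show ?thesis by simp
    qed
    have id: "P z - disc_aut w z * P' z = of_real (W * S N) * (1 / (1 - cnj w * z))" if "cmod z < 1" for z
      using rank_one_identity[OF v w that fc] unfolding P_def P'_def f'_def pairing
      by (simp add: W_def)
    have ae: "AE \<zeta> in mT. bv P \<zeta> - disc_aut w \<zeta> * bv P' \<zeta> = of_real (W * S N) * (1 / (1 - cnj w * \<zeta>))"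
      using hardy2_radial_limit[OF hP(1)] hardy2_radial_limit[OF hP(2)] AE_space
    proof eventually_elim
      case (elim \<zeta>)
      then have \<zeta>: "\<zeta> \<in> unit_circle" by simp
      have ne: "1 - cnj w * \<zeta> \<noteq> 0"
        using one_minus_ne[of "cnj w" "cnj \<zeta>"] \<zeta> w by simp
      have "isCont (disc_aut w) \<zeta>" unfolding disc_aut_def using ne by (intro continuous_intros)
      from has_radial_limit_diff[OF elim(1) has_radial_limit_mult[OF has_radial_limit_isCont[OF this] elim(2)]]
      have "has_radial_limit (\<lambda>z. P z - disc_aut w z * P' z) \<zeta> (bv P \<zeta> - disc_aut w \<zeta> * bv P' \<zeta>)" .
      then have "has_radial_limit (\<lambda>z. of_real (W * S N) * (1 / (1 - cnj w * z))) \<zeta> (bv P \<zeta> - disc_aut w \<zeta> * bv P' \<zeta>)"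
        by (rule has_radial_limit_cong[OF _ \<zeta> id])
      moreover have "isCont (\<lambda>z. of_real (W * S N) * (1 / (1 - cnj w * z))) \<zeta>"
        using ne by (intro continuous_intros)
      then have "has_radial_limit (\<lambda>z. of_real (W * S N) * (1 / (1 - cnj w * z))) \<zeta> (of_real (W * S N) * (1 / (1 - cnj w * \<zeta>)))"
        by (rule has_radial_limit_isCont)
      ultimately show ?case using bv_eqI by metis
    qed
    \<comment> \<open>The rank-one term is a difference of the two projections up to a unimodular
      factor, and squaring it costs the factor 2.\<close>
    have le: "AE \<zeta> in mT. ennreal (W * (S N)\<^sup>2 * (W / (cmod (\<zeta> - w))\<^sup>2 * (cmod (bv u \<zeta>))\<^sup>2)) \<le>
        2 * ennreal ((cmod (bv P \<zeta>))\<^sup>2 * (cmod (bv u \<zeta>))\<^sup>2) + 2 * ennreal ((cmod (bv P' \<zeta>))\<^sup>2 * (cmod (bv u \<zeta>))\<^sup>2)"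
      using ae AE_space
    proof eventually_elim
      case (elim \<zeta>)
      then have \<zeta>: "\<zeta> \<in> unit_circle" by simp
      have "W * (S N)\<^sup>2 * (W / (cmod (\<zeta> - w))\<^sup>2) = (cmod (bv P \<zeta> - disc_aut w \<zeta> * bv P' \<zeta>))\<^sup>2"
        unfolding elim(1) ker[OF \<zeta>] norm_mult norm_of_real power_mult_distrib power2_abs by (simp add: power2_eq_square)
      also have "\<dots> \<le> 2 * (cmod (bv P \<zeta>))\<^sup>2 + 2 * (cmod (bv P' \<zeta>))\<^sup>2"
        using cmod_add_squared[of "bv P \<zeta>" "- (disc_aut w \<zeta> * bv P' \<zeta>)"] by (simp add: norm_mult disc_aut_unit[OF \<zeta> w])
      finally have "W * (S N)\<^sup>2 * (W / (cmod (\<zeta> - w))\<^sup>2) * (cmod (bv u \<zeta>))\<^sup>2 \<le> (2 * (cmod (bv P \<zeta>))\<^sup>2 + 2 * (cmod (bv P' \<zeta>))\<^sup>2) * (cmod (bv u \<zeta>))\<^sup>2"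
        by (rule mult_right_mono) simp
      then have "ennreal (W * (S N)\<^sup>2 * (W / (cmod (\<zeta> - w))\<^sup>2 * (cmod (bv u \<zeta>))\<^sup>2)) \<le>
          ennreal (2 * ((cmod (bv P \<zeta>))\<^sup>2 * (cmod (bv u \<zeta>))\<^sup>2) + 2 * ((cmod (bv P' \<zeta>))\<^sup>2 * (cmod (bv u \<zeta>))\<^sup>2))"
        by (intro ennreal_leI) (simp add: algebra_simps)
      then show ?case by (simp add: ennreal_plus ennreal_mult')
    qed
    have [measurable]: "bv P \<in> borel_measurable mT" "bv P' \<in> borel_measurable mT" "bv u \<in> borel_measurable mT"
      by (intro bv_measurable hardy2_hol hP u)+
    have ip: "integrable mT (\<lambda>\<zeta>. W / (cmod (\<zeta> - w))\<^sup>2 * (cmod (bv u \<zeta>))\<^sup>2)"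
      unfolding W_def by (rule poisson_integrable[OF hardy2_bv(1)[OF u] w])
    have "ennreal (W * (S N)\<^sup>2 * pu) = (\<integral>\<^sup>+\<zeta>. ennreal (W * (S N)\<^sup>2 * (W / (cmod (\<zeta> - w))\<^sup>2 * (cmod (bv u \<zeta>))\<^sup>2)) \<partial>mT)"
    proof -
      have "(LINT \<zeta>|mT. W * (S N)\<^sup>2 * (W / (cmod (\<zeta> - w))\<^sup>2 * (cmod (bv u \<zeta>))\<^sup>2)) = W * (S N)\<^sup>2 * pu"
        by (simp only: integral_mult_right_zero pu_def poisson_def W_def)
      then show ?thesis
        using W by (subst nn_integral_eq_integral[OF integrable_mult_right[OF ip]]) (auto intro!: AE_I2)
    qed
    also have "\<dots> \<le> (\<integral>\<^sup>+\<zeta>. (2 * ennreal ((cmod (bv P \<zeta>))\<^sup>2 * (cmod (bv u \<zeta>))\<^sup>2) + 2 * ennreal ((cmod (bv P' \<zeta>))\<^sup>2 * (cmod (bv u \<zeta>))\<^sup>2)) \<partial>mT)"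
      by (rule nn_integral_mono_AE[OF le])
    also have "\<dots> = 2 * two_weight_form u v f + 2 * two_weight_form u v f'"
      unfolding two_weight_form_def P_def[symmetric] P'_def[symmetric]
      by (subst nn_integral_add) (auto simp: nn_integral_cmult)
    also have "\<dots> \<le> 2 * ennreal (C * S N) + 2 * ennreal (C * S N)"
      using bound[OF circle_bounded_continuous[OF fc]] bound[OF circle_bounded_continuous[OF fc']]
      by (intro add_mono mult_left_mono) (auto simp: fs fs')
    also have "\<dots> = ennreal (4 * C * S N)"
    proof -
      have "2 * ennreal (C * S N) + 2 * ennreal (C * S N) = (2 + 2) * ennreal (C * S N)"
        by (rule distrib_right[symmetric])
      also have "\<dots> = ennreal 4 * ennreal (C * S N)" by simp
      also have "\<dots> = ennreal (4 * (C * S N))" using C S0 by (intro ennreal_mult[symmetric]) auto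
      finally show ?thesis by (simp add: mult.assoc)
    qed
    finally have "W * (S N)\<^sup>2 * pu \<le> 4 * C * S N"
      using C S0 by (subst (asm) ennreal_le_iff) auto
    \<comment> \<open>The left side is quadratic in \<open>S N\<close> and the right side linear, so
      one factor cancels; for \<open>S N = 0\<close> the claim is trivial.\<close>
    then have "S N * (W * S N * pu) \<le> S N * (4 * C)" by (simp add: power2_eq_square mult_ac)
    then show ?thesis
      using S0 C by (cases "S N = 0") (auto simp: mult_le_cancel_left)
  qed
  have "S \<longlonglongrightarrow> sqn (bv ?g)"
    unfolding S_def hardy2_hsum[OF g(1)] hsum_def
    by (rule summable_LIMSEQ[OF hardy2D(1)[OF g(1)]])
  then have "(\<lambda>N. W * S N * pu) \<longlonglongrightarrow> W * sqn (bv ?g) * pu" by (intro tendsto_intros)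
  then have "W * sqn (bv ?g) * pu \<le> 4 * C"
    by (rule tendsto_upperbound) (use main in auto)
  then show ?thesis unfolding pv pu_def by (simp add: mult.commute)
qed

section \<open>Necessity: from (d) to (c), and from (a), (b) and (e) to the two-weight bound\<close>

lemma Linfty_on_iff:
  assumes "f \<in> borel_measurable mT" "E \<inter> unit_circle \<in> sets mT"
  shows "f \<in> Linfty_on E \<longleftrightarrow> (\<exists>M. AE \<zeta> in mT. \<zeta> \<in> E \<longrightarrow> cmod (f \<zeta>) \<le> M)"
proof -
  have "(\<lambda>\<zeta>. indicator (E \<inter> unit_circle) \<zeta> *\<^sub>R f \<zeta>) \<in> borel_measurable mT"
    using assms by (intro borel_measurable_scaleR borel_measurable_indicator) auto
  then have "(\<lambda>\<zeta>. indicator E \<zeta> *\<^sub>R f \<zeta>) \<in> borel_measurable mT"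
    by (rule measurable_cong[THEN iffD1, rotated]) (auto simp: indicator_def)
  then show ?thesis by (simp add: Linfty_on_def set_borel_measurable_def)
qed

lemma Linfty_on_circle_iff:
  assumes "f \<in> borel_measurable mT"
  shows "f \<in> Linfty_on unit_circle \<longleftrightarrow> (\<exists>M. AE \<zeta> in mT. cmod (f \<zeta>) \<le> M)"
proof -
  have "unit_circle \<inter> unit_circle \<in> sets mT" using sets.top[of mT] by simp
  moreover have "(AE \<zeta> in mT. \<zeta> \<in> unit_circle \<longrightarrow> cmod (f \<zeta>) \<le> M) \<longleftrightarrow> (AE \<zeta> in mT. cmod (f \<zeta>) \<le> M)" for M
    by (intro AE_cong) simp
  ultimately show ?thesis using Linfty_on_iff[OF assms] by simp
qed

lemma poisson_imp_Linfty:
  assumes u: "u \<in> hardy 2" and v: "v \<in> hardy 2"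
    and bound: "\<And>w. cmod w < 1 \<Longrightarrow> poisson (\<lambda>\<zeta>. (cmod (bv u \<zeta>))\<^sup>2) w * poisson (\<lambda>\<zeta>. (cmod (bv v \<zeta>))\<^sup>2) w \<le> K"
  shows "AE \<zeta> in mT. cmod (bv u \<zeta> * bv v \<zeta>) \<le> sqrt K"
  using hardy2_radial_limit[OF u] hardy2_radial_limit[OF v] AE_space
proof eventually_elim
  case (elim \<zeta>)
  have disc: "cmod (u z * v z) \<le> sqrt K" if z: "cmod z < 1" for z
  proof -
    have "(cmod (u z * v z))\<^sup>2 = (cmod (u z))\<^sup>2 * (cmod (v z))\<^sup>2"
      by (simp add: norm_mult power_mult_distrib)
    also have "\<dots> \<le> poisson (\<lambda>\<zeta>. (cmod (bv u \<zeta>))\<^sup>2) z * poisson (\<lambda>\<zeta>. (cmod (bv v \<zeta>))\<^sup>2) z"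
      using hardy2_poisson_square[OF u z] hardy2_poisson_square[OF v z]
      by (intro mult_mono) (auto intro: order_trans[OF zero_le_power2])
    also have "\<dots> \<le> K" by (rule bound[OF z])
    finally show ?thesis by (rule real_le_rsqrt)
  qed
  show ?case
    by (rule has_radial_limit_norm_le[OF has_radial_limit_mult[OF elim(1,2)] _ disc]) (use elim in simp)
qed

lemma toeplitz_bounded_imp_two_weight:
  assumes u: "u \<in> hardy 2" and v: "v \<in> hardy 2"
    and b: "hardy2_bounded (toeplitz_product u (bv v))"
  shows "\<exists>C\<ge>0. \<forall>F. circle_bounded F \<longrightarrow> two_weight_form u v F \<le> ennreal (C * sqn F)"
proof -
  obtain C where C: "C > 0" and mem: "\<And>f. f \<in> hardy 2 \<Longrightarrow> toeplitz_product u (bv v) f \<in> hardy 2"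
    and le: "\<And>f. f \<in> hardy 2 \<Longrightarrow> hardy2_norm (toeplitz_product u (bv v) f) \<le> C * hardy2_norm f"
    using b unfolding hardy2_bounded_def by blast
  have "two_weight_form u v F \<le> ennreal (C\<^sup>2 * sqn F)" if F: "circle_bounded F" for F
  proof -
    \<comment> \<open>Passing from \<open>F\<close> to its projection leaves the Toeplitz image
      unchanged by \<open>conj_toeplitz_riesz_proj\<close> and does not increase the norm.\<close>
    define f where "f = riesz_proj F"
    have Fs: "sq_integrable F" by (rule circle_bounded_sq_integrable[OF F])
    have f: "f \<in> hardy 2" unfolding f_def by (rule riesz_proj_hardy2(1)[OF Fs])
    define G where "G = riesz_proj (\<lambda>\<zeta>. cnj (bv v \<zeta>) * F \<zeta>)"
    have G: "G \<in> hardy 2" unfolding G_def by (intro riesz_proj_hardy2 circle_bounded_times_bv F v)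
    let ?A = "toeplitz_product u (bv v) f"
    have A: "?A z = u z * G z" if "cmod z < 1" for z
      unfolding toeplitz_product_def f_def G_def conj_toeplitz_riesz_proj[OF v Fs that] ..
    have "two_weight_form u v F = (\<integral>\<^sup>+\<zeta>. ennreal ((cmod (bv ?A \<zeta>))\<^sup>2) \<partial>mT)"
      unfolding two_weight_form_def G_def[symmetric]
    proof (rule nn_integral_cong_AE)
      show "AE \<zeta> in mT. ennreal ((cmod (bv G \<zeta>))\<^sup>2 * (cmod (bv u \<zeta>))\<^sup>2) = ennreal ((cmod (bv ?A \<zeta>))\<^sup>2)"
        using hardy2_radial_limit[OF u] hardy2_radial_limit[OF G] AE_space
      proof eventually_elim
        case (elim \<zeta>)
        have "bv ?A \<zeta> = bv (\<lambda>z. u z * G z) \<zeta>" using elim by (intro bv_cong A) simp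
        also have "\<dots> = bv u \<zeta> * bv G \<zeta>" using elim by (intro bv_eqI has_radial_limit_mult)
        finally show ?case by (simp add: norm_mult power_mult_distrib mult.commute)
      qed
    qed
    also have "\<dots> = ennreal (sqn (bv ?A))" by (intro sqn_nn hardy2_bv mem f)
    also have "\<dots> \<le> ennreal (C\<^sup>2 * sqn F)"
    proof (rule ennreal_leI)
      have "sqrt (sqn (bv ?A)) \<le> C * sqrt (sqn (bv f))"
        using le[OF f] by (simp add: hardy2_norm_sqn)
      then have "(sqrt (sqn (bv ?A)))\<^sup>2 \<le> (C * sqrt (sqn (bv f)))\<^sup>2" by (rule power_mono) simp
      then have "sqn (bv ?A) \<le> C\<^sup>2 * sqn (bv f)" by (simp add: power_mult_distrib)
      also have "\<dots> \<le> C\<^sup>2 * sqn F"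
        unfolding f_def by (intro mult_left_mono riesz_proj_contraction Fs) simp
      finally show "sqn (bv ?A) \<le> C\<^sup>2 * sqn F" .
    qed
    finally show ?thesis .
  qed
  then show ?thesis by (intro exI[of _ "C\<^sup>2"]) auto
qed

lemma riesz_bounded_imp_two_weight:
  assumes u: "u \<in> hardy 2" and v: "v \<in> hardy 2"
    and b: "riesz_proj_bounded (\<lambda>\<zeta>. 1 / (cmod (bv v \<zeta>))\<^sup>2) (\<lambda>\<zeta>. (cmod (bv u \<zeta>))\<^sup>2)"
  shows "\<exists>C\<ge>0. \<forall>F. circle_bounded F \<longrightarrow> two_weight_form u v F \<le> ennreal (C * sqn F)"
proof -
  obtain C where C: "C > 0" and le: "\<And>g. g \<in> weighted_L2 (\<lambda>\<zeta>. 1 / (cmod (bv v \<zeta>))\<^sup>2) \<Longrightarrow>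
     (\<integral>\<^sup>+\<zeta>. ennreal ((cmod (bv (riesz_proj g) \<zeta>))\<^sup>2 * (cmod (bv u \<zeta>))\<^sup>2) \<partial>mT)
       \<le> ennreal C * (\<integral>\<^sup>+\<zeta>. ennreal ((cmod (g \<zeta>))\<^sup>2 * (1 / (cmod (bv v \<zeta>))\<^sup>2)) \<partial>mT)"
    using b unfolding riesz_proj_bounded_def by blast
  have "two_weight_form u v F \<le> ennreal (C * sqn F)" if F: "circle_bounded F" for F
  proof -
    let ?g = "\<lambda>\<zeta>. cnj (bv v \<zeta>) * F \<zeta>"
    have Fs: "sq_integrable F" by (rule circle_bounded_sq_integrable[OF F])
    \<comment> \<open>Where \<open>bv v\<close> is 0 the weight is \<open>1 / 0 = 0\<close>, so the
      integrand is at most that of \<open>F\<close> at every point.\<close>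
    have w: "(\<integral>\<^sup>+\<zeta>. ennreal ((cmod (?g \<zeta>))\<^sup>2 * (1 / (cmod (bv v \<zeta>))\<^sup>2)) \<partial>mT) \<le> ennreal (sqn F)"
    proof -
      have "(\<integral>\<^sup>+\<zeta>. ennreal ((cmod (?g \<zeta>))\<^sup>2 * (1 / (cmod (bv v \<zeta>))\<^sup>2)) \<partial>mT) \<le> (\<integral>\<^sup>+\<zeta>. ennreal ((cmod (F \<zeta>))\<^sup>2) \<partial>mT)"
        by (intro nn_integral_mono ennreal_leI) (auto simp: norm_mult power_mult_distrib)
      then show ?thesis by (simp add: sqn_nn[OF Fs])
    qed
    have "?g \<in> weighted_L2 (\<lambda>\<zeta>. 1 / (cmod (bv v \<zeta>))\<^sup>2)"
      unfolding weighted_L2_def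
      using sq_integrableD(1)[OF circle_bounded_times_bv[OF F v]] le_less_trans[OF w ennreal_less_top] by simp
    from le[OF this] have "two_weight_form u v F \<le> ennreal C * (\<integral>\<^sup>+\<zeta>. ennreal ((cmod (?g \<zeta>))\<^sup>2 * (1 / (cmod (bv v \<zeta>))\<^sup>2)) \<partial>mT)"
      unfolding two_weight_form_def .
    also have "\<dots> \<le> ennreal C * ennreal (sqn F)" by (rule mult_left_mono[OF w]) simp
    finally show ?thesis using C by (simp add: ennreal_mult)
  qed
  then show ?thesis using C by (intro exI[of _ C]) auto
qed

section \<open>The Carleson condition as a weighted integral over the circle\<close>

lemma closed_disc_ext_measurable:
  assumes "f holomorphic_on unit_disc"
  shows "closed_disc_ext f \<in> borel_measurable (restrict_space borel (cball 0 1))"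
proof -
  let ?M = "restrict_space borel (cball 0 1) :: complex measure"
  have 1: "restrict_space ?M {z. cmod z < 1} = restrict_space borel unit_disc"
  proof -
    have "cball 0 1 \<inter> {z. cmod z < 1} = (unit_disc :: complex set)" by auto
    then show ?thesis by (simp add: restrict_restrict_space)
  qed
  have 2: "restrict_space ?M {z. \<not> cmod z < 1} = restrict_space borel unit_circle"
  proof -
    have "cball 0 1 \<inter> {z. \<not> cmod z < 1} = (unit_circle :: complex set)" by auto
    moreover have "{z. \<not> cmod z < 1} \<in> sets (borel :: complex measure)" by measurable
    ultimately show ?thesis by (subst restrict_restrict_space) auto
  qed
  have S: "{z \<in> space ?M. cmod z < 1} \<in> sets ?M"
  proof -
    have "{z \<in> space ?M. cmod z < 1} = unit_disc" by (auto simp: space_restrict_space)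
    then show ?thesis by (auto simp: sets_restrict_space_iff)
  qed
  have "f \<in> borel_measurable (restrict_space ?M {z. cmod z < 1})"
    unfolding 1 by (intro borel_measurable_continuous_on_restrict holomorphic_on_imp_continuous_on assms)
  moreover have "bv f \<in> borel_measurable (restrict_space ?M {z. \<not> cmod z < 1})"
    unfolding 2 using bv_measurable[OF assms] by (simp add: measurable_cong_sets[OF sets_circle refl])
  ultimately have "(\<lambda>z. if cmod z < 1 then f z else bv f z) \<in> borel_measurable ?M"
    by (subst measurable_If_restrict_space_iff[OF S]) simp
  then show ?thesis by (simp add: closed_disc_ext_def[abs_def])
qed

lemma boundary_measure_integral:
  assumes f: "f holomorphic_on unit_disc" and u: "u \<in> borel_measurable mT"
  shows "(\<integral>\<^sup>+z. ennreal ((cmod (closed_disc_ext f z))\<^sup>2) \<partial>boundary_measure (\<lambda>\<zeta>. (cmod (u \<zeta>))\<^sup>2)) =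
    (\<integral>\<^sup>+\<zeta>. ennreal ((cmod (bv f \<zeta>))\<^sup>2 * (cmod (u \<zeta>))\<^sup>2) \<partial>mT)"
proof -
  have [measurable]: "u \<in> borel_measurable mT" "bv f \<in> borel_measurable mT"
    by (rule u, rule bv_measurable[OF f])
  have id: "(\<lambda>\<zeta>. \<zeta>) \<in> measurable (density mT (\<lambda>\<zeta>. ennreal ((cmod (u \<zeta>))\<^sup>2))) (restrict_space borel (cball 0 1))"
    by (intro measurable_restrict_space2) auto
  have "(\<integral>\<^sup>+z. ennreal ((cmod (closed_disc_ext f z))\<^sup>2) \<partial>boundary_measure (\<lambda>\<zeta>. (cmod (u \<zeta>))\<^sup>2)) =
     (\<integral>\<^sup>+\<zeta>. ennreal ((cmod (closed_disc_ext f \<zeta>))\<^sup>2) \<partial>density mT (\<lambda>\<zeta>. ennreal ((cmod (u \<zeta>))\<^sup>2)))"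
    unfolding boundary_measure_def
    by (rule nn_integral_distr[OF id], intro measurable_compose[OF _ measurable_ennreal] borel_measurable_power)
       (simp add: measurable_cong_sets[OF sets_distr refl] measurable_compose[OF closed_disc_ext_measurable[OF f] borel_measurable_norm])
  also have "\<dots> = (\<integral>\<^sup>+\<zeta>. ennreal ((cmod (bv f \<zeta>))\<^sup>2) \<partial>density mT (\<lambda>\<zeta>. ennreal ((cmod (u \<zeta>))\<^sup>2)))"
    by (intro nn_integral_cong) (simp add: closed_disc_ext_def)
  also have "\<dots> = (\<integral>\<^sup>+\<zeta>. ennreal ((cmod (u \<zeta>))\<^sup>2) * ennreal ((cmod (bv f \<zeta>))\<^sup>2) \<partial>mT)"
    by (intro nn_integral_density) measurable
  finally show ?thesis by (simp add: ennreal_mult'[symmetric] mult.commute)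
qed

lemma Re_hardy2_inner: "Re (hardy2_inner f f) = sqn (bv f)"
  unfolding hardy2_inner_def sqn_def complex_norm_square[symmetric] integral_complex_of_real Re_complex_of_real ..

lemma conj_toeplitz_hol:
  assumes "v \<in> hardy 2" "f \<in> hardy 2"
  shows "conj_toeplitz (bv v) f holomorphic_on unit_disc"
  unfolding conj_toeplitz_def by (intro riesz_proj_hol conj_toeplitz_integrable hardy2_bv assms)

lemma carleson_imp_two_weight:
  assumes u: "u \<in> hardy 2" and v: "v \<in> hardy 2" and out: "outer v"
    and b: "carleson_measure (boundary_measure (\<lambda>\<zeta>. (cmod (bv u \<zeta>))\<^sup>2)) (ran_space (bv v)) (ran_inner (bv v))"
  shows "\<exists>C\<ge>0. \<forall>F. circle_bounded F \<longrightarrow> two_weight_form u v F \<le> ennreal (C * sqn F)"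
proof -
  obtain C where C: "C > 0" and le: "\<And>f. f \<in> ran_space (bv v) \<Longrightarrow>
     (\<integral>\<^sup>+z. ennreal ((cmod (closed_disc_ext f z))\<^sup>2) \<partial>boundary_measure (\<lambda>\<zeta>. (cmod (bv u \<zeta>))\<^sup>2)) \<le> ennreal (C\<^sup>2 * Re (ran_inner (bv v) f f))"
    using b unfolding carleson_measure_def by blast
  have "two_weight_form u v F \<le> ennreal (C\<^sup>2 * sqn F)" if F: "circle_bounded F" for F
  proof -
    define f where "f = riesz_proj F"
    have Fs: "sq_integrable F" by (rule circle_bounded_sq_integrable[OF F])
    have f: "f \<in> hardy 2" unfolding f_def by (rule riesz_proj_hardy2(1)[OF Fs])
    let ?T = "conj_toeplitz (bv v)"
    have ran: "?T f \<in> ran_space (bv v)" using f by (simp add: ran_space_def)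
    \<comment> \<open>The preimage chosen by \<open>inv_into\<close> may differ from
      \<open>f\<close>, but injectivity gives it the same norm.\<close>
    let ?f' = "inv_into (hardy 2) ?T (?T f)"
    have f': "?f' \<in> hardy 2" "?T ?f' = ?T f"
      by (rule inv_into_into[OF imageI[OF f]], rule f_inv_into_f[OF imageI[OF f]])
    have "Re (ran_inner (bv v) (?T f) (?T f)) = sqn (bv ?f')"
      unfolding ran_inner_def by (rule Re_hardy2_inner)
    also have "\<dots> = sqn (bv f)" by (rule conj_toeplitz_injective[OF v out f'(1) f]) (simp add: f'(2))
    also have "\<dots> \<le> sqn F" unfolding f_def by (rule riesz_proj_contraction[OF Fs])
    finally have 1: "Re (ran_inner (bv v) (?T f) (?T f)) \<le> sqn F" .
    have "two_weight_form u v F = (\<integral>\<^sup>+\<zeta>. ennreal ((cmod (bv (?T f) \<zeta>))\<^sup>2 * (cmod (bv u \<zeta>))\<^sup>2) \<partial>mT)"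
      unfolding two_weight_form_def
    proof (rule nn_integral_cong)
      fix \<zeta> assume "\<zeta> \<in> space mT"
      then have "bv (?T f) \<zeta> = bv (riesz_proj (\<lambda>\<zeta>. cnj (bv v \<zeta>) * F \<zeta>)) \<zeta>"
        unfolding f_def using conj_toeplitz_riesz_proj[OF v Fs] by (intro bv_cong) auto
      then show "ennreal ((cmod (bv (riesz_proj (\<lambda>\<zeta>. cnj (bv v \<zeta>) * F \<zeta>)) \<zeta>))\<^sup>2 * (cmod (bv u \<zeta>))\<^sup>2) = ennreal ((cmod (bv (?T f) \<zeta>))\<^sup>2 * (cmod (bv u \<zeta>))\<^sup>2)"
        by simp
    qed
    also have "\<dots> \<le> ennreal (C\<^sup>2 * Re (ran_inner (bv v) (?T f) (?T f)))"
      using le[OF ran] by (simp only: boundary_measure_integral[OF conj_toeplitz_hol[OF v f] bv_measurable[OF hardy2_hol[OF u]]])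
    also have "\<dots> \<le> ennreal (C\<^sup>2 * sqn F)" using 1 by (intro ennreal_leI mult_left_mono) auto
    finally show ?thesis .
  qed
  then show ?thesis by (intro exI[of _ "C\<^sup>2"]) auto
qed

text \<open>Stated on interior circles because for square-integrable \<open>F\<close> the projection
  is at first only known to be holomorphic. The lower limit 1/2 keeps the reflected points
  \<open>1 / cnj z\<close> of the later proof within distance 2 of the origin.\<close>

definition dilation_bound :: "(complex \<Rightarrow> complex) \<Rightarrow> (complex \<Rightarrow> complex) \<Rightarrow> real \<Rightarrow> bool" where
  "dilation_bound u v C \<longleftrightarrow> (\<forall>F r. sq_integrable F \<longrightarrow> 1/2 \<le> r \<longrightarrow> r < 1 \<longrightarrow>
     sqn (\<lambda>\<zeta>. u (of_real r * \<zeta>) * riesz_proj (\<lambda>\<zeta>. cnj (bv v \<zeta>) * F \<zeta>) (of_real r * \<zeta>)) \<le> C * sqn F)"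

text \<open>The limit of the projection itself is recovered by dividing the product by
  \<open>u\<close> wherever \<open>bv u\<close> is nonzero; where \<open>bv u\<close> is zero the
  weighted integrand vanishes whatever value \<open>bv\<close> returns.\<close>

lemma dilation_bound_product:
  assumes u: "u \<in> hardy 2" and v: "v \<in> hardy 2" and b: "dilation_bound u v C" and F: "sq_integrable F"
  shows "(\<lambda>z. u z * riesz_proj (\<lambda>\<zeta>. cnj (bv v \<zeta>) * F \<zeta>) z) \<in> hardy 2"
    and "sqn (bv (\<lambda>z. u z * riesz_proj (\<lambda>\<zeta>. cnj (bv v \<zeta>) * F \<zeta>) z)) \<le> C * sqn F"
    and "two_weight_form u v F \<le> ennreal (C * sqn F)"
proof -
  define G where "G = riesz_proj (\<lambda>\<zeta>. cnj (bv v \<zeta>) * F \<zeta>)"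
  have hol: "(\<lambda>z. u z * G z) holomorphic_on unit_disc"
    unfolding G_def by (intro holomorphic_intros hardy2_hol u riesz_proj_hol conj_toeplitz_integrable v F)
  have half: "1/2 < (1::real)" by simp
  note I = hardy2I[OF hol half, of "C * sqn F"]
  have le: "sqn (\<lambda>\<zeta>. u (of_real r * \<zeta>) * G (of_real r * \<zeta>)) \<le> C * sqn F" if "1/2 \<le> r" "r < 1" for r
    using b F that unfolding dilation_bound_def G_def by blast
  show h: "(\<lambda>z. u z * riesz_proj (\<lambda>\<zeta>. cnj (bv v \<zeta>) * F \<zeta>) z) \<in> hardy 2"
    using I(1) le unfolding G_def by blast
  have h': "(\<lambda>z. u z * G z) \<in> hardy 2" using h by (simp add: G_def)
  have s: "sqn (bv (\<lambda>z. u z * G z)) \<le> C * sqn F"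
    unfolding hardy2_hsum[OF h'] using I(3) le by blast
  then show "sqn (bv (\<lambda>z. u z * riesz_proj (\<lambda>\<zeta>. cnj (bv v \<zeta>) * F \<zeta>) z)) \<le> C * sqn F"
    by (simp add: G_def)
  have "two_weight_form u v F \<le> (\<integral>\<^sup>+\<zeta>. ennreal ((cmod (bv (\<lambda>z. u z * G z) \<zeta>))\<^sup>2) \<partial>mT)"
    unfolding two_weight_form_def G_def[symmetric]
  proof (rule nn_integral_mono_AE)
    show "AE \<zeta> in mT. ennreal ((cmod (bv G \<zeta>))\<^sup>2 * (cmod (bv u \<zeta>))\<^sup>2) \<le> ennreal ((cmod (bv (\<lambda>z. u z * G z) \<zeta>))\<^sup>2)"
      using hardy2_radial_limit[OF u] hardy2_radial_limit[OF h']
    proof eventually_elim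
      case (elim \<zeta>)
      show ?case
      proof (cases "bv u \<zeta> = 0")
        case False
        have "has_radial_limit (\<lambda>z. u z * G z / u z) \<zeta> (bv (\<lambda>z. u z * G z) \<zeta> / bv u \<zeta>)"
          by (rule has_radial_limit_divide[OF elim(2,1) False])
        moreover have "\<forall>\<^sub>F r in at_left 1. u (of_real r * \<zeta>) \<noteq> 0"
          using elim(1) False unfolding has_radial_limit_def by (rule tendsto_imp_eventually_ne)
        then have "\<forall>\<^sub>F r in at_left 1. u (of_real r * \<zeta>) * G (of_real r * \<zeta>) / u (of_real r * \<zeta>) = G (of_real r * \<zeta>)"
          by eventually_elim simp
        ultimately have "has_radial_limit G \<zeta> (bv (\<lambda>z. u z * G z) \<zeta> / bv u \<zeta>)"
          unfolding has_radial_limit_def by (rule Lim_transform_eventually)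
        then have "bv G \<zeta> = bv (\<lambda>z. u z * G z) \<zeta> / bv u \<zeta>" by (rule bv_eqI)
        then have "bv G \<zeta> * bv u \<zeta> = bv (\<lambda>z. u z * G z) \<zeta>" using False by simp
        then show ?thesis by (simp flip: power_mult_distrib norm_mult)
      qed simp
    qed
  qed
  also have "\<dots> \<le> ennreal (C * sqn F)"
    unfolding sqn_nn[OF hardy2_bv(1)[OF h']] using s by (rule ennreal_leI)
  finally show "two_weight_form u v F \<le> ennreal (C * sqn F)" .
qed

lemma dilation_bound_imp_toeplitz:
  assumes u: "u \<in> hardy 2" and v: "v \<in> hardy 2" and b: "dilation_bound u v C" and C: "C > 0"
  shows "hardy2_bounded (toeplitz_product u (bv v))"
  unfolding hardy2_bounded_def
proof (intro conjI exI[of _ "sqrt C"] ballI)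
  fix f assume f: "f \<in> hardy 2"
  have eq: "toeplitz_product u (bv v) f = (\<lambda>z. u z * riesz_proj (\<lambda>\<zeta>. cnj (bv v \<zeta>) * bv f \<zeta>) z)"
    by (simp add: toeplitz_product_def conj_toeplitz_def)
  note p = dilation_bound_product[OF u v b hardy2_bv(1)[OF f]]
  show "toeplitz_product u (bv v) f \<in> hardy 2" unfolding eq by (rule p(1))
  show "hardy2_norm (toeplitz_product u (bv v) f) \<le> sqrt C * hardy2_norm f"
    unfolding eq hardy2_norm_sqn real_sqrt_mult[symmetric] using p(2) by (rule real_sqrt_le_mono)
qed (use C in simp)

lemma dilation_bound_imp_riesz:
  assumes u: "u \<in> hardy 2" and v: "v \<in> hardy 2" and out: "outer v" and b: "dilation_bound u v C" and C: "C > 0"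
  shows "riesz_proj_bounded (\<lambda>\<zeta>. 1 / (cmod (bv v \<zeta>))\<^sup>2) (\<lambda>\<zeta>. (cmod (bv u \<zeta>))\<^sup>2)"
  unfolding riesz_proj_bounded_def
proof (intro exI[of _ C] conjI C ballI)
  fix g assume "g \<in> weighted_L2 (\<lambda>\<zeta>. 1 / (cmod (bv v \<zeta>))\<^sup>2)"
  then have [measurable]: "g \<in> borel_measurable mT"
    and fin: "(\<integral>\<^sup>+\<zeta>. ennreal ((cmod (g \<zeta>))\<^sup>2 * (1 / (cmod (bv v \<zeta>))\<^sup>2)) \<partial>mT) < \<infinity>"
    by (auto simp: weighted_L2_def)
  have [measurable]: "bv v \<in> borel_measurable mT" by (rule bv_measurable[OF hardy2_hol[OF v]])
  \<comment> \<open>Solves \<open>g = cnj v F\<close>. For outer \<open>v\<close> the default value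
    of the division occurs only on a null set.\<close>
  define F where "F \<zeta> = g \<zeta> / cnj (bv v \<zeta>)" for \<zeta>
  have Fm [measurable]: "F \<in> borel_measurable mT" unfolding F_def by measurable
  have Fn: "(cmod (F \<zeta>))\<^sup>2 = (cmod (g \<zeta>))\<^sup>2 * (1 / (cmod (bv v \<zeta>))\<^sup>2)" for \<zeta>
    by (simp add: F_def norm_divide power_divide)
  have F: "sq_integrable F" by (subst sq_integrable_nn[OF Fm]) (simp only: Fn fin)
  have eq: "riesz_proj (\<lambda>\<zeta>. cnj (bv v \<zeta>) * F \<zeta>) z = riesz_proj g z" for z
    unfolding riesz_proj_def
  proof (rule integral_cong_AE)
    show "AE \<zeta> in mT. cnj (bv v \<zeta>) * F \<zeta> / (1 - cnj \<zeta> * z) = g \<zeta> / (1 - cnj \<zeta> * z)"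
      using outer_bv_nonzero[OF v out] by eventually_elim (simp add: F_def)
  qed measurable
  have "(\<integral>\<^sup>+\<zeta>. ennreal ((cmod (bv (riesz_proj g) \<zeta>))\<^sup>2 * (cmod (bv u \<zeta>))\<^sup>2) \<partial>mT) = two_weight_form u v F"
    unfolding two_weight_form_def eq[abs_def] ..
  also have "\<dots> \<le> ennreal (C * sqn F)" by (rule dilation_bound_product(3)[OF u v b F])
  also have "\<dots> = ennreal C * (\<integral>\<^sup>+\<zeta>. ennreal ((cmod (F \<zeta>))\<^sup>2) \<partial>mT)"
    using C by (simp add: sqn_nn[OF F] ennreal_mult)
  finally show "(\<integral>\<^sup>+\<zeta>. ennreal ((cmod (bv (riesz_proj g) \<zeta>))\<^sup>2 * (cmod (bv u \<zeta>))\<^sup>2) \<partial>mT)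
      \<le> ennreal C * (\<integral>\<^sup>+\<zeta>. ennreal ((cmod (g \<zeta>))\<^sup>2 * (1 / (cmod (bv v \<zeta>))\<^sup>2)) \<partial>mT)"
    by (simp only: Fn)
qed

lemma dilation_bound_imp_carleson:
  assumes u: "u \<in> hardy 2" and v: "v \<in> hardy 2" and b: "dilation_bound u v C" and C: "C > 0"
  shows "carleson_measure (boundary_measure (\<lambda>\<zeta>. (cmod (bv u \<zeta>))\<^sup>2)) (ran_space (bv v)) (ran_inner (bv v))"
  unfolding carleson_measure_def
proof (intro conjI exI[of _ "sqrt C"] ballI)
  have um [measurable]: "bv u \<in> borel_measurable mT" by (rule bv_measurable[OF hardy2_hol[OF u]])
  show "sets (boundary_measure (\<lambda>\<zeta>. (cmod (bv u \<zeta>))\<^sup>2)) = sets (restrict_space borel (cball 0 1))"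
    by (simp add: boundary_measure_def)
  show "finite_measure (boundary_measure (\<lambda>\<zeta>. (cmod (bv u \<zeta>))\<^sup>2))"
    unfolding boundary_measure_def
  proof (rule finite_measure.finite_measure_distr)
    show "finite_measure (density mT (\<lambda>\<zeta>. ennreal ((cmod (bv u \<zeta>))\<^sup>2)))"
    proof (rule finite_measureI)
      have "emeasure (density mT (\<lambda>\<zeta>. ennreal ((cmod (bv u \<zeta>))\<^sup>2))) (space mT) = (\<integral>\<^sup>+\<zeta>. ennreal ((cmod (bv u \<zeta>))\<^sup>2) * indicator (space mT) \<zeta> \<partial>mT)"
        by (intro emeasure_density sets.top) measurable
      also have "\<dots> = (\<integral>\<^sup>+\<zeta>. ennreal ((cmod (bv u \<zeta>))\<^sup>2) \<partial>mT)" by (intro nn_integral_cong) simp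
      also have "\<dots> = ennreal (sqn (bv u))" by (rule sqn_nn[OF hardy2_bv(1)[OF u]])
      finally show "emeasure (density mT (\<lambda>\<zeta>. ennreal ((cmod (bv u \<zeta>))\<^sup>2))) (space (density mT (\<lambda>\<zeta>. ennreal ((cmod (bv u \<zeta>))\<^sup>2)))) \<noteq> \<infinity>"
        by simp
    qed
    show "(\<lambda>\<zeta>. \<zeta>) \<in> measurable (density mT (\<lambda>\<zeta>. ennreal ((cmod (bv u \<zeta>))\<^sup>2))) (restrict_space borel (cball 0 1))"
      by (intro measurable_restrict_space2) auto
  qed
  fix f assume "f \<in> ran_space (bv v)"
  then have ran: "f \<in> conj_toeplitz (bv v) ` hardy 2" by (simp add: ran_space_def)
  let ?f = "inv_into (hardy 2) (conj_toeplitz (bv v)) f"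
  have f: "?f \<in> hardy 2" and Tf: "conj_toeplitz (bv v) ?f = f"
    by (rule inv_into_into[OF ran], rule f_inv_into_f[OF ran])
  have fhol: "f holomorphic_on unit_disc" using conj_toeplitz_hol[OF v f] by (simp only: Tf)
  have "(\<integral>\<^sup>+z. ennreal ((cmod (closed_disc_ext f z))\<^sup>2) \<partial>boundary_measure (\<lambda>\<zeta>. (cmod (bv u \<zeta>))\<^sup>2)) = two_weight_form u v (bv ?f)"
    unfolding boundary_measure_integral[OF fhol um] two_weight_form_def conj_toeplitz_def[symmetric] Tf ..
  also have "\<dots> \<le> ennreal (C * sqn (bv ?f))" by (rule dilation_bound_product(3)[OF u v b hardy2_bv(1)[OF f]])
  also have "C * sqn (bv ?f) = (sqrt C)\<^sup>2 * Re (ran_inner (bv v) f f)"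
    using C by (simp add: ran_inner_def Re_hardy2_inner)
  finally show "(\<integral>\<^sup>+z. ennreal ((cmod (closed_disc_ext f z))\<^sup>2) \<partial>boundary_measure (\<lambda>\<zeta>. (cmod (bv u \<zeta>))\<^sup>2)) \<le> ennreal ((sqrt C)\<^sup>2 * Re (ran_inner (bv v) f f))" .
qed (use C in simp)

section \<open>Boundary zeros and poles\<close>

lemma radial_in_open:
  assumes "open S" "\<zeta> \<in> S" "\<zeta> \<in> unit_circle"
  shows "\<forall>\<^sub>F r in at_left (1::real). of_real r * \<zeta> \<in> S \<and> cmod (of_real r * \<zeta>) < 1"
  using topological_tendstoD[OF radial_path assms(1,2)] radial_eventually[of 0, OF zero_less_one]
  by eventually_elim (use assms(3) in \<open>auto simp: norm_mult\<close>)

lemma radial_limit_bounds: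
  assumes "open S" "\<zeta> \<in> S" "\<zeta> \<in> unit_circle" "has_radial_limit f \<zeta> l" "isCont B \<zeta>"
  shows "(\<And>z. z \<in> S \<Longrightarrow> cmod z < 1 \<Longrightarrow> cmod (f z) \<le> B z) \<Longrightarrow> cmod l \<le> B \<zeta>"
    and "(\<And>z. z \<in> S \<Longrightarrow> cmod z < 1 \<Longrightarrow> B z \<le> cmod (f z)) \<Longrightarrow> B \<zeta> \<le> cmod l"
proof -
  have 1: "((\<lambda>r. cmod (f (of_real r * \<zeta>))) \<longlongrightarrow> cmod l) (at_left 1)"
    using assms(4) unfolding has_radial_limit_def by (rule tendsto_norm)
  have 2: "((\<lambda>r. B (of_real r * \<zeta>)) \<longlongrightarrow> B \<zeta>) (at_left (1::real))"
    by (rule isCont_tendsto_compose[OF assms(5) radial_path])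
  note ev = radial_in_open[OF assms(1-3)]
  have nb: "at_left (1::real) \<noteq> bot" by simp
  show "cmod l \<le> B \<zeta>" if "\<And>z. z \<in> S \<Longrightarrow> cmod z < 1 \<Longrightarrow> cmod (f z) \<le> B z"
    by (rule tendsto_le[OF nb 2 1]) (use ev in \<open>eventually_elim, use that in blast\<close>)
  show "B \<zeta> \<le> cmod l" if "\<And>z. z \<in> S \<Longrightarrow> cmod z < 1 \<Longrightarrow> B z \<le> cmod (f z)"
    by (rule tendsto_le[OF nb 1 2]) (use ev in \<open>eventually_elim, use that in blast\<close>)
qed

text \<open>The continuation is a power of \<open>z - t\<close> times a function continuous and
  nonzero at \<open>t\<close>, whose modulus near \<open>t\<close> lies between half and twice its
  value there. The point \<open>z0\<close> excludes the zero function.\<close>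

lemma boundary_zero_order:
  assumes hol: "f holomorphic_on unit_disc" and an: "analytic_at_bdry f t" and t: "t \<in> unit_circle"
    and nz: "cmod z0 < 1" "f z0 \<noteq> 0"
  shows "\<exists>k \<epsilon> \<delta> M. 0 < \<epsilon> \<and> 0 < \<delta> \<and> (\<forall>z\<in>ball t \<epsilon>. cmod z < 1 \<longrightarrow>
    \<delta> * cmod (z - t) ^ k \<le> cmod (f z) \<and> cmod (f z) \<le> M * cmod (z - t) ^ k)"
proof -
  obtain e g where e: "e > 0" and g: "g holomorphic_on ball t e" and gf: "\<And>z. z \<in> ball t e \<Longrightarrow> cmod z < 1 \<Longrightarrow> g z = f z"
    using an unfolding analytic_at_bdry_def by auto
  have "\<exists>k r h. 0 < r \<and> r \<le> e \<and> isCont h t \<and> h t \<noteq> 0 \<and> (\<forall>w\<in>ball t r. g w = (w - t) ^ k * h w)"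
  proof (cases "g t = 0")
    case False
    have "isCont g t"
      using holomorphic_on_imp_continuous_on[OF g] e by (simp add: continuous_on_eq_continuous_at)
    then show ?thesis using False e by (intro exI[of _ 0] exI[of _ e] exI[of _ g]) auto
  next
    case True
    \<comment> \<open>A continuation that is constantly 0 near \<open>t\<close> would make
      \<open>f\<close> vanish on an open part of the disc, hence on all of it.\<close>
    have "\<not> g constant_on ball t e"
    proof
      assume "g constant_on ball t e"
      then have g0: "g z = 0" if "z \<in> ball t e" for z
        using that True e unfolding constant_on_def by (metis centre_in_ball)
      have "\<forall>\<^sub>F r in at_left (1::real). of_real r * t \<in> ball t e \<and> cmod (of_real r * t) < 1"
        by (rule radial_in_open) (use e t in auto)
      then obtain r :: real where r: "of_real r * t \<in> ball t e" "cmod (of_real r * t) < 1"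
        using eventually_happens'[OF trivial_limit_at_left_real[of 1]] by blast
      define U where "U = ball t e \<inter> unit_disc"
      have "f z0 = 0"
      proof (rule analytic_continuation_open[of U unit_disc f "\<lambda>_. 0" z0])
        show "open U" "U \<noteq> {}" "U \<subseteq> unit_disc" using r by (auto simp: U_def)
        show "f z = 0" if "z \<in> U" for z using that g0[of z] gf[of z] by (auto simp: U_def)
      qed (use hol nz in \<open>auto intro: connected_ball\<close>)
      then show False using nz by simp
    qed
    have "t \<in> ball t e" using e by simp
    show ?thesis
    proof (rule holomorphic_factor_zero_nonconstant[OF g open_ball connected_ball \<open>t \<in> ball t e\<close> True \<open>\<not> g constant_on ball t e\<close>])
      fix h r n
      assume r: "0 < r" "ball t r \<subseteq> ball t e" and h: "h holomorphic_on ball t r"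
        and gh: "\<And>w. w \<in> ball t r \<Longrightarrow> g w = (w - t) ^ n * h w" and nz: "\<And>w. w \<in> ball t r \<Longrightarrow> h w \<noteq> 0"
      have "isCont h t"
        using holomorphic_on_imp_continuous_on[OF h] r(1) by (simp add: continuous_on_eq_continuous_at)
      moreover have "r \<le> e" using r by (simp add: ball_subset_ball_iff)
      moreover have "h t \<noteq> 0" using nz[of t] r(1) by simp
      ultimately show ?thesis using r(1) gh by (intro exI[of _ n] exI[of _ r] exI[of _ h]) simp
    qed
  qed
  then obtain k r h where r: "0 < r" "r \<le> e" and h: "isCont h t" "h t \<noteq> 0" and gh: "\<And>w. w \<in> ball t r \<Longrightarrow> g w = (w - t) ^ k * h w"
    by blast
  have "\<exists>d>0. \<forall>z. dist z t < d \<longrightarrow> dist (h z) (h t) < cmod (h t) / 2"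
  proof -
    have "0 < cmod (h t) / 2" using h(2) by simp
    then show ?thesis using h(1) unfolding continuous_at_eps_delta by blast
  qed
  then obtain d where d: "d > 0" "\<And>z. dist z t < d \<Longrightarrow> dist (h z) (h t) < cmod (h t) / 2" by blast
  show ?thesis
  proof (rule exI[of _ k], rule exI[of _ "min r d"], rule exI[of _ "cmod (h t) / 2"], rule exI[of _ "2 * cmod (h t)"],
      intro conjI ballI impI)
    fix z assume z: "z \<in> ball t (min r d)" "cmod z < 1"
    have "f z = (z - t) ^ k * h z" using gh[of z] gf[of z] z r by auto
    then have f: "cmod (f z) = cmod (h z) * cmod (z - t) ^ k" by (simp add: norm_mult norm_power)
    have "dist (h z) (h t) < cmod (h t) / 2" using d(2)[of z] z by (simp add: dist_commute)
    then have "cmod (h t) / 2 \<le> cmod (h z)" "cmod (h z) \<le> 2 * cmod (h t)"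
      using norm_triangle_ineq2[of "h t" "h z"] norm_triangle_ineq2[of "h z" "h t"] norm_ge_zero[of "h t"]
      unfolding dist_norm norm_minus_commute[of "h z"] by linarith+
    then show "cmod (h t) / 2 * cmod (z - t) ^ k \<le> cmod (f z)" "cmod (f z) \<le> 2 * cmod (h t) * cmod (z - t) ^ k"
      unfolding f by (intro mult_right_mono; simp)+
  qed (use r d h in auto)
qed

section \<open>Local bounds and compactness\<close>

definition locally_AE_bounded :: "(complex \<Rightarrow> complex) \<Rightarrow> complex \<Rightarrow> bool" where
  "locally_AE_bounded f \<zeta> \<longleftrightarrow> (\<exists>\<epsilon>>0. \<exists>M. AE z in mT. z \<in> ball \<zeta> \<epsilon> \<longrightarrow> cmod (f z) \<le> M)"

lemma locally_AE_bounded_global: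
  assumes "\<And>\<zeta>. \<zeta> \<in> unit_circle \<Longrightarrow> locally_AE_bounded f \<zeta>"
  shows "\<exists>M. AE z in mT. cmod (f z) \<le> M"
proof -
  obtain \<epsilon> M where \<epsilon>: "\<And>\<zeta>. \<zeta> \<in> unit_circle \<Longrightarrow> \<epsilon> \<zeta> > 0"
    and M: "\<And>\<zeta>. \<zeta> \<in> unit_circle \<Longrightarrow> AE z in mT. z \<in> ball \<zeta> (\<epsilon> \<zeta>) \<longrightarrow> cmod (f z) \<le> M \<zeta>"
    using assms unfolding locally_AE_bounded_def by metis
  have "compact (unit_circle :: complex set)" by simp
  then obtain D where D: "D \<subseteq> unit_circle" "finite D" "unit_circle \<subseteq> (\<Union>\<zeta>\<in>D. ball \<zeta> (\<epsilon> \<zeta>))"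
    by (rule compactE_image[where f="\<lambda>\<zeta>. ball \<zeta> (\<epsilon> \<zeta>)" and C=unit_circle]) (use \<epsilon> in force)+
  have "AE z in mT. \<forall>\<zeta>\<in>D. z \<in> ball \<zeta> (\<epsilon> \<zeta>) \<longrightarrow> cmod (f z) \<le> M \<zeta>"
    using D M by (intro AE_finite_allI) auto
  then have "AE z in mT. cmod (f z) \<le> (\<Sum>\<zeta>\<in>D. \<bar>M \<zeta>\<bar>)"
    using AE_space
  proof eventually_elim
    case (elim z)
    then obtain \<zeta> where \<zeta>: "\<zeta> \<in> D" "z \<in> ball \<zeta> (\<epsilon> \<zeta>)" using D(3) by auto
    then have "cmod (f z) \<le> \<bar>M \<zeta>\<bar>" using elim(1) by (smt (verit, ccfv_SIG))
    also have "\<dots> \<le> (\<Sum>\<zeta>\<in>D. \<bar>M \<zeta>\<bar>)" using \<zeta>(1) D(2) by (intro member_le_sum) auto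
    finally show ?case .
  qed
  then show ?thesis by blast
qed

lemma disc_bounded_global:
  fixes f :: "complex \<Rightarrow> complex" and b :: "complex \<Rightarrow> real"
  assumes "\<And>x. x \<in> cball 0 1 \<Longrightarrow> \<exists>\<epsilon>>0. \<exists>M. \<forall>z\<in>ball x \<epsilon>. cmod z < 1 \<longrightarrow> cmod (f z) \<le> M * b z"
    and "\<And>z. 0 \<le> b z"
  shows "\<exists>M\<ge>0. \<forall>z. cmod z < 1 \<longrightarrow> cmod (f z) \<le> M * b z"
proof -
  obtain \<epsilon> M where \<epsilon>: "\<And>x. x \<in> cball 0 1 \<Longrightarrow> \<epsilon> x > 0"
    and M: "\<And>x z. x \<in> cball 0 1 \<Longrightarrow> z \<in> ball x (\<epsilon> x) \<Longrightarrow> cmod z < 1 \<Longrightarrow> cmod (f z) \<le> M x * b z"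
    using assms(1) by metis
  have "compact (cball (0::complex) 1)" by simp
  then obtain D where D: "D \<subseteq> cball 0 1" "finite D" "cball 0 1 \<subseteq> (\<Union>x\<in>D. ball x (\<epsilon> x))"
    by (rule compactE_image[where f="\<lambda>x. ball x (\<epsilon> x)" and C="cball 0 1"]) (use \<epsilon> in force)+
  show ?thesis
  proof (intro exI[of _ "\<Sum>x\<in>D. \<bar>M x\<bar>"] conjI allI impI)
    fix z :: complex assume z: "cmod z < 1"
    then have "z \<in> cball 0 1" by simp
    then obtain x where x: "x \<in> D" "z \<in> ball x (\<epsilon> x)" using D(3) by blast
    then have "cmod (f z) \<le> M x * b z" using D(1) M z by blast
    also have "\<dots> \<le> \<bar>M x\<bar> * b z" using assms(2) by (intro mult_right_mono) auto
    also have "\<dots> \<le> (\<Sum>x\<in>D. \<bar>M x\<bar>) * b z"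
      using x(1) D(2) assms(2) by (intro mult_right_mono member_le_sum) auto
    finally show "cmod (f z) \<le> (\<Sum>x\<in>D. \<bar>M x\<bar>) * b z" .
  qed (simp add: sum_nonneg)
qed

lemma isCont_locally_bounded:
  fixes f :: "complex \<Rightarrow> complex"
  assumes "isCont f x"
  shows "\<exists>\<epsilon>>0. \<forall>z\<in>ball x \<epsilon>. cmod (f z) \<le> cmod (f x) + 1"
proof -
  have "\<exists>d>0. \<forall>z. dist z x < d \<longrightarrow> dist (f z) (f x) < 1"
    using assms unfolding continuous_at_eps_delta by simp
  then obtain d where d: "d > 0" "\<And>z. dist z x < d \<Longrightarrow> dist (f z) (f x) < 1" by blast
  show ?thesis
  proof (intro exI[of _ d] conjI ballI d(1))
    fix z assume "z \<in> ball x d"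
    then have "dist (f z) (f x) < 1" by (intro d) (simp add: dist_commute)
    then show "cmod (f z) \<le> cmod (f x) + 1"
      using norm_triangle_ineq2[of "f z" "f x"] unfolding dist_norm by linarith
  qed
qed

section \<open>Polynomials with prescribed zeros on the circle\<close>

definition root_prod :: "complex set \<Rightarrow> (complex \<Rightarrow> nat) \<Rightarrow> complex \<Rightarrow> complex" where
  "root_prod U k z = (\<Prod>t\<in>U. (z - t) ^ k t)"

lemma root_prod_hol: "root_prod U k holomorphic_on S"
  unfolding root_prod_def by (intro holomorphic_intros)

lemma root_prod_isCont: "isCont (root_prod U k) x"
  using holomorphic_on_imp_continuous_on[OF root_prod_hol, of UNIV] by (simp add: continuous_on_eq_continuous_at)

lemma root_prod_nonzero: "finite U \<Longrightarrow> z \<notin> U \<Longrightarrow> root_prod U k z \<noteq> 0"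
  unfolding root_prod_def by auto

lemma root_prod_split:
  "finite U \<Longrightarrow> t \<in> U \<Longrightarrow> root_prod U k z = (z - t) ^ k t * root_prod (U - {t}) k z"
  unfolding root_prod_def by (rule prod.remove)

text \<open>Radius 2 is chosen so that the reflected points \<open>1 / cnj z\<close> with
  \<open>cmod z \<ge> 1/2\<close> are covered.\<close>

lemma root_prod_Lipschitz:
  shows "\<exists>L\<ge>0. \<forall>x\<in>cball 0 2. \<forall>y\<in>cball 0 2. cmod (root_prod U k x - root_prod U k y) \<le> L * cmod (x - y)"
proof -
  have der: "(root_prod U k has_field_derivative deriv (root_prod U k) z) (at z within cball 0 2)" for z
    using holomorphic_derivI[OF root_prod_hol open_UNIV, of z] by auto
  have "continuous_on (cball 0 2) (deriv (root_prod U k))"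
    by (intro holomorphic_on_imp_continuous_on holomorphic_on_subset[OF holomorphic_deriv[OF root_prod_hol open_UNIV]]) auto
  then have "bounded (deriv (root_prod U k) ` cball 0 2)"
    by (intro compact_imp_bounded compact_continuous_image) auto
  then obtain L where L: "\<forall>z\<in>cball 0 2. cmod (deriv (root_prod U k) z) \<le> L"
    unfolding bounded_iff by blast
  show ?thesis
  proof (intro exI[of _ L] conjI ballI)
    show "0 \<le> L" by (rule order_trans[OF norm_ge_zero L[rule_format, of 0]]) simp
    show "cmod (root_prod U k x - root_prod U k y) \<le> L * cmod (x - y)" if "x \<in> cball 0 2" "y \<in> cball 0 2" for x y
      by (rule field_differentiable_bound[OF convex_cball der _ that(1,2)]) (use L in auto)
  qed
qed

text \<open>For \<open>t\<close> on the circle the distance from \<open>1 / cnj z\<close> to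
  \<open>t\<close> is \<open>cmod (z - t) / cmod z\<close>, so each linear factor grows at most by
  2.\<close>

lemma root_prod_reflect:
  assumes "finite U" "U \<subseteq> unit_circle" "1/2 \<le> cmod z"
  shows "cmod (root_prod U k (1 / cnj z)) \<le> 2 ^ (\<Sum>t\<in>U. k t) * cmod (root_prod U k z)"
proof -
  have z0: "z \<noteq> 0" "cmod z > 0" using assms(3) by auto
  have "cmod ((1 / cnj z - t) ^ k t) \<le> 2 ^ k t * cmod ((z - t) ^ k t)" if "t \<in> U" for t
  proof -
    have t: "t \<in> unit_circle" using that assms(2) by blast
    have "1 / cnj z - t = cnj (1 - z * cnj t) / cnj z" using z0 by (simp add: field_simps)
    then have "cmod (1 / cnj z - t) = cmod (t - z) / cmod z"
      by (simp only: norm_divide complex_mod_cnj cmod_one_minus_eq[OF t])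
    also have "\<dots> \<le> 2 * cmod (z - t)"
      using assms(3) z0 mult_right_mono[of "1/2" "cmod z" "2 * cmod (z - t)"]
      by (simp add: norm_minus_commute divide_le_eq mult.commute)
    finally have "cmod (1 / cnj z - t) ^ k t \<le> (2 * cmod (z - t)) ^ k t" by (rule power_mono) simp
    then show ?thesis by (simp add: norm_power power_mult_distrib)
  qed
  then have "(\<Prod>t\<in>U. cmod ((1 / cnj z - t) ^ k t)) \<le> (\<Prod>t\<in>U. 2 ^ k t * cmod ((z - t) ^ k t))"
    by (intro prod_mono) auto
  then show ?thesis by (simp add: root_prod_def prod_norm[symmetric] prod.distrib power_sum)
qed

text \<open>The zeros of \<open>v\<close> at the poles of \<open>u\<close> absorb them because \<open>u v\<close> is bounded, while the zeros of
  \<open>u\<close> at the poles of \<open>v\<close> can be divided out.\<close>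

lemma quotient_bounded:
  fixes u v :: "complex \<Rightarrow> complex"
  assumes fin: "finite U" "finite V" and disj: "U \<inter> V = {}"
    and u: "\<And>\<zeta>. \<zeta> \<in> unit_circle - U \<Longrightarrow> locally_AE_bounded u \<zeta>"
    and vU: "\<And>t. t \<in> U \<Longrightarrow> \<exists>\<epsilon>>0. \<exists>\<delta>>0. AE \<zeta> in mT. \<zeta> \<in> ball t \<epsilon> \<longrightarrow> \<delta> * cmod (\<zeta> - t) ^ k t \<le> cmod (v \<zeta>)"
    and uV: "\<And>s. s \<in> V \<Longrightarrow> \<exists>\<epsilon>>0. \<exists>M. AE \<zeta> in mT. \<zeta> \<in> ball s \<epsilon> \<longrightarrow> cmod (u \<zeta>) \<le> M * cmod (\<zeta> - s) ^ l s"
    and uv: "AE \<zeta> in mT. cmod (u \<zeta> * v \<zeta>) \<le> K"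
  shows "\<exists>M. AE \<zeta> in mT. cmod (u \<zeta> * (root_prod U k \<zeta> / root_prod V l \<zeta>)) \<le> M"
proof (rule locally_AE_bounded_global)
  fix x :: complex assume x: "x \<in> unit_circle"
  consider "x \<in> U" "x \<notin> V" | "x \<in> V" "x \<notin> U" | "x \<notin> U" "x \<notin> V" using disj by blast
  then show "locally_AE_bounded (\<lambda>\<zeta>. u \<zeta> * (root_prod U k \<zeta> / root_prod V l \<zeta>)) x"
  proof cases
    case 1
    obtain \<epsilon> \<delta> where \<epsilon>: "\<epsilon> > 0" "\<delta> > 0" "AE \<zeta> in mT. \<zeta> \<in> ball x \<epsilon> \<longrightarrow> \<delta> * cmod (\<zeta> - x) ^ k x \<le> cmod (v \<zeta>)"
      using vU[OF 1(1)] by blast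
    let ?q = "\<lambda>\<zeta>. root_prod (U - {x}) k \<zeta> / root_prod V l \<zeta>"
    have "isCont ?q x" using root_prod_nonzero[OF fin(2) 1(2)] by (intro continuous_intros root_prod_isCont)
    then obtain \<epsilon>' where \<epsilon>': "\<epsilon>' > 0" "\<forall>z\<in>ball x \<epsilon>'. cmod (?q z) \<le> cmod (?q x) + 1"
      using isCont_locally_bounded by blast
    have "AE \<zeta> in mT. \<zeta> \<in> ball x (min \<epsilon> \<epsilon>') \<longrightarrow> cmod (u \<zeta> * (root_prod U k \<zeta> / root_prod V l \<zeta>)) \<le> (K / \<delta>) * (cmod (?q x) + 1)"
      using \<epsilon>(3) uv
    proof eventually_elim
      case (elim \<zeta>)
      show ?case
      proof
        assume \<zeta>: "\<zeta> \<in> ball x (min \<epsilon> \<epsilon>')"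
        then have "\<delta> * cmod (\<zeta> - x) ^ k x \<le> cmod (v \<zeta>)" using elim(1) by simp
        then have "cmod (u \<zeta>) * (\<delta> * cmod (\<zeta> - x) ^ k x) \<le> cmod (u \<zeta>) * cmod (v \<zeta>)" by (intro mult_left_mono) auto
        also have "\<dots> \<le> K" using elim(2) by (simp add: norm_mult)
        finally have *: "cmod (u \<zeta>) * cmod (\<zeta> - x) ^ k x \<le> K / \<delta>" using \<epsilon>(2) by (simp add: field_simps)
        have "cmod (u \<zeta> * (root_prod U k \<zeta> / root_prod V l \<zeta>)) = (cmod (u \<zeta>) * cmod (\<zeta> - x) ^ k x) * cmod (?q \<zeta>)"
          by (simp add: root_prod_split[OF fin(1) 1(1)] norm_mult norm_divide norm_power)
        also have "\<dots> \<le> (K / \<delta>) * (cmod (?q x) + 1)"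
          using \<epsilon>'(2)[rule_format, of \<zeta>] \<zeta> by (intro mult_mono * order_trans[OF _ *]) auto
        finally show "cmod (u \<zeta> * (root_prod U k \<zeta> / root_prod V l \<zeta>)) \<le> (K / \<delta>) * (cmod (?q x) + 1)" .
      qed
    qed
    then show ?thesis unfolding locally_AE_bounded_def using \<epsilon> \<epsilon>' by (intro exI[of _ "min \<epsilon> \<epsilon>'"]) auto
  next
    case 2
    obtain \<epsilon> M where \<epsilon>: "\<epsilon> > 0" "AE \<zeta> in mT. \<zeta> \<in> ball x \<epsilon> \<longrightarrow> cmod (u \<zeta>) \<le> M * cmod (\<zeta> - x) ^ l x"
      using uV[OF 2(1)] by blast
    let ?q = "\<lambda>\<zeta>. root_prod U k \<zeta> / root_prod (V - {x}) l \<zeta>"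
    have "root_prod (V - {x}) l x \<noteq> 0" using fin(2) by (intro root_prod_nonzero) auto
    then have "isCont ?q x" by (intro continuous_intros root_prod_isCont)
    then obtain \<epsilon>' where \<epsilon>': "\<epsilon>' > 0" "\<forall>z\<in>ball x \<epsilon>'. cmod (?q z) \<le> cmod (?q x) + 1"
      using isCont_locally_bounded by blast
    have "AE \<zeta> in mT. \<zeta> \<in> ball x (min \<epsilon> \<epsilon>') \<longrightarrow> cmod (u \<zeta> * (root_prod U k \<zeta> / root_prod V l \<zeta>)) \<le> \<bar>M\<bar> * (cmod (?q x) + 1)"
      using \<epsilon>(2) AE_circle_neq[of x]
    proof eventually_elim
      case (elim \<zeta>)
      show ?case
      proof
        assume \<zeta>: "\<zeta> \<in> ball x (min \<epsilon> \<epsilon>')"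
        then have "cmod (u \<zeta>) \<le> M * cmod (\<zeta> - x) ^ l x" using elim(1) by simp
        also have "\<dots> \<le> \<bar>M\<bar> * cmod (\<zeta> - x) ^ l x" by (intro mult_right_mono) auto
        finally have *: "cmod (u \<zeta>) / cmod (\<zeta> - x) ^ l x \<le> \<bar>M\<bar>" using elim(2) by (simp add: field_simps)
        have "cmod (u \<zeta> * (root_prod U k \<zeta> / root_prod V l \<zeta>)) = (cmod (u \<zeta>) / cmod (\<zeta> - x) ^ l x) * cmod (?q \<zeta>)"
          by (simp add: root_prod_split[OF fin(2) 2(1)] norm_mult norm_divide norm_power)
        also have "\<dots> \<le> \<bar>M\<bar> * (cmod (?q x) + 1)"
          using \<epsilon>'(2)[rule_format, of \<zeta>] \<zeta> by (intro mult_mono *) auto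
        finally show "cmod (u \<zeta> * (root_prod U k \<zeta> / root_prod V l \<zeta>)) \<le> \<bar>M\<bar> * (cmod (?q x) + 1)" .
      qed
    qed
    then show ?thesis unfolding locally_AE_bounded_def using \<epsilon> \<epsilon>' by (intro exI[of _ "min \<epsilon> \<epsilon>'"]) auto
  next
    case 3
    obtain \<epsilon> M where \<epsilon>: "\<epsilon> > 0" "AE \<zeta> in mT. \<zeta> \<in> ball x \<epsilon> \<longrightarrow> cmod (u \<zeta>) \<le> M"
      using u[of x] x 3 unfolding locally_AE_bounded_def by blast
    let ?q = "\<lambda>\<zeta>. root_prod U k \<zeta> / root_prod V l \<zeta>"
    have "isCont ?q x" using root_prod_nonzero[OF fin(2) 3(2)] by (intro continuous_intros root_prod_isCont)
    then obtain \<epsilon>' where \<epsilon>': "\<epsilon>' > 0" "\<forall>z\<in>ball x \<epsilon>'. cmod (?q z) \<le> cmod (?q x) + 1"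
      using isCont_locally_bounded by blast
    have "AE \<zeta> in mT. \<zeta> \<in> ball x (min \<epsilon> \<epsilon>') \<longrightarrow> cmod (u \<zeta> * ?q \<zeta>) \<le> \<bar>M\<bar> * (cmod (?q x) + 1)"
      using \<epsilon>(2)
    proof eventually_elim
      case (elim \<zeta>)
      show ?case
      proof
        assume \<zeta>: "\<zeta> \<in> ball x (min \<epsilon> \<epsilon>')"
        then have "cmod (u \<zeta>) \<le> \<bar>M\<bar>" using elim by force
        then show "cmod (u \<zeta> * ?q \<zeta>) \<le> \<bar>M\<bar> * (cmod (?q x) + 1)"
          unfolding norm_mult using \<epsilon>'(2)[rule_format, of \<zeta>] \<zeta> by (intro mult_mono) auto
      qed
    qed
    then show ?thesis unfolding locally_AE_bounded_def using \<epsilon> \<epsilon>' by (intro exI[of _ "min \<epsilon> \<epsilon>'"]) auto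
  qed
qed

lemma not_pole_locally_bounded:
  assumes "f \<in> borel_measurable mT" "\<zeta> \<in> unit_circle" "\<zeta> \<notin> poles f"
  shows "locally_AE_bounded f \<zeta>"
proof -
  obtain \<epsilon> where \<epsilon>: "\<epsilon> > 0" "f \<in> Linfty_on (ball \<zeta> \<epsilon> \<inter> unit_circle)"
    using assms(2,3) unfolding poles_def by blast
  then obtain M where "AE z in mT. z \<in> ball \<zeta> \<epsilon> \<inter> unit_circle \<longrightarrow> cmod (f z) \<le> M"
    unfolding Linfty_on_def by blast
  then have "AE z in mT. z \<in> ball \<zeta> \<epsilon> \<longrightarrow> cmod (f z) \<le> M"
    using AE_space by eventually_elim simp
  then show ?thesis unfolding locally_AE_bounded_def using \<epsilon> by blast
qed

lemma locally_bounded_not_pole: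
  assumes "f \<in> borel_measurable mT" "locally_AE_bounded f \<zeta>"
  shows "\<zeta> \<notin> poles f"
proof -
  obtain \<epsilon> M where \<epsilon>: "\<epsilon> > 0" "AE z in mT. z \<in> ball \<zeta> \<epsilon> \<longrightarrow> cmod (f z) \<le> M"
    using assms(2) unfolding locally_AE_bounded_def by blast
  have "(ball \<zeta> \<epsilon> \<inter> unit_circle) \<inter> unit_circle \<in> sets mT"
    unfolding sets_circle by (auto simp: sets_restrict_space_iff)
  moreover have "AE z in mT. z \<in> ball \<zeta> \<epsilon> \<inter> unit_circle \<longrightarrow> cmod (f z) \<le> M"
    using \<epsilon>(2) by eventually_elim simp
  ultimately have "f \<in> Linfty_on (ball \<zeta> \<epsilon> \<inter> unit_circle)"
    using Linfty_on_iff[OF assms(1)] by blast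
  then show ?thesis using \<epsilon>(1) unfolding poles_def by blast
qed

text \<open>The bound on \<open>c - \<Phi> \<zeta>\<close> cancels the singularity of the Cauchy
  kernel, so only the L1 norm of \<open>G\<close> enters. The constant \<open>c\<close> stands for
  the value at \<open>z\<close> of an extension of \<open>\<Phi>\<close> into the disc.\<close>

lemma riesz_commutator:
  assumes G: "integrable mT G" and \<Phi>: "continuous_on unit_circle \<Phi>" and z: "cmod z < 1"
    and K: "\<And>\<zeta>. \<zeta> \<in> unit_circle \<Longrightarrow> cmod (c - \<Phi> \<zeta>) \<le> K * cmod (1 - cnj \<zeta> * z)"
  shows "cmod (c * riesz_proj G z - riesz_proj (\<lambda>\<zeta>. \<Phi> \<zeta> * G \<zeta>) z) \<le> K * (LINT \<zeta>|mT. cmod (G \<zeta>))"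
proof -
  have i2: "integrable mT (\<lambda>\<zeta>. \<Phi> \<zeta> * G \<zeta>)"
    using integrable_times_continuous[OF G \<Phi>] by (simp add: mult.commute)
  note j1 = integrable_mult_right[OF riesz_proj_integrable[OF G z], of c] and j2 = riesz_proj_integrable[OF i2 z]
  have "c * riesz_proj G z - riesz_proj (\<lambda>\<zeta>. \<Phi> \<zeta> * G \<zeta>) z
     = (LINT \<zeta>|mT. c * (G \<zeta> / (1 - cnj \<zeta> * z)) - \<Phi> \<zeta> * G \<zeta> / (1 - cnj \<zeta> * z))"
    unfolding riesz_proj_def integral_mult_right_zero[symmetric]
    by (rule Bochner_Integration.integral_diff[OF j1 j2, symmetric])
  also have "cmod \<dots> \<le> (LINT \<zeta>|mT. K * cmod (G \<zeta>))"
  proof (rule order_trans[OF integral_norm_bound], rule Bochner_Integration.integral_mono)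
    show "integrable mT (\<lambda>\<zeta>. cmod (c * (G \<zeta> / (1 - cnj \<zeta> * z)) - \<Phi> \<zeta> * G \<zeta> / (1 - cnj \<zeta> * z)))"
      by (intro integrable_norm Bochner_Integration.integrable_diff j1 j2)
    show "integrable mT (\<lambda>\<zeta>. K * cmod (G \<zeta>))" using G by auto
    fix \<zeta> assume "\<zeta> \<in> space mT"
    then have \<zeta>: "\<zeta> \<in> unit_circle" by simp
    have ne: "1 - cnj \<zeta> * z \<noteq> 0" using one_minus_ne[OF z \<zeta>] by (simp add: mult.commute)
    have "c * (G \<zeta> / (1 - cnj \<zeta> * z)) - \<Phi> \<zeta> * G \<zeta> / (1 - cnj \<zeta> * z) = (c - \<Phi> \<zeta>) / (1 - cnj \<zeta> * z) * G \<zeta>"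
      by (simp add: left_diff_distrib diff_divide_distrib)
    moreover have "cmod ((c - \<Phi> \<zeta>) / (1 - cnj \<zeta> * z)) \<le> K"
      using K[OF \<zeta>] ne by (simp add: norm_divide divide_le_eq)
    ultimately show "cmod (c * (G \<zeta> / (1 - cnj \<zeta> * z)) - \<Phi> \<zeta> * G \<zeta> / (1 - cnj \<zeta> * z)) \<le> K * cmod (G \<zeta>)"
      by (metis mult_right_mono norm_ge_zero norm_mult)
  qed
  finally show ?thesis by simp
qed

lemma root_prod_AE_nonzero: "finite U \<Longrightarrow> AE \<zeta> in mT. root_prod U k \<zeta> \<noteq> 0"
proof -
  assume fin: "finite U"
  have "AE \<zeta> in mT. \<forall>t\<in>U. \<zeta> \<noteq> t" by (intro AE_finite_allI fin AE_circle_neq)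
  then show ?thesis by eventually_elim (use fin root_prod_nonzero in blast)
qed

lemma root_prod_continuous: "continuous_on S (root_prod U k)"
  by (rule holomorphic_on_imp_continuous_on[OF root_prod_hol])

lemma root_prod_measurable [measurable]: "root_prod U k \<in> borel_measurable mT"
  by (rule continuous_imp_measurable_circle[OF root_prod_continuous])

lemma boundary_two_sided:
  assumes f: "f \<in> hardy 2"
    and b: "\<forall>z\<in>ball t \<epsilon>. cmod z < 1 \<longrightarrow> \<delta> * cmod (z - t) ^ k \<le> cmod (f z) \<and> cmod (f z) \<le> M * cmod (z - t) ^ k"
  shows "AE \<zeta> in mT. \<zeta> \<in> ball t \<epsilon> \<longrightarrow> \<delta> * cmod (\<zeta> - t) ^ k \<le> cmod (bv f \<zeta>)"
    and "AE \<zeta> in mT. \<zeta> \<in> ball t \<epsilon> \<longrightarrow> cmod (bv f \<zeta>) \<le> M * cmod (\<zeta> - t) ^ k"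
proof -
  have *: "AE \<zeta> in mT. \<zeta> \<in> ball t \<epsilon> \<longrightarrow> \<delta> * cmod (\<zeta> - t) ^ k \<le> cmod (bv f \<zeta>) \<and> cmod (bv f \<zeta>) \<le> M * cmod (\<zeta> - t) ^ k"
    using hardy2_radial_limit[OF f] AE_space
  proof eventually_elim
    case (elim \<zeta>)
    have c: "isCont (\<lambda>z. c * cmod (z - t) ^ k) \<zeta>" for c by (intro continuous_intros)
    show ?case
    proof (intro impI conjI)
      assume \<zeta>: "\<zeta> \<in> ball t \<epsilon>"
      show "\<delta> * cmod (\<zeta> - t) ^ k \<le> cmod (bv f \<zeta>)"
        by (rule radial_limit_bounds(2)[OF open_ball \<zeta> _ elim(1) c]) (use elim b in auto)
      show "cmod (bv f \<zeta>) \<le> M * cmod (\<zeta> - t) ^ k"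
        by (rule radial_limit_bounds(1)[OF open_ball \<zeta> _ elim(1) c]) (use elim b in auto)
    qed
  qed
  then show "AE \<zeta> in mT. \<zeta> \<in> ball t \<epsilon> \<longrightarrow> \<delta> * cmod (\<zeta> - t) ^ k \<le> cmod (bv f \<zeta>)"
    by eventually_elim blast
  show "AE \<zeta> in mT. \<zeta> \<in> ball t \<epsilon> \<longrightarrow> cmod (bv f \<zeta>) \<le> M * cmod (\<zeta> - t) ^ k"
    using * by eventually_elim blast
qed

lemma hardy2_affine_dominated:
  assumes f: "f \<in> hardy 2" and g: "g holomorphic_on unit_disc"
    and le: "\<And>z. cmod z < 1 \<Longrightarrow> cmod (g z) \<le> K * (1 + cmod (f z))"
  shows "g \<in> hardy 2"
proof (rule hardy2I(1)[where s=0 and B="K\<^sup>2 * (2 + 2 * hsum f)"])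
  fix r :: real assume r: "0 \<le> r" "r < 1"
  let ?m = "\<lambda>\<zeta>. 1 + complex_of_real (cmod (f (of_real r * \<zeta>)))"
  have c: "continuous_on unit_circle (\<lambda>\<zeta>. complex_of_real (cmod (f (of_real r * \<zeta>))))"
    by (intro continuous_intros continuous_on_dilate hardy2_hol f r)
  have nm: "cmod (?m \<zeta>) = 1 + cmod (f (of_real r * \<zeta>))" for \<zeta>
    by (metis abs_of_nonneg add_nonneg_nonneg norm_ge_zero norm_of_real of_real_1 of_real_add zero_le_one)
  have "sqn (\<lambda>\<zeta>. g (of_real r * \<zeta>)) \<le> K\<^sup>2 * sqn ?m"
  proof (rule sq_integrable_bound(2))
    show "sq_integrable ?m" by (intro sq_integrable_continuous continuous_intros c)
    show "(\<lambda>\<zeta>. g (of_real r * \<zeta>)) \<in> borel_measurable mT" by (rule dilate_measurable[OF g r])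
    show "AE \<zeta> in mT. cmod (g (of_real r * \<zeta>)) \<le> K * cmod (?m \<zeta>)"
      unfolding nm using r by (intro AE_I2 le) (simp add: norm_mult)
  qed
  also have "sqn ?m \<le> 2 * sqn (\<lambda>_. 1) + 2 * sqn (\<lambda>\<zeta>. complex_of_real (cmod (f (of_real r * \<zeta>))))"
    by (intro sq_integrable_add(2) sq_integrable_continuous c continuous_intros)
  also have "\<dots> = 2 + 2 * sqn (\<lambda>\<zeta>. f (of_real r * \<zeta>))"
    using mT.prob_space by (simp add: sqn_def)
  also have "\<dots> \<le> 2 + 2 * hsum f" using hardy2D(2)[OF f r] by simp
  finally show "sqn (\<lambda>\<zeta>. g (of_real r * \<zeta>)) \<le> K\<^sup>2 * (2 + 2 * hsum f)" by (simp add: mult_left_mono)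
qed (use g in auto)

text \<open>Near a point of \<open>V\<close> the zero of \<open>u\<close> keeps the quotient
  bounded; elsewhere the reciprocal polynomial is locally bounded and the quotient is dominated by
  \<open>u\<close>. Compactness merges both into one bound by a multiple of
  \<open>1 + cmod (u z)\<close>.\<close>

lemma divide_boundary_zeros:
  assumes u: "u \<in> hardy 2" and fin: "finite V" and V: "V \<subseteq> unit_circle"
    and b: "\<And>s. s \<in> V \<Longrightarrow> \<exists>\<epsilon>>0. \<exists>M. \<forall>z\<in>ball s \<epsilon>. cmod z < 1 \<longrightarrow> cmod (u z) \<le> M * cmod (z - s) ^ l s"
  shows "(\<lambda>z. u z / root_prod V l z) \<in> hardy 2"
proof -
  let ?R = "root_prod V l"
  have Rd: "?R z \<noteq> 0" if "cmod z < 1" for z using that V by (intro root_prod_nonzero fin) auto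
  have hol: "(\<lambda>z. u z / ?R z) holomorphic_on unit_disc"
    using Rd by (intro holomorphic_on_divide hardy2_hol u root_prod_hol) auto
  have "\<exists>M\<ge>0. \<forall>z. cmod z < 1 \<longrightarrow> cmod (u z / ?R z) \<le> M * (1 + cmod (u z))"
  proof (rule disc_bounded_global)
    fix x :: complex assume "x \<in> cball 0 1"
    show "\<exists>\<epsilon>>0. \<exists>M. \<forall>z\<in>ball x \<epsilon>. cmod z < 1 \<longrightarrow> cmod (u z / ?R z) \<le> M * (1 + cmod (u z))"
    proof (cases "x \<in> V")
      case True
      obtain \<epsilon> M where \<epsilon>: "\<epsilon> > 0" "\<forall>z\<in>ball x \<epsilon>. cmod z < 1 \<longrightarrow> cmod (u z) \<le> M * cmod (z - x) ^ l x"
        using b[OF True] by blast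
      let ?q = "\<lambda>\<zeta>. 1 / root_prod (V - {x}) l \<zeta>"
      have "root_prod (V - {x}) l x \<noteq> 0" using fin by (intro root_prod_nonzero) auto
      then have "isCont ?q x" by (intro continuous_intros root_prod_isCont)
      then obtain \<epsilon>' where \<epsilon>': "\<epsilon>' > 0" "\<forall>z\<in>ball x \<epsilon>'. cmod (?q z) \<le> cmod (?q x) + 1"
        using isCont_locally_bounded by blast
      show ?thesis
      proof (rule exI[of _ "min \<epsilon> \<epsilon>'"], rule conjI, simp add: \<epsilon> \<epsilon>',
          rule exI[of _ "\<bar>M\<bar> * (cmod (?q x) + 1)"], intro ballI impI)
        fix z assume z: "z \<in> ball x (min \<epsilon> \<epsilon>')" "cmod z < 1"
        have "x \<in> unit_circle" using True V by blast
        then have zx: "z \<noteq> x" using z(2) by auto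
        have "cmod (u z) \<le> M * cmod (z - x) ^ l x" using \<epsilon>(2) z by auto
        also have "\<dots> \<le> \<bar>M\<bar> * cmod (z - x) ^ l x" by (intro mult_right_mono) auto
        finally have *: "cmod (u z) / cmod (z - x) ^ l x \<le> \<bar>M\<bar>" using zx by (simp add: field_simps)
        have "cmod (u z / ?R z) = (cmod (u z) / cmod (z - x) ^ l x) * cmod (?q z)"
          by (simp add: root_prod_split[OF fin True] norm_mult norm_divide norm_power)
        also have "\<dots> \<le> \<bar>M\<bar> * (cmod (?q x) + 1)"
          using \<epsilon>'(2)[rule_format, of z] z by (intro mult_mono *) auto
        also have "\<dots> \<le> \<bar>M\<bar> * (cmod (?q x) + 1) * (1 + cmod (u z))"
          by (intro mult_left_mono[of 1 _ "\<bar>M\<bar> * (cmod (?q x) + 1)", simplified]) auto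
        finally show "cmod (u z / ?R z) \<le> \<bar>M\<bar> * (cmod (?q x) + 1) * (1 + cmod (u z))" .
      qed
    next
      case False
      let ?q = "\<lambda>\<zeta>. 1 / ?R \<zeta>"
      have "isCont ?q x" using root_prod_nonzero[OF fin False] by (intro continuous_intros root_prod_isCont)
      then obtain \<epsilon>' where \<epsilon>': "\<epsilon>' > 0" "\<forall>z\<in>ball x \<epsilon>'. cmod (?q z) \<le> cmod (?q x) + 1"
        using isCont_locally_bounded by blast
      show ?thesis
      proof (rule exI[of _ \<epsilon>'], rule conjI, rule \<epsilon>'(1), rule exI[of _ "cmod (?q x) + 1"], intro ballI impI)
        fix z assume "z \<in> ball x \<epsilon>'" "cmod z < 1"
        then have "cmod (?q z) * cmod (u z) \<le> (cmod (?q x) + 1) * (1 + cmod (u z))"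
          using \<epsilon>'(2) by (intro mult_mono) auto
        then show "cmod (u z / ?R z) \<le> (cmod (?q x) + 1) * (1 + cmod (u z))"
          by (simp add: norm_divide)
      qed
    qed
  qed auto
  then obtain M where "\<And>z. cmod z < 1 \<Longrightarrow> cmod (u z / ?R z) \<le> M * (1 + cmod (u z))" by blast
  then show ?thesis by (rule hardy2_affine_dominated[OF u hol])
qed

section \<open>Sufficiency: from (c) to the uniform bound on interior circles\<close>

lemma integral_norm_le:
  assumes "sq_integrable F"
  shows "(LINT \<zeta>|mT. cmod (F \<zeta>)) \<le> sqrt (sqn F)"
  by (rule real_le_rsqrt[OF integral_norm_le_sqn[OF assms]])

text \<open>With \<open>Q\<close> the product of the zeros of \<open>v\<close> at the poles of \<open>u\<close> and \<open>R\<close> that of the zeros of \<open>u\<close>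
  at the poles of \<open>v\<close>, one has \<open>R cnj v = cnj Q h\<close> on the circle with \<open>h\<close> bounded. Commuting \<open>R\<close> and
  \<open>cnj Q\<close> with the Riesz projection costs only terms bounded in the \<open>L\<^sup>1\<close> norm.\<close>

lemma Linfty_imp_dilation_bound:
  assumes u: "u \<in> hardy 2" and v: "v \<in> hardy 2"
    and K: "AE \<zeta> in mT. cmod (bv u \<zeta> * bv v \<zeta>) \<le> K"
    and fin: "finite (poles (bv u))" "finite (poles (bv v))"
    and an_u: "\<And>s. s \<in> poles (bv v) \<Longrightarrow> analytic_at_bdry u s"
    and an_v: "\<And>t. t \<in> poles (bv u) \<Longrightarrow> analytic_at_bdry v t"
    and nz: "cmod x < 1" "u x \<noteq> 0" "cmod y < 1" "v y \<noteq> 0"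
  shows "\<exists>C>0. dilation_bound u v C"
proof -
  define U where "U = poles (bv u)"
  define V where "V = poles (bv v)"
  have circ: "U \<subseteq> unit_circle" "V \<subseteq> unit_circle" by (auto simp: U_def V_def poles_def)
  note fin' = fin[folded U_def V_def]
  have um: "bv u \<in> borel_measurable mT" and vm: "bv v \<in> borel_measurable mT"
    by (intro bv_measurable hardy2_hol u v)+
  have "\<forall>t\<in>U. \<exists>k \<epsilon> \<delta> M. 0 < \<epsilon> \<and> 0 < \<delta> \<and> (\<forall>z\<in>ball t \<epsilon>. cmod z < 1 \<longrightarrow>
    \<delta> * cmod (z - t) ^ k \<le> cmod (v z) \<and> cmod (v z) \<le> M * cmod (z - t) ^ k)"
    using boundary_zero_order[OF hardy2_hol[OF v] an_v _ nz(3,4)] circ by (auto simp: U_def)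
  then obtain k where k: "\<And>t. t \<in> U \<Longrightarrow> \<exists>\<epsilon> \<delta> M. 0 < \<epsilon> \<and> 0 < \<delta> \<and> (\<forall>z\<in>ball t \<epsilon>. cmod z < 1 \<longrightarrow>
    \<delta> * cmod (z - t) ^ k t \<le> cmod (v z) \<and> cmod (v z) \<le> M * cmod (z - t) ^ k t)" by metis
  have "\<forall>s\<in>V. \<exists>l \<epsilon> \<delta> M. 0 < \<epsilon> \<and> 0 < \<delta> \<and> (\<forall>z\<in>ball s \<epsilon>. cmod z < 1 \<longrightarrow>
    \<delta> * cmod (z - s) ^ l \<le> cmod (u z) \<and> cmod (u z) \<le> M * cmod (z - s) ^ l)"
    using boundary_zero_order[OF hardy2_hol[OF u] an_u _ nz(1,2)] circ by (auto simp: V_def)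
  then obtain l where l: "\<And>s. s \<in> V \<Longrightarrow> \<exists>\<epsilon> \<delta> M. 0 < \<epsilon> \<and> 0 < \<delta> \<and> (\<forall>z\<in>ball s \<epsilon>. cmod z < 1 \<longrightarrow>
    \<delta> * cmod (z - s) ^ l s \<le> cmod (u z) \<and> cmod (u z) \<le> M * cmod (z - s) ^ l s)" by metis
  have vU: "\<exists>\<epsilon>>0. \<exists>\<delta>>0. AE \<zeta> in mT. \<zeta> \<in> ball t \<epsilon> \<longrightarrow> \<delta> * cmod (\<zeta> - t) ^ k t \<le> cmod (bv v \<zeta>)" if "t \<in> U" for t
    using k[OF that] boundary_two_sided(1)[OF v] by meson
  have vU': "\<exists>\<epsilon>>0. \<exists>M. AE \<zeta> in mT. \<zeta> \<in> ball t \<epsilon> \<longrightarrow> cmod (bv v \<zeta>) \<le> M * cmod (\<zeta> - t) ^ k t" if "t \<in> U" for t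
    using k[OF that] boundary_two_sided(2)[OF v] by meson
  have uV: "\<exists>\<epsilon>>0. \<exists>\<delta>>0. AE \<zeta> in mT. \<zeta> \<in> ball s \<epsilon> \<longrightarrow> \<delta> * cmod (\<zeta> - s) ^ l s \<le> cmod (bv u \<zeta>)" if "s \<in> V" for s
    using l[OF that] boundary_two_sided(1)[OF u] by meson
  have uV': "\<exists>\<epsilon>>0. \<exists>M. AE \<zeta> in mT. \<zeta> \<in> ball s \<epsilon> \<longrightarrow> cmod (bv u \<zeta>) \<le> M * cmod (\<zeta> - s) ^ l s" if "s \<in> V" for s
    using l[OF that] boundary_two_sided(2)[OF u] by meson
  \<comment> \<open>At a pole of \<open>v\<close> the function \<open>u\<close> is analytic, hence
    bounded nearby, so it has no pole there.\<close>
  have disj: "U \<inter> V = {}"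
  proof (rule ccontr)
    assume "U \<inter> V \<noteq> {}"
    then obtain s where s: "s \<in> U" "s \<in> V" by blast
    obtain \<epsilon> M where \<epsilon>: "\<epsilon> > 0" "AE \<zeta> in mT. \<zeta> \<in> ball s \<epsilon> \<longrightarrow> cmod (bv u \<zeta>) \<le> M * cmod (\<zeta> - s) ^ l s"
      using uV'[OF s(2)] by blast
    have "AE \<zeta> in mT. \<zeta> \<in> ball s \<epsilon> \<longrightarrow> cmod (bv u \<zeta>) \<le> \<bar>M\<bar> * \<epsilon> ^ l s"
      using \<epsilon>(2)
    proof eventually_elim
      case (elim \<zeta>)
      have "M * cmod (\<zeta> - s) ^ l s \<le> \<bar>M\<bar> * \<epsilon> ^ l s" if "\<zeta> \<in> ball s \<epsilon>"
        using that by (intro mult_mono power_mono) (auto simp: dist_norm norm_minus_commute)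
      then show ?case using elim by auto
    qed
    then have "locally_AE_bounded (bv u) s" unfolding locally_AE_bounded_def using \<epsilon>(1) by blast
    then show False using locally_bounded_not_pole[OF um] s(1) by (simp add: U_def)
  qed
  define Q where "Q = root_prod U k"
  define R where "R = root_prod V l"
  have LU: "locally_AE_bounded (bv u) \<zeta>" if "\<zeta> \<in> unit_circle - U" for \<zeta>
    using not_pole_locally_bounded[OF um] that by (simp add: U_def)
  have LV: "locally_AE_bounded (bv v) \<zeta>" if "\<zeta> \<in> unit_circle - V" for \<zeta>
    using not_pole_locally_bounded[OF vm] that by (simp add: V_def)
  obtain M1 where M1: "AE \<zeta> in mT. cmod (bv u \<zeta> * (Q \<zeta> / R \<zeta>)) \<le> M1"
    using quotient_bounded[OF fin' disj LU vU uV' K] unfolding Q_def R_def by blast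
  have K': "AE \<zeta> in mT. cmod (bv v \<zeta> * bv u \<zeta>) \<le> K" using K by (simp add: mult.commute)
  have disj': "V \<inter> U = {}" using disj by blast
  \<comment> \<open>The same quotient bound with the roles of \<open>u\<close> and \<open>v\<close>
    exchanged.\<close>
  obtain M2 where M2: "AE \<zeta> in mT. cmod (bv v \<zeta> * (R \<zeta> / Q \<zeta>)) \<le> M2"
    using quotient_bounded[OF fin'(2,1) disj' LV uV vU' K'] unfolding Q_def R_def by blast
  have Rd: "R z \<noteq> 0" if "cmod z < 1" for z unfolding R_def using that circ(2) by (intro root_prod_nonzero fin') auto
  define w where "w z = u z / R z" for z
  have w: "w \<in> hardy 2"
    unfolding w_def R_def
  proof (rule divide_boundary_zeros[OF u fin'(2) circ(2)])
    fix s assume "s \<in> V"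
    from l[OF this] show "\<exists>\<epsilon>>0. \<exists>M. \<forall>z\<in>ball s \<epsilon>. cmod z < 1 \<longrightarrow> cmod (u z) \<le> M * cmod (z - s) ^ l s" by blast
  qed
  have contQ: "continuous_on S Q" "isCont Q z" and contR: "continuous_on S R" "isCont R z" for S z
    unfolding Q_def R_def by (rule root_prod_continuous root_prod_isCont)+
  \<comment> \<open>The boundary function of this product is \<open>u Q / R\<close>, bounded by
    \<open>M1\<close>; the Poisson formula carries the bound into the disc.\<close>
  have wQ: "cmod (w z * Q z) \<le> M1" if z: "cmod z < 1" for z
  proof -
    have "bounded (Q ` cball 0 1)" by (intro compact_imp_bounded compact_continuous_image contQ) auto
    then obtain B where "\<forall>z\<in>cball 0 1. cmod (Q z) \<le> B" unfolding bounded_iff by blast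
    then have h: "(\<lambda>z. Q z * w z) \<in> hardy 2"
      unfolding Q_def by (intro hardy2_mult_bounded[OF w, where K=B] root_prod_hol) auto
    have "AE \<zeta> in mT. cmod (bv (\<lambda>z. Q z * w z) \<zeta>) \<le> M1"
      using M1 hardy2_radial_limit[OF u] root_prod_AE_nonzero[OF fin'(2), of l]
    proof eventually_elim
      case (elim \<zeta>)
      have "has_radial_limit (\<lambda>z. Q z * w z) \<zeta> (Q \<zeta> * (bv u \<zeta> / R \<zeta>))"
        unfolding w_def using elim(2,3) unfolding R_def[symmetric]
        by (intro has_radial_limit_mult has_radial_limit_divide has_radial_limit_isCont contQ contR)
      from bv_eqI[OF this] show ?case using elim(1) by (simp add: mult.commute)
    qed
    from hardy2_bounded_of_bv[OF h this z] show ?thesis by (simp add: mult.commute)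
  qed
  obtain LQ where LQ: "LQ \<ge> 0" "\<And>x y. x \<in> cball 0 2 \<Longrightarrow> y \<in> cball 0 2 \<Longrightarrow> cmod (Q x - Q y) \<le> LQ * cmod (x - y)"
    using root_prod_Lipschitz[of U k] unfolding Q_def by blast
  obtain LR where LR: "LR \<ge> 0" "\<And>x y. x \<in> cball 0 2 \<Longrightarrow> y \<in> cball 0 2 \<Longrightarrow> cmod (R x - R y) \<le> LR * cmod (x - y)"
    using root_prod_Lipschitz[of V l] unfolding R_def by blast
  define d where "d = (\<Sum>t\<in>U. k t)"
  have M20: "M2 \<ge> 0"
  proof -
    have "AE \<zeta> in mT. 0 \<le> M2" using M2 by eventually_elim (rule order_trans[OF norm_ge_zero])
    then show ?thesis by (simp add: mT.AE_const)
  qed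
  define h where "h \<zeta> = R \<zeta> * cnj (bv v \<zeta> / Q \<zeta>)" for \<zeta>
  have hm: "h \<in> borel_measurable mT"
    unfolding h_def using vm root_prod_measurable[of U k] root_prod_measurable[of V l]
    by (intro borel_measurable_times measurable_compose[OF _ cnj_borel_measurable] borel_measurable_divide)
       (simp_all add: Q_def R_def)
  have hb: "AE \<zeta> in mT. cmod (h \<zeta>) \<le> M2"
    using M2 by eventually_elim (simp add: h_def norm_mult norm_divide mult.commute)
  \<comment> \<open>\<open>A\<close> combines the bound of \<open>w Q\<close> with the factor of
    \<open>root_prod_reflect\<close>. \<open>B\<close> collects the two commutator errors, their L1
    norms being estimated by Cauchy-Schwarz.\<close>
  define A where "A = 2 ^ d * M1"
  define B where "B = 2 * LQ * M2 + LR * sqrt (sqn (bv v))"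
  have B0: "B \<ge> 0" using LQ(1) LR(1) M20 by (simp add: B_def)
  have point: "cmod (u z * riesz_proj (\<lambda>\<zeta>. cnj (bv v \<zeta>) * F \<zeta>) z) \<le>
      A * cmod (riesz_proj (\<lambda>\<zeta>. h \<zeta> * F \<zeta>) z) + cmod (w z) * (B * sqrt (sqn F))"
    if F: "sq_integrable F" and z: "1/2 \<le> cmod z" "cmod z < 1" for F z
  proof -
    define G where "G \<zeta> = cnj (bv v \<zeta>) * F \<zeta>" for \<zeta>
    define H where "H \<zeta> = h \<zeta> * F \<zeta>" for \<zeta>
    have iG: "integrable mT G" unfolding G_def by (rule conj_toeplitz_integrable[OF v F])
    have Hs: "sq_integrable H" "sqn H \<le> M2\<^sup>2 * sqn F"
      unfolding H_def by (rule sq_integrable_cmult[OF F hm hb])+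
    have iH: "integrable mT H" by (rule sq_integrable_imp_integrable[OF Hs(1)])
    have z0: "z \<noteq> 0" using z by auto
    have nG: "(LINT \<zeta>|mT. cmod (G \<zeta>)) \<le> sqrt (sqn (bv v)) * sqrt (sqn F)"
    proof -
      have "(LINT \<zeta>|mT. cmod (cnj (bv v \<zeta>) * F \<zeta>))\<^sup>2 \<le> sqn (\<lambda>\<zeta>. cnj (bv v \<zeta>)) * sqn F"
        by (intro Cauchy_Schwarz_norm sq_integrable_cnj hardy2_bv v F)
      then show ?thesis unfolding G_def real_sqrt_mult[symmetric] sqn_cnj by (rule real_le_rsqrt)
    qed
    have nH: "(LINT \<zeta>|mT. cmod (H \<zeta>)) \<le> M2 * sqrt (sqn F)"
    proof -
      have "(LINT \<zeta>|mT. cmod (H \<zeta>)) \<le> sqrt (sqn H)" by (rule integral_norm_le[OF Hs(1)])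
      also have "\<dots> \<le> sqrt (M2\<^sup>2 * sqn F)" using Hs(2) by (rule real_sqrt_le_mono)
      finally show ?thesis using M20 by (simp add: real_sqrt_mult)
    qed
    have 1: "cmod (R z * riesz_proj G z - riesz_proj (\<lambda>\<zeta>. R \<zeta> * G \<zeta>) z) \<le> LR * (LINT \<zeta>|mT. cmod (G \<zeta>))"
    proof (rule riesz_commutator[OF iG contR(1) z(2)])
      fix \<zeta> assume \<zeta>: "\<zeta> \<in> unit_circle"
      have "cmod (R z - R \<zeta>) \<le> LR * cmod (z - \<zeta>)" using \<zeta> z by (intro LR) auto
      also have "cmod (z - \<zeta>) = cmod (1 - cnj \<zeta> * z)"
        using cmod_one_minus_eq[OF \<zeta>, of z] by (simp add: norm_minus_commute mult.commute)
      finally show "cmod (R z - R \<zeta>) \<le> LR * cmod (1 - cnj \<zeta> * z)" .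
    qed
    \<comment> \<open>On the circle this is \<open>cnj (Q z)\<close>. Its distance to
      \<open>cnj (Q \<zeta>)\<close> is controlled by that of \<open>1 / cnj z\<close> to
      \<open>\<zeta>\<close>, which equals \<open>cmod (1 - cnj \<zeta> * z) / cmod z\<close>; the
      last division accounts for the factor 2.\<close>
    let ?c = "cnj (Q (1 / cnj z))"
    have 2: "cmod (?c * riesz_proj H z - riesz_proj (\<lambda>\<zeta>. cnj (Q \<zeta>) * H \<zeta>) z) \<le> (2 * LQ) * (LINT \<zeta>|mT. cmod (H \<zeta>))"
    proof (rule riesz_commutator[OF iH continuous_on_cnj[OF contQ(1)] z(2)])
      fix \<zeta> assume \<zeta>: "\<zeta> \<in> unit_circle"
      have nz: "cmod (1 / cnj z) \<le> 2" using z by (simp add: norm_divide divide_le_eq)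
      have "cmod (?c - cnj (Q \<zeta>)) = cmod (Q (1 / cnj z) - Q \<zeta>)"
        by (metis complex_cnj_diff complex_mod_cnj)
      also have "\<dots> \<le> LQ * cmod (1 / cnj z - \<zeta>)" using \<zeta> nz by (intro LQ) auto
      also have "1 / cnj z - \<zeta> = cnj (1 - cnj \<zeta> * z) / cnj z" using z0 by (simp add: field_simps)
      also have "LQ * cmod (cnj (1 - cnj \<zeta> * z) / cnj z) = LQ * (cmod (1 - cnj \<zeta> * z) / cmod z)"
        by (simp only: norm_divide complex_mod_cnj)
      also have "\<dots> \<le> LQ * (2 * cmod (1 - cnj \<zeta> * z))"
      proof (intro mult_left_mono LQ(1))
        have "cmod (1 - cnj \<zeta> * z) * 1 \<le> cmod (1 - cnj \<zeta> * z) * (2 * cmod z)"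
          using z by (intro mult_left_mono) auto
        then show "cmod (1 - cnj \<zeta> * z) / cmod z \<le> 2 * cmod (1 - cnj \<zeta> * z)"
          using z0 by (simp add: divide_le_eq mult_ac)
      qed
      finally show "cmod (?c - cnj (Q \<zeta>)) \<le> 2 * LQ * cmod (1 - cnj \<zeta> * z)" by simp
    qed
    have 3: "riesz_proj (\<lambda>\<zeta>. R \<zeta> * G \<zeta>) z = riesz_proj (\<lambda>\<zeta>. cnj (Q \<zeta>) * H \<zeta>) z"
    proof (rule riesz_proj_AE_cong[OF _ _ _ z(2)])
      show "AE \<zeta> in mT. R \<zeta> * G \<zeta> = cnj (Q \<zeta>) * H \<zeta>"
        using root_prod_AE_nonzero[OF fin'(1), of k]
        by eventually_elim (simp add: G_def H_def h_def Q_def)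
      show "integrable mT (\<lambda>\<zeta>. R \<zeta> * G \<zeta>)"
        using integrable_times_continuous[OF iG contR(1)] by (simp add: mult.commute)
      show "integrable mT (\<lambda>\<zeta>. cnj (Q \<zeta>) * H \<zeta>)"
        using integrable_times_continuous[OF iH continuous_on_cnj[OF contQ(1)]] by (simp add: mult.commute)
    qed
    have "cmod (R z * riesz_proj G z) \<le> cmod (?c * riesz_proj H z) + (2 * LQ) * (LINT \<zeta>|mT. cmod (H \<zeta>)) + LR * (LINT \<zeta>|mT. cmod (G \<zeta>))"
      using 1 2 norm_triangle_ineq2[of "R z * riesz_proj G z" "riesz_proj (\<lambda>\<zeta>. R \<zeta> * G \<zeta>) z"]
        norm_triangle_ineq3[of "?c * riesz_proj H z" "riesz_proj (\<lambda>\<zeta>. cnj (Q \<zeta>) * H \<zeta>) z"]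
      unfolding 3 by linarith
    also have "\<dots> \<le> cmod (?c * riesz_proj H z) + (2 * LQ) * (M2 * sqrt (sqn F)) + LR * (sqrt (sqn (bv v)) * sqrt (sqn F))"
      using LQ(1) LR(1) by (intro add_mono mult_left_mono nG nH order_refl) auto
    also have "\<dots> = cmod (Q (1 / cnj z)) * cmod (riesz_proj H z) + B * sqrt (sqn F)"
      unfolding B_def norm_mult complex_mod_cnj by (simp add: algebra_simps)
    also have "\<dots> \<le> 2 ^ d * cmod (Q z) * cmod (riesz_proj H z) + B * sqrt (sqn F)"
      using root_prod_reflect[OF fin'(1) circ(1) z(1), of k]
      by (intro add_right_mono mult_right_mono) (auto simp: Q_def d_def)
    finally have "cmod (w z) * cmod (R z * riesz_proj G z) \<le> cmod (w z) * (2 ^ d * cmod (Q z) * cmod (riesz_proj H z) + B * sqrt (sqn F))"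
      by (rule mult_left_mono) simp
    also have "\<dots> = 2 ^ d * cmod (w z * Q z) * cmod (riesz_proj H z) + cmod (w z) * (B * sqrt (sqn F))"
      by (simp add: algebra_simps norm_mult)
    also have "\<dots> \<le> A * cmod (riesz_proj H z) + cmod (w z) * (B * sqrt (sqn F))"
      unfolding A_def using wQ[OF z(2)] by (intro add_right_mono mult_right_mono mult_left_mono) auto
    also have "cmod (w z) * cmod (R z * riesz_proj G z) = cmod (u z * riesz_proj G z)"
      using Rd[OF z(2)] by (simp add: w_def norm_mult norm_divide)
    finally show ?thesis by (simp add: G_def[abs_def] H_def[abs_def])
  qed
  \<comment> \<open>Twice the squared bounds of the two terms in \<open>point\<close>; the summand 1
    ensures positivity.\<close>
  define C where "C = 2 * A\<^sup>2 * M2\<^sup>2 + 2 * hsum w * B\<^sup>2 + 1"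
  have hw: "hsum w \<ge> 0" using hardy2_hsum[OF w] sqn_nonneg[of "bv w"] by simp
  have "dilation_bound u v C"
    unfolding dilation_bound_def
  proof (intro allI impI)
    fix F r assume F: "sq_integrable F" and r: "(1::real)/2 \<le> r" "r < 1"
    have r0: "0 \<le> r" using r by simp
    define H where "H \<zeta> = h \<zeta> * F \<zeta>" for \<zeta>
    have Hs: "sq_integrable H" "sqn H \<le> M2\<^sup>2 * sqn F"
      unfolding H_def by (rule sq_integrable_cmult[OF F hm hb])+
    have P: "riesz_proj H \<in> hardy 2" by (rule riesz_proj_hardy2(1)[OF Hs(1)])
    let ?p = "\<lambda>\<zeta>. complex_of_real (A * cmod (riesz_proj H (of_real r * \<zeta>)))"
    let ?q = "\<lambda>\<zeta>. complex_of_real (cmod (w (of_real r * \<zeta>)) * (B * sqrt (sqn F)))"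
    have cp: "continuous_on unit_circle ?p" and cq: "continuous_on unit_circle ?q"
      by (intro continuous_intros continuous_on_dilate hardy2_hol P w r0 r(2))+
    note sp = sq_integrable_continuous[OF cp] and sq = sq_integrable_continuous[OF cq]
    have A0: "0 \<le> A"
      unfolding A_def using order_trans[OF norm_ge_zero wQ[of 0]] by simp
    have "sqn (\<lambda>\<zeta>. u (of_real r * \<zeta>) * riesz_proj (\<lambda>\<zeta>. cnj (bv v \<zeta>) * F \<zeta>) (of_real r * \<zeta>)) \<le> 1\<^sup>2 * sqn (\<lambda>\<zeta>. ?p \<zeta> + ?q \<zeta>)"
    proof (rule sq_integrable_bound(2)[OF sq_integrable_add(1)[OF sp sq]])
      show "(\<lambda>\<zeta>. u (of_real r * \<zeta>) * riesz_proj (\<lambda>\<zeta>. cnj (bv v \<zeta>) * F \<zeta>) (of_real r * \<zeta>)) \<in> borel_measurable mT"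
        by (intro borel_measurable_times dilate_measurable hardy2_hol u riesz_proj_hol conj_toeplitz_integrable v F r0 r(2))
      show "AE \<zeta> in mT. cmod (u (of_real r * \<zeta>) * riesz_proj (\<lambda>\<zeta>. cnj (bv v \<zeta>) * F \<zeta>) (of_real r * \<zeta>)) \<le> 1 * cmod (?p \<zeta> + ?q \<zeta>)"
      proof (rule AE_I2)
        fix \<zeta> assume "\<zeta> \<in> space mT"
        then have n: "cmod (of_real r * \<zeta>) = r" using r0 by (simp add: norm_mult)
        have pq: "0 \<le> A * cmod (riesz_proj H (of_real r * \<zeta>)) + cmod (w (of_real r * \<zeta>)) * (B * sqrt (sqn F))"
          using A0 B0 by simp
        show "cmod (u (of_real r * \<zeta>) * riesz_proj (\<lambda>\<zeta>. cnj (bv v \<zeta>) * F \<zeta>) (of_real r * \<zeta>)) \<le> 1 * cmod (?p \<zeta> + ?q \<zeta>)"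
          using point[OF F, of "of_real r * \<zeta>"] r unfolding n of_real_add[symmetric] norm_of_real abs_of_nonneg[OF pq] H_def by simp
      qed
    qed
    also have "\<dots> \<le> 2 * sqn ?p + 2 * sqn ?q" using sq_integrable_add(2)[OF sp sq] by simp
    also have "sqn ?p = A\<^sup>2 * sqn (\<lambda>\<zeta>. riesz_proj H (of_real r * \<zeta>))"
      unfolding sqn_def norm_of_real power2_abs power_mult_distrib by simp
    also have "sqn ?q = sqn (\<lambda>\<zeta>. w (of_real r * \<zeta>)) * (B\<^sup>2 * sqn F)"
      unfolding sqn_def norm_of_real power2_abs power_mult_distrib by (simp add: sqn_def[symmetric])
    also have "2 * (A\<^sup>2 * sqn (\<lambda>\<zeta>. riesz_proj H (of_real r * \<zeta>))) + 2 * (sqn (\<lambda>\<zeta>. w (of_real r * \<zeta>)) * (B\<^sup>2 * sqn F))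
       \<le> 2 * (A\<^sup>2 * (M2\<^sup>2 * sqn F)) + 2 * (hsum w * (B\<^sup>2 * sqn F))"
      using hardy2D(2)[OF P r0 r(2)] hardy2D(2)[OF w r0 r(2)] riesz_proj_hardy2(2)[OF Hs(1)] Hs(2)
      by (intro add_mono mult_left_mono mult_right_mono) auto
    also have "\<dots> \<le> C * sqn F" by (simp add: C_def algebra_simps)
    finally show "sqn (\<lambda>\<zeta>. u (of_real r * \<zeta>) * riesz_proj (\<lambda>\<zeta>. cnj (bv v \<zeta>) * F \<zeta>) (of_real r * \<zeta>)) \<le> C * sqn F" .
  qed
  moreover have "C > 0" using hw by (simp add: C_def add_nonneg_pos)
  ultimately show ?thesis by blast
qed

text \<open>As \<open>vm\<close> vanishes at 0, its conjugate has no Fourier coefficient of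
  nonnegative index, so \<open>vp\<close> and \<open>v\<close> share all Taylor coefficients. The
  conditions of admissibility on \<open>vp\<close> thereby become conditions on
  \<open>v\<close>.\<close>

lemma riesz_decomp_analytic:
  assumes v: "v \<in> hardy 2" and dec: "riesz_decomp (bv v) vm vp" and z: "cmod z < 1"
  shows "vp z = v z"
proof -
  obtain h where h: "h \<in> hardy 2" and vm: "vm = (\<lambda>z. z * h z)" and vp: "vp \<in> hardy 2"
    and ae: "AE \<zeta> in mT. bv v \<zeta> = cnj (bv vm \<zeta>) + bv vp \<zeta>"
    using dec unfolding riesz_decomp_def by blast
  have vmh: "vm \<in> hardy 2"
    unfolding vm by (rule hardy2_mult_bounded[OF h, where K=1]) auto
  have "fcoeff (bv v) n = fcoeff (bv vp) n" for n
  proof -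
    have i: "integrable mT (\<lambda>\<zeta>. cnj (bv vm \<zeta>) * cnj \<zeta> ^ n)" "integrable mT (\<lambda>\<zeta>. bv vp \<zeta> * cnj \<zeta> ^ n)"
      "integrable mT (\<lambda>\<zeta>. bv v \<zeta> * cnj \<zeta> ^ n)"
      by (intro integrable_times_continuous sq_integrable_imp_integrable sq_integrable_cnj hardy2_bv vmh vp v continuous_intros)+
    have "fcoeff (bv v) n = (LINT \<zeta>|mT. cnj (bv vm \<zeta>) * cnj \<zeta> ^ n + bv vp \<zeta> * cnj \<zeta> ^ n)"
      unfolding fcoeff_def
    proof (rule integral_cong_AE)
      show "AE \<zeta> in mT. bv v \<zeta> * cnj \<zeta> ^ n = cnj (bv vm \<zeta>) * cnj \<zeta> ^ n + bv vp \<zeta> * cnj \<zeta> ^ n"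
        using ae by eventually_elim (simp add: distrib_right)
    qed (intro borel_measurable_integrable i Bochner_Integration.integrable_add)+
    also have "\<dots> = (LINT \<zeta>|mT. cnj (bv vm \<zeta>) * cnj \<zeta> ^ n) + fcoeff (bv vp) n"
      unfolding fcoeff_def by (rule Bochner_Integration.integral_add[OF i(1,2)])
    also have "(LINT \<zeta>|mT. cnj (bv vm \<zeta>) * cnj \<zeta> ^ n) = cnj (LINT \<zeta>|mT. bv vm \<zeta> * \<zeta> ^ n)"
      by (subst Bochner_Integration.integral_cnj[symmetric]) simp
    also have "(LINT \<zeta>|mT. bv vm \<zeta> * \<zeta> ^ n) = 0"
    proof (cases "n = 0")
      case True
      have "fcoeff (bv vm) 0 = vm 0" using hardy2_fcoeff[OF vmh, of 0] by (simp add: tcoeff_def)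
      then show ?thesis using True by (simp add: fcoeff_def vm)
    next
      case False then show ?thesis using hardy2_negative_fcoeff[OF vmh] by simp
    qed
    finally show ?thesis by simp
  qed
  then have "tcoeff v n = tcoeff vp n" for n using hardy2_fcoeff v vp by metis
  then show ?thesis
    using tcoeff_sums[OF hardy2_hol[OF v] z] tcoeff_sums[OF hardy2_hol[OF vp] z] by (simp add: sums_unique2)
qed

section \<open>Assembling the equivalences\<close>

lemma poles_cong:
  assumes "\<And>\<zeta>. \<zeta> \<in> unit_circle \<Longrightarrow> f \<zeta> = g \<zeta>"
  shows "poles f = poles g"
proof -
  have "(f \<in> Linfty_on (ball \<zeta> \<epsilon> \<inter> unit_circle)) = (g \<in> Linfty_on (ball \<zeta> \<epsilon> \<inter> unit_circle))" for \<zeta> \<epsilon>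
  proof -
    have "set_borel_measurable mT (ball \<zeta> \<epsilon> \<inter> unit_circle) f = set_borel_measurable mT (ball \<zeta> \<epsilon> \<inter> unit_circle) g"
      unfolding set_borel_measurable_def by (intro measurable_cong) (simp add: assms)
    moreover have "(AE z in mT. z \<in> ball \<zeta> \<epsilon> \<inter> unit_circle \<longrightarrow> cmod (f z) \<le> M) = (AE z in mT. z \<in> ball \<zeta> \<epsilon> \<inter> unit_circle \<longrightarrow> cmod (g z) \<le> M)" for M
      by (intro AE_cong) (simp add: assms)
    ultimately show ?thesis by (simp add: Linfty_on_def)
  qed
  then show ?thesis by (simp add: poles_def)
qed

lemma analytic_at_bdry_cong:
  assumes "analytic_at_bdry f t" "\<And>z. cmod z < 1 \<Longrightarrow> f z = g z"
  shows "analytic_at_bdry g t"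
  using assms unfolding analytic_at_bdry_def by (metis IntD2 mem_ball_0)

theorem theorem5p7:
  fixes u v :: "complex \<Rightarrow> complex"
  assumes "u \<in> hardy 2" and "v \<in> hardy 2"
    and "admissible_toeplitz_pair u (bv v)"
    and "outer v"
  defines "a \<equiv> hardy2_bounded (toeplitz_product u (bv v))"
    and "b \<equiv> riesz_proj_bounded (\<lambda>\<zeta>. 1 / (cmod (bv v \<zeta>))\<^sup>2) (\<lambda>\<zeta>. (cmod (bv u \<zeta>))\<^sup>2)"
    and "c \<equiv> (\<lambda>\<zeta>. bv u \<zeta> * bv v \<zeta>) \<in> Linfty_on unit_circle"
    and "d \<equiv> bdd_above ((\<lambda>w. poisson (\<lambda>\<zeta>. (cmod (bv u \<zeta>))\<^sup>2) w *
                             poisson (\<lambda>\<zeta>. (cmod (bv v \<zeta>))\<^sup>2) w) ` unit_disc)"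
    and "e \<equiv> carleson_measure (boundary_measure (\<lambda>\<zeta>. (cmod (bv u \<zeta>))\<^sup>2))
               (ran_space (bv v)) (ran_inner (bv v))"
  shows "(a \<longleftrightarrow> b) \<and> (b \<longleftrightarrow> c) \<and> (c \<longleftrightarrow> d) \<and> (d \<longleftrightarrow> e)"
proof -
  note u = assms(1) and v = assms(2) and adm = assms(3) and out = assms(4)
  have m: "(\<lambda>\<zeta>. bv u \<zeta> * bv v \<zeta>) \<in> borel_measurable mT"
    by (intro borel_measurable_times bv_measurable hardy2_hol u v)
  have to_d: d if "\<exists>C\<ge>0. \<forall>F. circle_bounded F \<longrightarrow> two_weight_form u v F \<le> ennreal (C * sqn F)"
  proof -
    obtain C where "C \<ge> 0" "\<And>F. circle_bounded F \<Longrightarrow> two_weight_form u v F \<le> ennreal (C * sqn F)"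
      using \<open>\<exists>C\<ge>0. _ C\<close> by blast
    then show d
      unfolding d_def using two_weight_imp_poisson[OF u v]
      by (intro bdd_aboveI2[where M="4 * C"]) simp
  qed
  have ad: "a \<Longrightarrow> d" using to_d toeplitz_bounded_imp_two_weight[OF u v] by (simp add: a_def)
  have bd: "b \<Longrightarrow> d" using to_d riesz_bounded_imp_two_weight[OF u v] by (simp add: b_def)
  have ed: "e \<Longrightarrow> d" using to_d carleson_imp_two_weight[OF u v out] by (simp add: e_def)
  have dc: c if d
  proof -
    obtain K where K: "\<forall>w\<in>unit_disc. poisson (\<lambda>\<zeta>. (cmod (bv u \<zeta>))\<^sup>2) w * poisson (\<lambda>\<zeta>. (cmod (bv v \<zeta>))\<^sup>2) w \<le> K"
      using \<open>d\<close> unfolding d_def bdd_above_def by blast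
    have "poisson (\<lambda>\<zeta>. (cmod (bv u \<zeta>))\<^sup>2) w * poisson (\<lambda>\<zeta>. (cmod (bv v \<zeta>))\<^sup>2) w \<le> K" if "cmod w < 1" for w
      using K that by simp
    from poisson_imp_Linfty[OF u v this] show c
      unfolding c_def Linfty_on_circle_iff[OF m] by blast
  qed
  have bound: "\<exists>C>0. dilation_bound u v C" if c
  \<comment> \<open>The order of a boundary zero makes sense only for a function that is not
    identically 0; for \<open>u = 0\<close> the estimate is trivial.\<close>
  proof (cases "\<forall>z. cmod z < 1 \<longrightarrow> u z = 0")
    case True
    have "dilation_bound u v 1"
      unfolding dilation_bound_def
    proof (intro allI impI)
      fix F r assume r: "(1::real)/2 \<le> r" "r < 1"
      have "sqn (\<lambda>\<zeta>. u (of_real r * \<zeta>) * riesz_proj (\<lambda>\<zeta>. cnj (bv v \<zeta>) * F \<zeta>) (of_real r * \<zeta>)) = sqn (\<lambda>_. 0)"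
        using True r by (intro sqn_cong) (simp add: norm_mult)
      also have "\<dots> = 0" by (simp add: sqn_def)
      finally show "sqn (\<lambda>\<zeta>. u (of_real r * \<zeta>) * riesz_proj (\<lambda>\<zeta>. cnj (bv v \<zeta>) * F \<zeta>) (of_real r * \<zeta>)) \<le> 1 * sqn F"
        by simp
    qed
    then show ?thesis by (intro exI[of _ 1]) simp
  next
    case False
    then obtain x where x: "cmod x < 1" "u x \<noteq> 0" by blast
    obtain K where K: "AE \<zeta> in mT. cmod (bv u \<zeta> * bv v \<zeta>) \<le> K"
      using \<open>c\<close> unfolding c_def Linfty_on_circle_iff[OF m] by blast
    obtain vm vp where dec: "riesz_decomp (bv v) vm vp"
      and fin: "finite (poles (bv u))" "finite (poles (bv vp))"
      and an_u: "\<forall>\<zeta>\<in>poles (bv vp). analytic_at_bdry u \<zeta>" and an_vp: "\<forall>\<zeta>\<in>poles (bv u). analytic_at_bdry vp \<zeta>"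
      using adm unfolding admissible_toeplitz_pair_def Let_def finite_Un by blast
    note eq = riesz_decomp_analytic[OF v dec]
    have poles_eq: "poles (bv vp) = poles (bv v)"
      using eq by (intro poles_cong bv_cong)
    \<comment> \<open>An outer function is a unimodular constant times an exponential, so it has no
      zeros in the disc.\<close>
    have v0: "v 0 \<noteq> 0"
      using out unfolding outer_def by fastforce
    show ?thesis
    proof (rule Linfty_imp_dilation_bound[OF u v K fin(1) _ _ _ x _ v0])
      show "analytic_at_bdry v t" if "t \<in> poles (bv u)" for t
        using an_vp that eq by (blast intro: analytic_at_bdry_cong)
    qed (use fin an_u in \<open>simp_all add: poles_eq\<close>)
  qed
  have "c \<Longrightarrow> a" "c \<Longrightarrow> b" "c \<Longrightarrow> e"
    using bound dilation_bound_imp_toeplitz[OF u v] dilation_bound_imp_riesz[OF u v out] dilation_bound_imp_carleson[OF u v]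
    unfolding a_def b_def e_def by blast+
  then show ?thesis using ad bd ed dc by blast
qed

end
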